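(* Let $n$ be a positive integer, let $\epsilon>0$, and let $G$ be a subgroup of the symmetric group $S_n$. For real $H\ge 1$ let $$N_n(H;G)=\#\{(a_1,\ldots,a_n)\in\mathbf{Z}^n : |a_i|\le H\ (1\le i\le n) \text{ and } X^n+a_1X^{n-1}+\cdots+a_n \text{ has Galois group } G\}.$$ Then there is a constant $C=C(n,\epsilon)>0$ such that for all $H\ge 1$, $$N_n(H;G)\le C\, H^{\,n-1+\delta_G+\epsilon},\qquad\text{where } \delta_G=\frac{1}{|S_n/G|}$$ and $|S_n/G|$ denotes the index of $G$ in $S_n$.
   Context: The Galois group of a monic polynomial $f\in\mathbf{Z}[X]$ of degree $n$ means the Galois group of the splitting field of $f$ over $\mathbf{Q}$, regarded as a permutation group on the $n$ complex roots of $f$ (listed with multiplicity), hence as a subgroup of $S_n$ after labelling the roots. The paper uses the notation $\ll_{n,\epsilon}$, i.e. the implied constant depends only on $n$ and $\epsilon$. *)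

theory Defs
  imports
    Complex_Main
    "HOL-Computational_Algebra.Polynomial"
    "HOL-Algebra.Bij"
    "HOL-Algebra.Generated_Fields"
    "HOL-Algebra.Sym_Groups"
    "HOL-Algebra.Algebraic_Closure_Type"
begin

abbreviation complex_ring :: "complex ring" where
  "complex_ring \<equiv> ring_of_type_algebra"

abbreviation complex_poly :: "int poly \<Rightarrow> complex poly" where
  "complex_poly f \<equiv> map_poly of_int f"

definition splitting_field :: "int poly \<Rightarrow> complex set" where
  "splitting_field f =
     generate_field complex_ring (\<rat> \<union> {z. poly (complex_poly f) z = 0})"

text \<open>As in \<^const>\<open>AutoGroup\<close>, the automorphisms are extensional functions, so that each
  automorphism of the splitting field over \<open>\<rat>\<close> is represented exactly once.\<close>

definition galois_group :: "int poly \<Rightarrow> (complex \<Rightarrow> complex) monoid" where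
  "galois_group f =
     (let K = splitting_field f; R = complex_ring\<lparr>carrier := K\<rparr>
      in BijGroup K \<lparr>carrier := {\<sigma> \<in> ring_hom R R \<inter> Bij K. \<forall>q\<in>\<rat>. \<sigma> q = q}\<rparr>)"

definition root_labelling :: "nat \<Rightarrow> int poly \<Rightarrow> (nat \<Rightarrow> complex) \<Rightarrow> bool" where
  "root_labelling n f \<alpha> \<longleftrightarrow> complex_poly f = (\<Prod>i=1..n. [:- \<alpha> i, 1:])"

text \<open>A labelling of the roots turns the Galois group into a group of permutations of the labels.
  If the roots are distinct, the permutation \<open>\<phi> \<sigma>\<close> is determined by
  \<open>\<sigma> (\<alpha> i) = \<alpha> (\<phi> \<sigma> i)\<close>, and the groups obtained from different labellings are precisely the
  conjugates of one of them. If there are repeated roots, \<open>\<sigma>\<close> alone does not say how it acts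
  on the labels of equal roots; any action of the Galois group on the labels
  that is compatible with its action on the roots is admitted.\<close>

definition has_galois_group :: "nat \<Rightarrow> int poly \<Rightarrow> (nat \<Rightarrow> nat) set \<Rightarrow> bool" where
  "has_galois_group n f G \<longleftrightarrow>
     (\<exists>\<alpha> \<phi>. root_labelling n f \<alpha> \<and>
        \<phi> \<in> iso (galois_group f) ((sym_group n)\<lparr>carrier := G\<rparr>) \<and>
        (\<forall>\<sigma>\<in>carrier (galois_group f). \<forall>i\<in>{1..n}. \<sigma> (\<alpha> i) = \<alpha> (\<phi> \<sigma> i)))"

definition monic_poly :: "nat \<Rightarrow> (nat \<Rightarrow> int) \<Rightarrow> int poly" where
  "monic_poly n a = monom 1 n + (\<Sum>i=1..n. monom (a i) (n - i))"

definition galois_count :: "nat \<Rightarrow> real \<Rightarrow> (nat \<Rightarrow> nat) set \<Rightarrow> nat" where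
  "galois_count n H G =
     card {a \<in> {1..n} \<rightarrow>\<^sub>E (UNIV :: int set).
             (\<forall>i\<in>{1..n}. \<bar>real_of_int (a i)\<bar> \<le> H) \<and> has_galois_group n (monic_poly n a) G}"

lemma finite_galois_count_set:
  "finite {a \<in> {1..n} \<rightarrow>\<^sub>E (UNIV :: int set).
             (\<forall>i\<in>{1..n}. \<bar>real_of_int (a i)\<bar> \<le> H) \<and> has_galois_group n (monic_poly n a) G}"
proof (rule finite_subset)
  show "finite ({1..n} \<rightarrow>\<^sub>E {- \<lfloor>H\<rfloor>..\<lfloor>H\<rfloor>})"
    by (intro finite_PiE) auto
  have "\<bar>real_of_int z\<bar> \<le> H \<Longrightarrow> z \<in> {- \<lfloor>H\<rfloor>..\<lfloor>H\<rfloor>}" for z :: int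
    by (simp add: le_floor_iff abs_le_iff minus_le_iff[of "\<lfloor>H\<rfloor>"])
  then show "{a \<in> {1..n} \<rightarrow>\<^sub>E (UNIV :: int set).
             (\<forall>i\<in>{1..n}. \<bar>real_of_int (a i)\<bar> \<le> H) \<and> has_galois_group n (monic_poly n a) G}
      \<subseteq> {1..n} \<rightarrow>\<^sub>E {- \<lfloor>H\<rfloor>..\<lfloor>H\<rfloor>}"
    by (auto simp: PiE_def Pi_def)
qed

definition sym_index :: "nat \<Rightarrow> (nat \<Rightarrow> nat) set \<Rightarrow> nat" where
  "sym_index n G = card (rcosets\<^bsub>sym_group n\<^esub> G)"

end

theory Submission
  imports
    Defs
    "HOL-Library.Poly_Mapping"
    "HOL-Computational_Algebra.Formal_Laurent_Series"
    "HOL-Computational_Algebra.Squarefree"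
begin

text \<open>The box of coefficient vectors is cut into lines \<open>f = f\<^sub>0 + t W\<close>, where \<open>W\<close> is a fixed monic
  integer polynomial of degree \<open>n - 1\<close> with Galois group \<open>S\<^bsub>n-1\<^esub>\<close>; such a \<open>W\<close> exists by the
  theorem for \<open>n - 1\<close>. Near \<open>t = \<infinity>\<close> all but one of the roots of \<open>f\<close> are close to the roots of \<open>W\<close>, and
  the remaining one has a pole. This shows that \<open>f\<close> has Galois group \<open>S\<^sub>n\<close> over \<open>\<rat>(t)\<close> unless \<open>W\<close>
  divides \<open>f\<^sub>0\<close>, which happens for one \<open>f\<^sub>0\<close> only.

  Let \<open>\<theta>\<close> be a polynomial in the roots with stabiliser \<open>G\<close>. If \<open>f\<close> has Galois group \<open>G\<close> then
  \<open>z = \<theta>(\<alpha>)\<close> is an integer, a zero of the resolvent \<open>F(z, t) = \<Prod>(z - \<theta>\<^sub>c)\<close>, which has degree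
  \<open>d = |S\<^sub>n/G|\<close> in \<open>z\<close> and distinct conjugate roots that are permuted transitively. So it suffices to bound
  by \<open>H\<^bsup>1/d+\<epsilon>\<^esup>\<close> the number of \<open>t\<close> in \<open>[-H, H]\<close> with an integral point \<open>(z, t)\<close> on this curve.

  This is an \<open>l\<close>-adic variant of the method of Bombieri and Pila. Let \<open>q = l\<^bsup>e\<^esup>\<close> be a prime power of size
  about \<open>H\<^bsup>1/d+\<epsilon>\<^esup>\<close> with \<open>l\<close> small and not dividing \<open>F\<^sub>z(z, t)\<close>. On a class of points with \<open>z\<close> fixed
  modulo \<open>l\<close> and \<open>t\<close> fixed modulo \<open>q\<close>, Hensel's lemma gives \<open>z\<close> as an \<open>l\<close>-adic power series in \<open>t\<close>, and
  the pigeonhole principle yields a nonzero form \<open>g(z, t)\<close> of degree less than \<open>d\<close> in \<open>z\<close> that vanishes on the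
  class. The norm of \<open>g\<close> is a nonzero polynomial in \<open>t\<close> of bounded degree, so each class
  contains boundedly many \<open>t\<close>.\<close>

section \<open>Integer polynomials in countably many variables\<close>

text \<open>All constants must be uniform over the slices, of which there are about
  \<open>H ^ (n - 1)\<close>. So every auxiliary quantity is one fixed integer polynomial in the
  roots, in \<open>t\<close> and in free parameters; if it is symmetric in the roots, a slice turns
  it into a polynomial in \<open>t\<close> whose degree is bounded independently of the slice. The
  parameters of \<open>theta\<close> vary with the slice, but within a finite set that depends on
  \<open>n\<close> and \<open>G\<close> only.

  Galois theory enters through the permutations that preserve all integer polynomial relations
  between the roots. This notion makes sense for complex numbers and for Laurent series, so the same
  invariants serve at an integer \<open>t\<close> and at the generic point.

  A prime power is used as modulus because primes in prescribed intervals are then avoided: some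
  small prime misses a given nonzero integer of polynomial size, and its powers reach every size up
  to a factor \<open>l\<close>. The prime may change with \<open>t\<close>.

  The existence of \<open>W\<close> is not circular. The bound in degree \<open>m + 1\<close> uses
  \<open>W\<close> of degree \<open>m\<close>, and it shows that the proper subgroups, having index
  at least 2, cannot fill the box in degree \<open>m + 1\<close>.\<close>

type_synonym mpol = "(nat \<Rightarrow>\<^sub>0 nat) \<Rightarrow>\<^sub>0 int"

definition mvar :: "nat \<Rightarrow> mpol" where
  "mvar k = Poly_Mapping.single (Poly_Mapping.single k 1) 1"

definition meval_monom :: "(nat \<Rightarrow> 'a::comm_ring_1) \<Rightarrow> (nat \<Rightarrow>\<^sub>0 nat) \<Rightarrow> 'a" where
  "meval_monom \<rho> m = (\<Prod>k\<in>Poly_Mapping.keys m. \<rho> k ^ Poly_Mapping.lookup m k)"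

definition meval :: "(nat \<Rightarrow> 'a::comm_ring_1) \<Rightarrow> mpol \<Rightarrow> 'a" where
  "meval \<rho> P = (\<Sum>m\<in>Poly_Mapping.keys P. of_int (Poly_Mapping.lookup P m) * meval_monom \<rho> m)"

lemma meval_monom_superset:
  assumes "finite A" "Poly_Mapping.keys m \<subseteq> A"
  shows "meval_monom \<rho> m = (\<Prod>k\<in>A. \<rho> k ^ Poly_Mapping.lookup m k)"
  unfolding meval_monom_def using assms
  by (intro prod.mono_neutral_left) (auto simp: Poly_Mapping.in_keys_iff)

lemma meval_superset:
  assumes "finite A" "Poly_Mapping.keys P \<subseteq> A"
  shows "meval \<rho> P = (\<Sum>m\<in>A. of_int (Poly_Mapping.lookup P m) * meval_monom \<rho> m)"
  unfolding meval_def using assms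
  by (intro sum.mono_neutral_left) (auto simp: Poly_Mapping.in_keys_iff)

lemma meval_monom_add: "meval_monom \<rho> (m + m') = meval_monom \<rho> m * meval_monom \<rho> m'"
proof -
  let ?A = "Poly_Mapping.keys m \<union> Poly_Mapping.keys m'"
  have "meval_monom \<rho> (m + m') = (\<Prod>k\<in>?A. \<rho> k ^ Poly_Mapping.lookup (m + m') k)"
    by (rule meval_monom_superset) (auto dest: Poly_Mapping.keys_add[THEN subsetD])
  also have "\<dots> = meval_monom \<rho> m * meval_monom \<rho> m'"
    by (simp add: meval_monom_superset[of ?A] lookup_add power_add prod.distrib)
  finally show ?thesis .
qed

lemma meval_add: "meval \<rho> (P + Q) = meval \<rho> P + meval \<rho> Q"
proof -
  let ?A = "Poly_Mapping.keys P \<union> Poly_Mapping.keys Q"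
  have "meval \<rho> (P + Q) = (\<Sum>m\<in>?A. of_int (Poly_Mapping.lookup (P + Q) m) * meval_monom \<rho> m)"
    by (rule meval_superset) (auto dest: Poly_Mapping.keys_add[THEN subsetD])
  also have "\<dots> = meval \<rho> P + meval \<rho> Q"
    by (simp add: meval_superset[of ?A] lookup_add distrib_right sum.distrib)
  finally show ?thesis .
qed

lemma meval_0: "meval \<rho> 0 = 0" by (simp add: meval_def)

lemma meval_single: "meval \<rho> (Poly_Mapping.single m a) = of_int a * meval_monom \<rho> m"
  by (subst meval_superset[of "{m}"]) auto

lemma mpol_single_induct:
  fixes P :: mpol
  assumes s: "\<And>m a. Q (Poly_Mapping.single m a)" and a: "\<And>p q. Q p \<Longrightarrow> Q q \<Longrightarrow> Q (p + q)"
  shows "Q P"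
proof (induction P rule: update_induct)
  case const
  show ?case using s[of 0 0] by simp
next
  case (update f m a)
  have "Poly_Mapping.update m a f = f + Poly_Mapping.single m a"
    using update.hyps by (intro poly_mapping_eqI)
      (auto simp: lookup_update lookup_add lookup_single Poly_Mapping.in_keys_iff when_def)
  then show ?case using a[OF update.IH s] by simp
qed

lemma meval_mult: "meval \<rho> (P * Q) = meval \<rho> P * meval \<rho> Q"
proof (induction P rule: mpol_single_induct)
  case (1 m a)
  show ?case
    by (induction Q rule: mpol_single_induct)
      (simp_all add: mult_single meval_single meval_monom_add meval_add distrib_left algebra_simps)
qed (simp add: meval_add distrib_right)

lemma meval_of_int [simp]: "meval \<rho> (of_int c) = of_int c"
proof -
  have n: "meval \<rho> (of_nat n) = of_nat n" for n
    by (induction n) (simp_all add: meval_add meval_0 meval_single[of \<rho> 0 1, simplified] meval_monom_def)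
  have m: "meval \<rho> (- P) = - meval \<rho> P" for P
    using meval_add[of \<rho> P "- P"] by (simp add: meval_0 eq_neg_iff_add_eq_0 add.commute)
  show ?thesis by (cases c rule: int_cases2) (simp_all add: n m)
qed

lemma meval_1 [simp]: "meval \<rho> 1 = 1" using meval_of_int[of \<rho> 1] by simp
lemma meval_of_nat [simp]: "meval \<rho> (of_nat c) = of_nat c" using meval_of_int[of \<rho> "int c"] by simp
lemma meval_var [simp]: "meval \<rho> (mvar k) = \<rho> k"
  by (simp add: mvar_def meval_single meval_monom_def)

lemma meval_minus: "meval \<rho> (- P) = - meval \<rho> P"
  using meval_add[of \<rho> P "- P"] by (simp add: meval_0 eq_neg_iff_add_eq_0 add.commute)

lemma meval_diff: "meval \<rho> (P - Q) = meval \<rho> P - meval \<rho> Q"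
  using meval_add[of \<rho> P "- Q"] by (simp add: meval_minus)

lemma meval_sum: "meval \<rho> (sum f A) = (\<Sum>i\<in>A. meval \<rho> (f i))"
  by (induction A rule: infinite_finite_induct) (simp_all add: meval_add meval_0)

lemma meval_prod: "meval \<rho> (prod f A) = (\<Prod>i\<in>A. meval \<rho> (f i))"
  by (induction A rule: infinite_finite_induct) (simp_all add: meval_mult)

lemma meval_power: "meval \<rho> (P ^ k) = meval \<rho> P ^ k"
  by (induction k) (simp_all add: meval_mult)

lemmas meval_hom = meval_0 meval_add meval_minus meval_diff meval_mult meval_sum meval_prod meval_power

lemma mpol_induct [case_names const var add mult]:
  fixes P :: mpol
  assumes c: "\<And>c. Q (of_int c)" and v: "\<And>k. Q (mvar k)"
    and a: "\<And>p q. Q p \<Longrightarrow> Q q \<Longrightarrow> Q (p + q)" and m: "\<And>p q. Q p \<Longrightarrow> Q q \<Longrightarrow> Q (p * q)"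
  shows "Q P"
proof (induction P rule: mpol_single_induct)
  case (1 m a)
  have one: "Q 1" using c[of 1] by simp
  have pw: "Q (mvar k ^ e)" for k e by (induction e) (simp_all add: one v m)
  have pweq: "mvar k ^ e = Poly_Mapping.single (Poly_Mapping.single k e) 1" for k e
    by (induction e) (simp_all add: mvar_def mult_single single_add[symmetric])
  have mon: "Q (Poly_Mapping.single m 1)" for m :: "nat \<Rightarrow>\<^sub>0 nat"
  proof (induction m rule: update_induct)
    case const
    show ?case using one by simp
  next
    case (update f k e)
    have "Poly_Mapping.update k e f = f + Poly_Mapping.single k e"
      using update.hyps by (intro poly_mapping_eqI)
        (auto simp: lookup_update lookup_add lookup_single Poly_Mapping.in_keys_iff when_def)
    then show ?case using m[OF update.IH pw[of k e]] by (simp add: pweq mult_single)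
  qed
  have "Poly_Mapping.single m a = of_int a * Poly_Mapping.single m 1"
    by (simp add: mult_single flip: single_of_int)
  then show ?case using m[OF c[of a] mon[of m]] by simp
qed (rule a)

lemma meval_meval: "meval \<rho> (meval \<eta> P) = meval (\<lambda>k. meval \<rho> (\<eta> k)) P"
  by (induction P rule: mpol_induct) (simp_all add: meval_hom)

lemma meval_mvar [simp]: "meval mvar P = P"
  by (induction P rule: mpol_induct) (simp_all add: meval_hom)

lemma mvar_inj: "mvar i = mvar j \<longleftrightarrow> i = j"
proof
  assume "mvar i = mvar j"
  then have "meval (\<lambda>k. int k) (mvar i) = meval (\<lambda>k. int k) (mvar j)" by simp
  then show "i = j" by simp
qed simp

text \<open>\<open>D\<close> depends on \<open>P\<close> alone. Applied to a symmetric polynomial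
  expressed through coefficients that are linear in \<open>t\<close>, this bounds the number of
  exceptional \<open>t\<close> uniformly over all slices.\<close>

lemma meval_degree_bound:
  "\<exists>D. \<forall>\<rho> :: nat \<Rightarrow> int poly. (\<forall>k. Polynomial.degree (\<rho> k) \<le> 1) \<longrightarrow> Polynomial.degree (meval \<rho> P) \<le> D"
proof (induction P rule: mpol_induct)
  case (const c)
  then show ?case by auto
next
  case (var k)
  then show ?case by auto
next
  case (add p q)
  then obtain D D' where "\<forall>\<rho> :: nat \<Rightarrow> int poly. (\<forall>k. Polynomial.degree (\<rho> k) \<le> 1) \<longrightarrow> Polynomial.degree (meval \<rho> p) \<le> D"
    "\<forall>\<rho> :: nat \<Rightarrow> int poly. (\<forall>k. Polynomial.degree (\<rho> k) \<le> 1) \<longrightarrow> Polynomial.degree (meval \<rho> q) \<le> D'"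
    by blast
  then show ?case
    by (intro exI[of _ "D + D'"]) (auto simp: meval_hom intro!: Polynomial.degree_add_le intro: trans_le_add1 trans_le_add2)
next
  case (mult p q)
  then obtain D D' where "\<forall>\<rho> :: nat \<Rightarrow> int poly. (\<forall>k. Polynomial.degree (\<rho> k) \<le> 1) \<longrightarrow> Polynomial.degree (meval \<rho> p) \<le> D"
    "\<forall>\<rho> :: nat \<Rightarrow> int poly. (\<forall>k. Polynomial.degree (\<rho> k) \<le> 1) \<longrightarrow> Polynomial.degree (meval \<rho> q) \<le> D'"
    by blast
  then show ?case
    by (intro exI[of _ "D + D'"]) (auto simp: meval_hom intro!: order_trans[OF Polynomial.degree_mult_le] add_mono)
qed

text \<open>Roots of size \<open>O(H)\<close> thus give invariants of polynomial size in
  \<open>H\<close>, with constants depending on \<open>P\<close> only.\<close>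

lemma meval_size_bound:
  "\<exists>C\<ge>0. \<exists>K. \<forall>(\<rho> :: nat \<Rightarrow> complex) B. B \<ge> 1 \<longrightarrow> (\<forall>k. norm (\<rho> k) \<le> B) \<longrightarrow> norm (meval \<rho> P) \<le> C * B ^ K"
proof (induction P rule: mpol_induct)
  case (const c)
  show ?case by (intro exI[of _ "\<bar>of_int c\<bar>"] conjI exI[of _ 0]) auto
next
  case (var k)
  show ?case by (intro exI[of _ 1] conjI exI[of _ "1::nat"]) auto
next
  case (add p q)
  then obtain C K C' K' where *: "C \<ge> 0" "C' \<ge> 0"
    "\<And>(\<rho> :: nat \<Rightarrow> complex) B. B \<ge> 1 \<Longrightarrow> (\<forall>k. norm (\<rho> k) \<le> B) \<Longrightarrow> norm (meval \<rho> p) \<le> C * B ^ K"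
    "\<And>(\<rho> :: nat \<Rightarrow> complex) B. B \<ge> 1 \<Longrightarrow> (\<forall>k. norm (\<rho> k) \<le> B) \<Longrightarrow> norm (meval \<rho> q) \<le> C' * B ^ K'"
    by metis
  show ?case
  proof (intro exI[of _ "C + C'"] conjI exI[of _ "K + K'"] allI impI)
    fix \<rho> :: "nat \<Rightarrow> complex" and B :: real
    assume B: "B \<ge> 1" "\<forall>k. norm (\<rho> k) \<le> B"
    have "norm (meval \<rho> (p + q)) \<le> C * B ^ K + C' * B ^ K'"
      using *(3)[OF B] *(4)[OF B] by (simp add: meval_hom norm_triangle_le)
    also have "\<dots> \<le> C * B ^ (K + K') + C' * B ^ (K + K')"
      using * B by (intro add_mono mult_left_mono power_increasing) auto
    finally show "norm (meval \<rho> (p + q)) \<le> (C + C') * B ^ (K + K')" by (simp add: algebra_simps)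
  qed (use * in auto)
next
  case (mult p q)
  then obtain C K C' K' where *: "C \<ge> 0" "C' \<ge> 0"
    "\<And>(\<rho> :: nat \<Rightarrow> complex) B. B \<ge> 1 \<Longrightarrow> (\<forall>k. norm (\<rho> k) \<le> B) \<Longrightarrow> norm (meval \<rho> p) \<le> C * B ^ K"
    "\<And>(\<rho> :: nat \<Rightarrow> complex) B. B \<ge> 1 \<Longrightarrow> (\<forall>k. norm (\<rho> k) \<le> B) \<Longrightarrow> norm (meval \<rho> q) \<le> C' * B ^ K'"
    by metis
  show ?case
  proof (intro exI[of _ "C * C'"] conjI exI[of _ "K + K'"] allI impI)
    fix \<rho> :: "nat \<Rightarrow> complex" and B :: real
    assume B: "B \<ge> 1" "\<forall>k. norm (\<rho> k) \<le> B"
    have "norm (meval \<rho> (p * q)) \<le> (C * B ^ K) * (C' * B ^ K')"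
      using *(1,2) *(3)[OF B] *(4)[OF B] B by (simp add: meval_hom norm_mult mult_mono)
    then show "norm (meval \<rho> (p * q)) \<le> (C * C') * B ^ (K + K')" by (simp add: power_add algebra_simps)
  qed (use * in auto)
qed

section \<open>Symmetric functions\<close>

definition rootpoly :: "nat \<Rightarrow> (nat \<Rightarrow> 'a::comm_ring_1) \<Rightarrow> 'a poly" where
  "rootpoly n x = (\<Prod>i=1..n. [:- x i, 1:])"

text \<open>An index \<open>k\<close> in \<open>1..n\<close> receives a signed elementary symmetric
  function, numbered like the coefficients \<open>a_1, ..., a_n\<close>. Every other index keeps its
  value, so that \<open>t\<close> at index 0 and parameters beyond \<open>n\<close> pass through as
  constants.\<close>

definition esub :: "nat \<Rightarrow> (nat \<Rightarrow> 'a::comm_ring_1) \<Rightarrow> nat \<Rightarrow> 'a" where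
  "esub n x k = (if k \<in> {1..n} then Polynomial.coeff (rootpoly n x) (n - k) else x k)"

definition symm :: "nat \<Rightarrow> mpol \<Rightarrow> bool" where
  "symm n R \<longleftrightarrow> (\<forall>\<tau>. \<tau> permutes {1..n} \<longrightarrow> meval (\<lambda>k. mvar (\<tau> k)) R = R)"

lemma rootpoly_0 [simp]: "rootpoly 0 x = 1"
  by (simp add: rootpoly_def)

lemma rootpoly_Suc: "rootpoly (Suc n) x = rootpoly n x * [:- x (Suc n), 1:]"
  by (simp add: rootpoly_def)

lemma coeff_rootpoly_Suc:
  "Polynomial.coeff (rootpoly (Suc n) x) j =
     (case j of 0 \<Rightarrow> 0 | Suc i \<Rightarrow> Polynomial.coeff (rootpoly n x) i) - x (Suc n) * Polynomial.coeff (rootpoly n x) j"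
  by (simp add: rootpoly_Suc coeff_pCons split: nat.split)

lemma degree_rootpoly_le: "Polynomial.degree (rootpoly n x) \<le> n"
proof (induction n)
  case (Suc n)
  have "Polynomial.degree (rootpoly (Suc n) x) \<le> Polynomial.degree (rootpoly n x) + Polynomial.degree [:- x (Suc n), 1:]"
    unfolding rootpoly_Suc by (rule Polynomial.degree_mult_le)
  then show ?case using Suc by simp
qed simp

lemma coeff_rootpoly_top [simp]: "Polynomial.coeff (rootpoly n x) n = 1"
proof (induction n)
  case (Suc n)
  have "Polynomial.coeff (rootpoly n x) (Suc n) = 0"
    using degree_rootpoly_le[of n x] by (intro coeff_eq_0) auto
  then show ?case using Suc by (simp add: coeff_rootpoly_Suc)
qed simp

lemma degree_rootpoly [simp]: "Polynomial.degree (rootpoly n x) = n"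
  using degree_rootpoly_le[of n x] le_degree[of "rootpoly n x" n] by simp

lemma poly_rootpoly: "poly (rootpoly n x) y = (\<Prod>i=1..n. y - x i)"
  by (simp add: rootpoly_def poly_prod)

lemma meval_coeff_rootpoly:
  "meval \<rho> (Polynomial.coeff (rootpoly n x) j) = Polynomial.coeff (rootpoly n (\<lambda>k. meval \<rho> (x k))) j"
proof (induction n arbitrary: j)
  case 0
  then show ?case by (cases j) (auto simp: meval_hom)
next
  case (Suc n)
  then show ?case by (auto simp: coeff_rootpoly_Suc meval_hom split: nat.split)
qed

lemma meval_esub: "meval \<rho> (esub n mvar k) = esub n \<rho> k"
  by (simp add: esub_def meval_coeff_rootpoly)

lemma meval_meval_esub: "meval \<rho> (meval (esub n mvar) P) = meval (esub n \<rho>) P"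
  by (simp add: meval_meval meval_esub)

lemma rootpoly_permute:
  assumes "\<tau> permutes {1..n}"
  shows "rootpoly n (\<lambda>k. x (\<tau> k)) = rootpoly n x"
  unfolding rootpoly_def by (subst prod.permute[OF assms]) (simp add: o_def)

lemma esub_permute:
  assumes "\<tau> permutes {1..n}"
  shows "esub n (\<lambda>k. x (\<tau> k)) k = esub n x k"
  using assms by (simp add: esub_def rootpoly_permute permutes_not_in)

definition subalg :: "nat \<Rightarrow> mpol set" where
  "subalg n = range (meval (esub n mvar))"

lemma subalg_closed:
  "of_int c \<in> subalg n" "p \<in> subalg n \<Longrightarrow> q \<in> subalg n \<Longrightarrow> p + q \<in> subalg n"
  "p \<in> subalg n \<Longrightarrow> q \<in> subalg n \<Longrightarrow> p * q \<in> subalg n"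
  "p \<in> subalg n \<Longrightarrow> - p \<in> subalg n" "esub n mvar k \<in> subalg n"
proof -
  show "of_int c \<in> subalg n" unfolding subalg_def by (rule range_eqI[of _ _ "of_int c"]) simp
  show "esub n mvar k \<in> subalg n" unfolding subalg_def by (rule range_eqI[of _ _ "mvar k"]) simp
  show "- p \<in> subalg n" if p: "p \<in> subalg n"
  proof -
    obtain P where "p = meval (esub n mvar) P" using p by (auto simp: subalg_def)
    then show ?thesis unfolding subalg_def by (intro range_eqI[of _ _ "- P"]) (simp add: meval_hom)
  qed
  show "p + q \<in> subalg n" "p * q \<in> subalg n" if p: "p \<in> subalg n" and q: "q \<in> subalg n"
  proof -
    obtain P Q where "p = meval (esub n mvar) P" "q = meval (esub n mvar) Q"
      using p q by (auto simp: subalg_def)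
    then show "p + q \<in> subalg n" "p * q \<in> subalg n" unfolding subalg_def
      by (auto intro: range_eqI[of _ _ "P + Q"] range_eqI[of _ _ "P * Q"] simp: meval_hom)
  qed
qed

lemma subalg_0: "0 \<in> subalg n" using subalg_closed(1)[of 0 n] by simp
lemma subalg_1: "1 \<in> subalg n" using subalg_closed(1)[of 1 n] by simp

lemma subalg_permute:
  assumes "p \<in> subalg n" "\<tau> permutes {1..n}"
  shows "meval (\<lambda>k. mvar (\<tau> k)) p = p"
  using assms by (auto simp: subalg_def meval_meval meval_esub esub_permute)

text \<open>\<open>V\<close> is a ring, because the last variable is a zero of the monic
  \<open>rootpoly N mvar\<close> and its powers beyond \<open>n\<close> reduce. It contains the
  elementary symmetric functions of the first \<open>n\<close> variables, because those are the
  coefficients of \<open>rootpoly N mvar\<close> divided by \<open>X - x_N\<close>.\<close>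

lemma subalg_span:
  fixes n :: nat
  defines "N \<equiv> Suc n"
  defines "V \<equiv> {\<Sum>k\<le>n. c k * mvar N ^ k | c. \<forall>k. c k \<in> subalg N}"
  assumes R: "R \<in> subalg n"
  shows "R \<in> V"
proof -
  have VI: "(\<Sum>k\<le>n. c k * mvar N ^ k) \<in> V" if "\<And>k. c k \<in> subalg N" for c
    using that unfolding V_def by blast
  have sum_V: "p + q \<in> V" if pq: "p \<in> V" "q \<in> V" for p q
  proof -
    obtain c c' where c: "\<And>k. c k \<in> subalg N" "p = (\<Sum>k\<le>n. c k * mvar N ^ k)"
      "\<And>k. c' k \<in> subalg N" "q = (\<Sum>k\<le>n. c' k * mvar N ^ k)"
      using pq unfolding V_def by blast
    have "p + q = (\<Sum>k\<le>n. (c k + c' k) * mvar N ^ k)"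
      by (simp add: c(2,4) distrib_right sum.distrib)
    then show ?thesis using VI[of "\<lambda>k. c k + c' k"] c by (simp add: subalg_closed)
  qed
  have scale_V: "s * p \<in> V" if sp: "s \<in> subalg N" "p \<in> V" for s p
  proof -
    obtain c where c: "\<And>k. c k \<in> subalg N" "p = (\<Sum>k\<le>n. c k * mvar N ^ k)"
      using sp unfolding V_def by blast
    have "s * p = (\<Sum>k\<le>n. (s * c k) * mvar N ^ k)"
      by (simp add: c(2) sum_distrib_left mult.assoc)
    then show ?thesis using VI[of "\<lambda>k. s * c k"] c sp by (simp add: subalg_closed)
  qed
  have base_V: "s \<in> V" if "s \<in> subalg N" for s
  proof -
    have "(\<Sum>k\<le>n. (if k = 0 then s else 0) * mvar N ^ k) = s"
      by (subst sum.remove[of _ 0]) auto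
    then show ?thesis using VI[of "\<lambda>k. if k = 0 then s else 0"] that by (auto simp: subalg_0)
  qed
  have pow_V: "mvar N ^ k \<in> V" if "k \<le> n" for k
  proof -
    have "(\<Sum>j\<le>n. (if j = k then 1 else 0) * mvar N ^ j) = (\<Sum>j\<in>{k}. mvar N ^ j)"
      using that by (intro sum.mono_neutral_cong_right) auto
    then show ?thesis using VI[of "\<lambda>j. if j = k then 1 else 0"] by (auto simp: subalg_0 subalg_1)
  qed
  have vsum_V: "sum f A \<in> V" if "\<And>i. i \<in> A \<Longrightarrow> f i \<in> V" for f :: "nat \<Rightarrow> mpol" and A
    using that by (induction A rule: infinite_finite_induct) (auto intro: sum_V base_V subalg_0)
  \<comment> \<open>The equation \<open>rootpoly N mvar = 0\<close> at \<open>x_N\<close>, solved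
    for the leading power.\<close>
  have top: "mvar N ^ N \<in> V"
  proof -
    let ?r = "rootpoly N (mvar :: nat \<Rightarrow> mpol)"
    have cf: "Polynomial.coeff ?r j \<in> subalg N" if "j < N" for j
    proof -
      have "esub N mvar (N - j) = Polynomial.coeff ?r j"
        using that by (auto simp: esub_def)
      then show ?thesis using subalg_closed(5)[of N "N - j"] by simp
    qed
    have "0 = poly ?r (mvar N)"
      unfolding poly_rootpoly by (simp add: N_def)
    also have "\<dots> = (\<Sum>j\<le>N. Polynomial.coeff ?r j * mvar N ^ j)"
      by (simp add: poly_altdef)
    also have "\<dots> = (\<Sum>j\<le>n. Polynomial.coeff ?r j * mvar N ^ j) + mvar N ^ N"
    proof -
      have "Polynomial.coeff ?r (Suc n) = 1" using coeff_rootpoly_top[of N] by (simp only: N_def)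
      then show ?thesis by (simp add: N_def)
    qed
    finally have "mvar N ^ N = (\<Sum>j\<le>n. (- Polynomial.coeff ?r j) * mvar N ^ j)"
      by (simp add: sum_negf eq_neg_iff_add_eq_0 add.commute)
    also have "\<dots> \<in> V"
    proof (rule vsum_V)
      fix j assume "j \<in> {..n}"
      then show "(- Polynomial.coeff ?r j) * mvar N ^ j \<in> V"
        by (intro scale_V pow_V subalg_closed(4) cf) (auto simp: N_def)
    qed
    finally show ?thesis .
  qed
  have shift_V: "mvar N * p \<in> V" if p: "p \<in> V" for p
  proof -
    obtain c where c: "\<And>k. c k \<in> subalg N" "p = (\<Sum>k\<le>n. c k * mvar N ^ k)"
      using p unfolding V_def by blast
    have "mvar N * p = (\<Sum>k\<le>n. c k * mvar N ^ Suc k)"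
      by (simp add: c(2) sum_distrib_left algebra_simps)
    also have "\<dots> \<in> V"
    proof (rule vsum_V)
      fix k assume k: "k \<in> {..n}"
      have "mvar N ^ Suc k \<in> V"
      proof (cases "k = n")
        case True
        then show ?thesis using top by (simp only: N_def)
      next
        case False
        then show ?thesis using pow_V[of "Suc k"] k by auto
      qed
      then show "c k * mvar N ^ Suc k \<in> V" using c scale_V by blast
    qed
    finally show ?thesis .
  qed
  have powall: "mvar N ^ k * p \<in> V" if "p \<in> V" for k p
    by (induction k) (use that shift_V in \<open>auto simp: mult.assoc\<close>)
  have mult_V: "p * q \<in> V" if pq: "p \<in> V" "q \<in> V" for p q
  proof -
    obtain c where c: "\<And>k. c k \<in> subalg N" "p = (\<Sum>k\<le>n. c k * mvar N ^ k)"
      using pq unfolding V_def by blast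
    have "p * q = (\<Sum>k\<le>n. c k * (mvar N ^ k * q))"
      by (simp add: c(2) sum_distrib_right mult.assoc)
    also have "\<dots> \<in> V" by (intro vsum_V scale_V[OF c(1)] powall pq(2))
    finally show ?thesis .
  qed
  have xN: "mvar N \<in> V" using shift_V[OF base_V[OF subalg_1]] by simp
  \<comment> \<open>Horner's scheme for the division by \<open>X - x_N\<close>, from the leading
    coefficient downwards.\<close>
  have e_V: "Polynomial.coeff (rootpoly n mvar) (n - k) \<in> V" if "k \<le> n" for k
    using that
  proof (induction k)
    case 0
    then show ?case by (auto intro: base_V subalg_1)
  next
    case (Suc k)
    have "Polynomial.coeff (rootpoly N mvar) (n - k) =
        Polynomial.coeff (rootpoly n mvar) (n - Suc k) - mvar N * Polynomial.coeff (rootpoly n mvar) (n - k)"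
    proof -
      have "n - k = Suc (n - Suc k)" using Suc.prems by simp
      then show ?thesis by (simp add: N_def coeff_rootpoly_Suc)
    qed
    moreover have "esub N mvar (Suc k) = Polynomial.coeff (rootpoly N mvar) (n - k)"
      using Suc.prems by (simp add: esub_def N_def)
    ultimately have "Polynomial.coeff (rootpoly n mvar) (n - Suc k) =
        esub N mvar (Suc k) + mvar N * Polynomial.coeff (rootpoly n mvar) (n - k)" by simp
    moreover have "esub N mvar (Suc k) \<in> V" by (intro base_V subalg_closed)
    ultimately show ?case using Suc shift_V sum_V by simp
  qed
  have var_V: "esub n mvar k \<in> V" for k
  proof (cases "k \<in> {1..n}")
    case True
    then show ?thesis using e_V[of k] by (simp add: esub_def)
  next
    case False
    show ?thesis
    proof (cases "k = N")
      case True
      then show ?thesis using xN by (simp add: esub_def N_def)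
    next
      case False
      then have "esub n mvar k = esub N mvar k" using \<open>k \<notin> {1..n}\<close> by (auto simp: esub_def N_def)
      then show ?thesis using base_V[OF subalg_closed(5)] by simp
    qed
  qed
  have "meval (esub n mvar) P \<in> V" for P
    by (induction P rule: mpol_induct)
      (auto simp: meval_hom var_V sum_V mult_V base_V subalg_closed(1))
  then show ?thesis using R by (auto simp: subalg_def)
qed

lemma poly_eq_0_of_roots:
  fixes q :: "'a::idom poly"
  assumes "\<And>i. i \<in> A \<Longrightarrow> poly q (f i) = 0" "inj_on f A" "Polynomial.degree q < card A"
  shows "q = 0"
  by (rule poly_eqI_degree[of "f ` A"]) (use assms in \<open>auto simp: card_image\<close>)

lemma symm_mono: "symm n R \<Longrightarrow> m \<le> n \<Longrightarrow> symm m R"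
  unfolding symm_def using permutes_subset[of _ "{1..m}" "{1..n}"] by fastforce

text \<open>By induction \<open>R\<close> is a polynomial of degree at most \<open>n\<close> in
  \<open>x_N\<close> whose coefficients are already symmetric in all \<open>N = n + 1\<close>
  variables. Minus \<open>R\<close>, this polynomial has the \<open>N\<close> zeros
  \<open>x_1, ..., x_N\<close>, so it is zero and \<open>R\<close> equals its constant
  coefficient.\<close>

theorem symmetric_function_theorem:
  assumes "symm n R"
  shows "\<exists>P. R = meval (esub n mvar) P"
  using assms
proof (induction n)
  case 0
  have "esub 0 (mvar :: nat \<Rightarrow> mpol) = mvar" by (auto simp: esub_def)
  then show ?case by (metis meval_mvar)
next
  case (Suc n)
  let ?N = "Suc n"
  have "R \<in> subalg n" using Suc.IH[OF symm_mono[OF Suc.prems]] by (auto simp: subalg_def)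
  then obtain c where c: "\<And>k. c k \<in> subalg ?N" and R: "R = (\<Sum>k\<le>n. c k * mvar ?N ^ k)"
    using subalg_span by blast
  \<comment> \<open>Exchanging \<open>x_N\<close> and \<open>x_j\<close> fixes \<open>R\<close> and
    the coefficients and changes only the powers.\<close>
  have *: "R = (\<Sum>k\<le>n. c k * mvar j ^ k)" if "j \<in> {1..?N}" for j
  proof -
    let ?t = "Transposition.transpose j ?N"
    have t: "?t permutes {1..?N}" using that by (intro permutes_swap_id) auto
    have "R = meval (\<lambda>k. mvar (?t k)) R" using Suc.prems t by (auto simp: symm_def)
    also have "\<dots> = (\<Sum>k\<le>n. c k * mvar j ^ k)"
      by (subst R) (simp add: meval_hom subalg_permute[OF c t])
    finally show ?thesis .
  qed
  define q where "q = (\<Sum>k\<le>n. Polynomial.monom (c k) k) - [:R:]"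
  have pq: "poly q y = (\<Sum>k\<le>n. c k * y ^ k) - R" for y
    by (simp add: q_def poly_sum poly_monom)
  have "Polynomial.degree q \<le> n" unfolding q_def
    by (intro Polynomial.degree_diff_le degree_sum_le) (auto intro: order_trans[OF degree_monom_le])
  then have "q = 0"
    using * by (intro poly_eq_0_of_roots[of "{1..?N}" q mvar]) (auto simp: pq inj_on_def mvar_inj)
  then have "poly q 0 = 0" by simp
  then have "R = c 0" unfolding pq by (simp add: power_0_left sum.delta if_distrib cong: if_cong)
  then show ?case using c[of 0] by (auto simp: subalg_def)
qed

text \<open>For the stabiliser of the last index: what it fixes is a polynomial in the last variable
  over the fully symmetric ones. For roots this means a polynomial in one root over the
  coefficients.\<close>

corollary almost_symmetric_expansion:
  assumes "symm n R"
  shows "\<exists>P. R = (\<Sum>k\<le>n. meval (esub (Suc n) mvar) (P k) * mvar (Suc n) ^ k)"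
proof -
  have "R \<in> subalg n" using symmetric_function_theorem[OF assms] by (auto simp: subalg_def)
  from subalg_span[OF this] obtain c where c: "\<And>k. c k \<in> subalg (Suc n)"
    and R: "R = (\<Sum>k\<le>n. c k * mvar (Suc n) ^ k)" by blast
  have "\<forall>k. \<exists>p. c k = meval (esub (Suc n) mvar) p" using c by (auto simp: subalg_def)
  then obtain P where "\<And>k. c k = meval (esub (Suc n) mvar) (P k)" by metis
  then show ?thesis using R by auto
qed

section \<open>Relation-preserving permutations of roots\<close>

definition perms :: "nat \<Rightarrow> (nat \<Rightarrow> nat) set" where
  "perms n = {\<tau>. \<tau> permutes {1..n}}"

lemma mem_perms [simp]: "\<tau> \<in> perms n \<longleftrightarrow> \<tau> permutes {1..n}" by (simp add: perms_def)

lemma finite_perms [simp]: "finite (perms n)" by (simp add: perms_def finite_permutations)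

lemma perms_compose: "\<sigma> \<in> perms n \<Longrightarrow> \<tau> \<in> perms n \<Longrightarrow> (\<lambda>k. \<sigma> (\<tau> k)) \<in> perms n"
  using permutes_compose[of \<tau> "{1..n}" \<sigma>] by (simp add: o_def)

lemma bij_perms_left:
  assumes "\<tau> \<in> perms n"
  shows "bij_betw (\<lambda>\<sigma> k. \<tau> (\<sigma> k)) (perms n) (perms n)"
proof (rule bij_betw_byWitness[where f' = "\<lambda>\<sigma> k. inv_into UNIV \<tau> (\<sigma> k)"])
  show "\<forall>\<sigma>\<in>perms n. (\<lambda>k. inv_into UNIV \<tau> (\<tau> (\<sigma> k))) = \<sigma>"
    using assms by (auto simp: permutes_inverses)
  show "\<forall>\<sigma>\<in>perms n. (\<lambda>k. \<tau> (inv_into UNIV \<tau> (\<sigma> k))) = \<sigma>"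
    using assms by (auto simp: permutes_inverses)
  show "(\<lambda>\<sigma> k. \<tau> (\<sigma> k)) ` perms n \<subseteq> perms n" using perms_compose[OF assms] by blast
  have "inv_into UNIV \<tau> \<in> perms n" using assms by (simp add: permutes_inv)
  then show "(\<lambda>\<sigma> k. inv_into UNIV \<tau> (\<sigma> k)) ` perms n \<subseteq> perms n" using perms_compose by blast
qed

section \<open>Evaluation of integer polynomials in commutative rings\<close>

text \<open>The same integer polynomial is evaluated at complex numbers, at power and Laurent series
  and at elements of \<open>mpol\<close>.\<close>

definition ipeval :: "int poly \<Rightarrow> 'a::comm_ring_1 \<Rightarrow> 'a" where
  "ipeval p y = poly (map_poly of_int p) y"

lemma ipeval_pCons: "ipeval (pCons a p) y = of_int a + y * ipeval p y"
  by (simp add: ipeval_def map_poly_pCons)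

lemma ipeval_0 [simp]: "ipeval 0 y = 0" by (simp add: ipeval_def)
lemma ipeval_const [simp]: "ipeval [:a:] y = of_int a" by (simp add: ipeval_pCons)
lemma ipeval_1 [simp]: "ipeval 1 y = 1" by (simp add: one_pCons)
lemma ipeval_X [simp]: "ipeval [:0, 1:] y = y" by (simp add: ipeval_pCons)

lemma ipeval_add: "ipeval (p + q) y = ipeval p y + ipeval q y"
  by (induction p q rule: poly_induct2) (simp_all add: ipeval_pCons algebra_simps)

lemma ipeval_smult: "ipeval (Polynomial.smult a p) y = of_int a * ipeval p y"
  by (induction p) (simp_all add: ipeval_pCons algebra_simps)

lemma ipeval_mult: "ipeval (p * q) y = ipeval p y * ipeval q y"
  by (induction p) (simp_all add: ipeval_pCons ipeval_add ipeval_smult algebra_simps)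

lemma ipeval_of_int [simp]: "ipeval (of_int a) y = of_int a"
  by (simp add: of_int_poly)

lemma ipeval_minus: "ipeval (- p) y = - ipeval p y"
  using ipeval_smult[of "-1" p y] by simp

lemma ipeval_diff: "ipeval (p - q) y = ipeval p y - ipeval q y"
  using ipeval_add[of p "- q" y] by (simp add: ipeval_minus)

lemma ipeval_power: "ipeval (p ^ k) y = ipeval p y ^ k"
  by (induction k) (simp_all add: ipeval_mult)

lemma ipeval_sum: "ipeval (sum f A) y = (\<Sum>i\<in>A. ipeval (f i) y)"
  by (induction A rule: infinite_finite_induct) (simp_all add: ipeval_add)

lemma ipeval_meval: "ipeval (meval \<rho> P) y = meval (\<lambda>k. ipeval (\<rho> k) y) P"
  by (induction P rule: mpol_induct) (simp_all add: meval_hom ipeval_add ipeval_mult)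

lemma ipeval_of_int_arg: "ipeval p (of_int y) = of_int (poly p y)"
  by (induction p) (simp_all add: ipeval_pCons)

section \<open>The action on variables and Lagrange interpolation over an orbit\<close>

definition pact :: "(nat \<Rightarrow> nat) \<Rightarrow> mpol \<Rightarrow> mpol" where
  "pact \<sigma> P = meval (\<lambda>k. mvar (\<sigma> k)) P"

lemma meval_pact [simp]: "meval \<rho> (pact \<sigma> P) = meval (\<lambda>k. \<rho> (\<sigma> k)) P"
  by (simp add: pact_def meval_meval)

lemma symm_alt: "symm n R \<longleftrightarrow> (\<forall>\<tau>\<in>perms n. pact \<tau> R = R)"
  by (auto simp: symm_def pact_def)

text \<open>Lagrange interpolation over the orbit of \<open>L\<close>: at \<open>Z = pact \<pi> L\<close> only the term of \<open>\<pi>\<close>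
  survives, although the coefficients with respect to \<open>Z\<close> are symmetric.\<close>

definition lagr :: "nat \<Rightarrow> mpol \<Rightarrow> mpol \<Rightarrow> mpol \<Rightarrow> mpol" where
  "lagr n Z L P = (\<Sum>\<sigma>\<in>perms n. pact \<sigma> P * (\<Prod>\<sigma>'\<in>perms n - {\<sigma>}. Z - pact \<sigma>' L))"

lemma symm_lagr:
  assumes "symm n Z"
  shows "symm n (lagr n Z L P)"
  unfolding symm_alt
proof
  fix \<tau> assume \<tau>: "\<tau> \<in> perms n"
  let ?f = "\<lambda>\<sigma> k. \<tau> (\<sigma> k)"
  note b = bij_perms_left[OF \<tau>]
  have "pact \<tau> (lagr n Z L P) =
      (\<Sum>\<sigma>\<in>perms n. pact (?f \<sigma>) P * (\<Prod>\<sigma>'\<in>perms n - {\<sigma>}. Z - pact (?f \<sigma>') L))"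
    using assms \<tau> by (simp add: lagr_def pact_def[of \<tau>] meval_hom symm_def) (simp add: pact_def)
  also have "\<dots> = (\<Sum>\<sigma>\<in>perms n. pact (?f \<sigma>) P * (\<Prod>\<sigma>'\<in>perms n - {?f \<sigma>}. Z - pact \<sigma>' L))"
  proof (rule sum.cong[OF refl])
    fix \<sigma> assume \<sigma>: "\<sigma> \<in> perms n"
    have "bij_betw ?f (perms n - {\<sigma>}) (perms n - {?f \<sigma>})"
      using b \<sigma> perms_compose[OF \<tau> \<sigma>] by (intro bij_betw_DiffI) (auto simp: bij_betw_def)
    from prod.reindex_bij_betw[OF this, of "\<lambda>\<sigma>'. Z - pact \<sigma>' L"]
    show "pact (?f \<sigma>) P * (\<Prod>\<sigma>'\<in>perms n - {\<sigma>}. Z - pact (?f \<sigma>') L) =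
      pact (?f \<sigma>) P * (\<Prod>\<sigma>'\<in>perms n - {?f \<sigma>}. Z - pact \<sigma>' L)" by simp
  qed
  also have "\<dots> = lagr n Z L P"
    unfolding lagr_def by (rule sum.reindex_bij_betw[OF b])
  finally show "pact \<tau> (lagr n Z L P) = lagr n Z L P" .
qed

lemma meval_lagr:
  "meval \<rho> (lagr n Z L P) =
    (\<Sum>\<sigma>\<in>perms n. meval (\<lambda>k. \<rho> (\<sigma> k)) P * (\<Prod>\<sigma>'\<in>perms n - {\<sigma>}. meval \<rho> Z - meval (\<lambda>k. \<rho> (\<sigma>' k)) L))"
  by (simp add: lagr_def meval_hom)

lemma meval_lagr_at:
  assumes "\<pi> \<in> perms n" "meval \<rho> Z = meval (\<lambda>k. \<rho> (\<pi> k)) L"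
  shows "meval \<rho> (lagr n Z L P) = meval (\<lambda>k. \<rho> (\<pi> k)) P *
    (\<Prod>\<sigma>'\<in>perms n - {\<pi>}. meval (\<lambda>k. \<rho> (\<pi> k)) L - meval (\<lambda>k. \<rho> (\<sigma>' k)) L)"
proof -
  have "meval \<rho> (lagr n Z L P) = (\<Sum>\<sigma>\<in>{\<pi>}. meval (\<lambda>k. \<rho> (\<sigma> k)) P *
      (\<Prod>\<sigma>'\<in>perms n - {\<sigma>}. meval \<rho> Z - meval (\<lambda>k. \<rho> (\<sigma>' k)) L))"
    unfolding meval_lagr
  proof (rule sum.mono_neutral_right)
    show "\<forall>i\<in>perms n - {\<pi>}. meval (\<lambda>k. \<rho> (i k)) P *
        (\<Prod>\<sigma>'\<in>perms n - {i}. meval \<rho> Z - meval (\<lambda>k. \<rho> (\<sigma>' k)) L) = 0"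
    proof
      fix i assume i: "i \<in> perms n - {\<pi>}"
      have "(\<Prod>\<sigma>'\<in>perms n - {i}. meval \<rho> Z - meval (\<lambda>k. \<rho> (\<sigma>' k)) L) = 0"
        using assms i by (subst prod.remove[of _ \<pi>]) auto
      then show "meval (\<lambda>k. \<rho> (i k)) P *
        (\<Prod>\<sigma>'\<in>perms n - {i}. meval \<rho> Z - meval (\<lambda>k. \<rho> (\<sigma>' k)) L) = 0" by simp
    qed
  qed (use assms in auto)
  then show ?thesis using assms by simp
qed

section \<open>Linear forms that separate permutations\<close>

definition lform :: "nat \<Rightarrow> nat \<Rightarrow> mpol" where
  "lform n c = (\<Sum>i=1..n. of_nat (c ^ i) * mvar i)"

lemma meval_lform: "meval \<rho> (lform n c) = (\<Sum>i=1..n. of_nat (c ^ i) * \<rho> i)"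
  unfolding lform_def meval_sum meval_mult meval_of_nat meval_var ..

definition separates :: "nat \<Rightarrow> (nat \<Rightarrow> 'a::comm_ring_1) \<Rightarrow> nat \<Rightarrow> bool" where
  "separates n x c \<longleftrightarrow> inj_on (\<lambda>\<sigma>. meval (\<lambda>k. x (\<sigma> k)) (lform n c)) (perms n)"

lemma card_vanishing_nats:
  fixes q :: "'a::{idom, ring_char_0} poly"
  assumes "q \<noteq> 0"
  shows "finite {c::nat. poly q (of_nat c) = 0}" "card {c::nat. poly q (of_nat c) = 0} \<le> Polynomial.degree q"
proof -
  have i: "inj_on (of_nat :: nat \<Rightarrow> 'a) {c::nat. poly q (of_nat c) = 0}" by (simp add: inj_on_def)
  have s: "of_nat ` {c::nat. poly q (of_nat c) = 0} \<subseteq> {y. poly q y = 0}" by auto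
  show "finite {c::nat. poly q (of_nat c) = 0}"
    by (rule finite_imageD[OF finite_subset[OF s poly_roots_finite[OF assms]] i])
  have "card {c::nat. poly q (of_nat c) = 0} = card (of_nat ` {c::nat. poly q (of_nat c) = 0} :: 'a set)"
    by (rule card_image[OF i, symmetric])
  also have "\<dots> \<le> card {y. poly q y = 0}" by (rule card_mono[OF poly_roots_finite[OF assms] s])
  also have "\<dots> \<le> Polynomial.degree q" by (rule card_poly_roots_bound[OF assms])
  finally show "card {c::nat. poly q (of_nat c) = 0} \<le> Polynomial.degree q" .
qed

text \<open>With powers of \<open>c\<close> as weights, the difference of the values at two
  permutations is a polynomial in \<open>c\<close> of degree at most \<open>n\<close>. It is nonzero
  since \<open>x\<close> is injective, so each pair excludes at most \<open>n\<close> values of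
  \<open>c\<close>. That the bound does not depend on \<open>x\<close> is what later allows a choice
  of \<open>c\<close> uniform over slices.\<close>

lemma not_separates_bound:
  fixes x :: "nat \<Rightarrow> 'a::{idom, ring_char_0}"
  assumes "inj_on x {1..n}"
  shows "finite {c. \<not> separates n x c}" "card {c. \<not> separates n x c} \<le> card (perms n \<times> perms n) * n"
proof -
  define D where "D = {(\<pi>, \<pi>'). \<pi> \<in> perms n \<and> \<pi>' \<in> perms n \<and> \<pi> \<noteq> \<pi>'}"
  define q where "q = (\<lambda>(\<pi>::nat\<Rightarrow>nat, \<pi>'::nat\<Rightarrow>nat). \<Sum>i=1..n. Polynomial.monom (x (\<pi> i) - x (\<pi>' i)) i)"
  have D: "D \<subseteq> perms n \<times> perms n" "finite D"
    by (auto simp: D_def intro: finite_subset[of _ "perms n \<times> perms n"])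
  have q0: "q d \<noteq> 0" if dD: "d \<in> D" for d
  proof -
    obtain \<pi> \<pi>' where d: "d = (\<pi>, \<pi>')" "\<pi> permutes {1..n}" "\<pi>' permutes {1..n}" "\<pi> \<noteq> \<pi>'"
      using dD unfolding D_def mem_perms by blast
    then obtain i where i: "\<pi> i \<noteq> \<pi>' i" by blast
    then have "i \<in> {1..n}" using d by (metis permutes_def)
    then have "Polynomial.coeff (q d) i = x (\<pi> i) - x (\<pi>' i)"
      by (auto simp: q_def d coeff_sum coeff_monom sum.delta)
    moreover have "x (\<pi> i) \<noteq> x (\<pi>' i)"
    proof
      assume "x (\<pi> i) = x (\<pi>' i)"
      moreover have "\<pi> i \<in> {1..n}" "\<pi>' i \<in> {1..n}"
        using \<open>i \<in> {1..n}\<close> permutes_in_image[OF d(2)] permutes_in_image[OF d(3)] by blast+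
      ultimately show False using i inj_onD[OF assms] by blast
    qed
    ultimately show ?thesis by auto
  qed
  have sub: "{c. \<not> separates n x c} \<subseteq> (\<Union>d\<in>D. {c. poly (q d) (of_nat c) = 0})"
  proof
    fix c assume "c \<in> {c. \<not> separates n x c}"
    then obtain \<pi> \<pi>' where d: "\<pi> \<in> perms n" "\<pi>' \<in> perms n" "\<pi> \<noteq> \<pi>'"
      "meval (\<lambda>k. x (\<pi> k)) (lform n c) = meval (\<lambda>k. x (\<pi>' k)) (lform n c)"
      by (auto simp: separates_def inj_on_def)
    then have "poly (q (\<pi>, \<pi>')) (of_nat c) = 0"
      by (simp add: q_def poly_sum poly_monom meval_lform sum_subtractf algebra_simps)
    then show "c \<in> (\<Union>d\<in>D. {c. poly (q d) (of_nat c) = 0})"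
      using d by (intro UN_I[of "(\<pi>, \<pi>')"]) (auto simp: D_def)
  qed
  have fin: "finite (\<Union>d\<in>D. {c. poly (q d) (of_nat c) = 0})"
    using D q0 by (intro finite_UN_I card_vanishing_nats) auto
  show "finite {c. \<not> separates n x c}" by (rule finite_subset[OF sub fin])
  have "card {c. \<not> separates n x c} \<le> card (\<Union>d\<in>D. {c. poly (q d) (of_nat c) = 0})"
    by (rule card_mono[OF fin sub])
  also have "\<dots> \<le> (\<Sum>d\<in>D. card {c::nat. poly (q d) (of_nat c) = 0})" by (rule card_UN_le[OF D(2)])
  also have "\<dots> \<le> (\<Sum>d\<in>D. n)"
  proof (rule sum_mono)
    fix d assume d: "d \<in> D"
    have "Polynomial.degree (q d) \<le> n"
      by (auto simp: q_def case_prod_unfold intro!: degree_sum_le order_trans[OF degree_monom_le])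
    then show "card {c::nat. poly (q d) (of_nat c) = 0} \<le> n"
      using card_vanishing_nats(2)[OF q0[OF d]] by linarith
  qed
  also have "\<dots> \<le> card (perms n \<times> perms n) * n"
    using card_mono[OF _ D(1)] by (simp del: card_cartesian_product)
  finally show "card {c. \<not> separates n x c} \<le> card (perms n \<times> perms n) * n" .
qed

lemma separates_exists:
  fixes x :: "nat \<Rightarrow> 'a::{idom, ring_char_0}"
  assumes "inj_on x {1..n}"
  obtains c where "separates n x c"
  using not_separates_bound(1)[OF assms] infinite_UNIV_nat
  by (metis (mono_tags, lifting) Collect_cong ex_new_if_finite mem_Collect_eq)

section \<open>Permutations that preserve all polynomial relations\<close>

text \<open>For the distinct complex roots of an integer polynomial this is the Galois group over
  the rationals. Indices outside \<open>1..n\<close> are fixed, so a transcendental value stored at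
  index 0 belongs to the base field and the group is then one over a rational function
  field.\<close>

definition relperms :: "nat \<Rightarrow> (nat \<Rightarrow> 'a::comm_ring_1) \<Rightarrow> (nat \<Rightarrow> nat) set" where
  "relperms n \<alpha> = {\<tau> \<in> perms n. \<forall>P. meval \<alpha> P = 0 \<longrightarrow> meval (\<lambda>k. \<alpha> (\<tau> k)) P = 0}"

lemma relperms_comp:
  assumes "\<sigma> \<in> relperms n \<alpha>" "\<tau> \<in> relperms n \<alpha>"
  shows "(\<lambda>k. \<sigma> (\<tau> k)) \<in> relperms n \<alpha>"
proof -
  have "meval (\<lambda>k. \<alpha> (\<sigma> (\<tau> k))) P = 0" if "meval \<alpha> P = 0" for P
  proof -
    have "meval \<alpha> (pact \<tau> P) = 0" using assms(2) that by (simp add: relperms_def)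
    then have "meval (\<lambda>k. \<alpha> (\<sigma> k)) (pact \<tau> P) = 0" using assms(1) unfolding relperms_def by blast
    then show ?thesis by simp
  qed
  then show ?thesis using assms perms_compose by (auto simp: relperms_def)
qed

lemma relperms_id: "id \<in> relperms n \<alpha>" by (simp add: relperms_def permutes_id)

text \<open>A permutation of finite order has a power of itself as inverse, so closure under
  composition suffices.\<close>

lemma relperms_inv:
  assumes "\<tau> \<in> relperms n \<alpha>"
  shows "inv_into UNIV \<tau> \<in> relperms n \<alpha>"
proof -
  have p: "\<tau> permutes {1..n}" using assms by (simp add: relperms_def)
  then have "permutation \<tau>" by (auto simp: permutation_permutes)
  then obtain k where k: "\<tau> ^^ k = id" "k > 0" using permutation_is_nilpotent by blast
  have pw: "\<tau> ^^ j \<in> relperms n \<alpha>" for j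
    by (induction j) (use relperms_id relperms_comp[OF assms] in \<open>auto simp: o_def id_def\<close>)
  have "\<tau> \<circ> \<tau> ^^ (k - 1) = id" using k by (metis Suc_pred' funpow.simps(2))
  then have "inv_into UNIV \<tau> = \<tau> ^^ (k - 1)"
    using p by (metis comp_assoc comp_id fun.map_id permutes_inv_o(2) id_comp)
  then show ?thesis using pw by simp
qed

lemma relperms_iff:
  assumes "\<tau> \<in> relperms n \<alpha>"
  shows "meval (\<lambda>k. \<alpha> (\<tau> k)) P = 0 \<longleftrightarrow> meval \<alpha> P = 0"
proof
  assume "meval (\<lambda>k. \<alpha> (\<tau> k)) P = 0"
  then have "meval \<alpha> (pact \<tau> P) = 0" by simp
  then have "meval (\<lambda>k. \<alpha> (inv_into UNIV \<tau> k)) (pact \<tau> P) = 0"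
    using relperms_inv[OF assms] unfolding relperms_def by blast
  moreover have "\<tau> (inv_into UNIV \<tau> k) = k" "inv_into UNIV \<tau> (\<tau> k) = k" for k
    using assms by (auto simp: relperms_def permutes_inverses)
  ultimately show "meval \<alpha> P = 0" by simp
qed (use assms in \<open>auto simp: relperms_def\<close>)

section \<open>The correspondence between the fields generated by two valuations\<close>

text \<open>The graph of the field map that sends each \<open>\<alpha> k\<close> to
  \<open>\<beta> k\<close>, kept as a relation: its closure properties hold whether or not such a
  map exists, and well-definedness enters only through \<open>frel_zero\<close>.\<close>

definition frel :: "(nat \<Rightarrow> 'a::field) \<Rightarrow> (nat \<Rightarrow> 'a) \<Rightarrow> ('a \<times> 'a) set" where
  "frel \<alpha> \<beta> = {(meval \<alpha> Q / meval \<alpha> D, meval \<beta> Q / meval \<beta> D) | Q D. meval \<alpha> D \<noteq> 0 \<and> meval \<beta> D \<noteq> 0}"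

lemma frelI:
  "meval \<alpha> D \<noteq> 0 \<Longrightarrow> meval \<beta> D \<noteq> 0 \<Longrightarrow> a = meval \<alpha> Q / meval \<alpha> D \<Longrightarrow> b = meval \<beta> Q / meval \<beta> D \<Longrightarrow> (a, b) \<in> frel \<alpha> \<beta>"
  unfolding frel_def by blast

lemma frelE:
  assumes "(a, b) \<in> frel \<alpha> \<beta>"
  obtains Q D where "meval \<alpha> D \<noteq> 0" "meval \<beta> D \<noteq> 0" "a = meval \<alpha> Q / meval \<alpha> D" "b = meval \<beta> Q / meval \<beta> D"
  using assms unfolding frel_def by blast

lemma frel_meval: "(meval \<alpha> Q, meval \<beta> Q) \<in> frel \<alpha> \<beta>"
  by (rule frelI[of _ 1]) simp_all

lemma frel_var: "(\<alpha> k, \<beta> k) \<in> frel \<alpha> \<beta>"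
  using frel_meval[of \<alpha> "mvar k"] by simp

lemma frel_of_int: "(of_int k, of_int k) \<in> frel \<alpha> \<beta>"
  using frel_meval[of \<alpha> "of_int k"] by simp

lemma frel_0: "(0, 0) \<in> frel \<alpha> \<beta>" using frel_of_int[of 0] by simp
lemma frel_1: "(1, 1) \<in> frel \<alpha> \<beta>" using frel_of_int[of 1] by simp

lemma frel_add:
  assumes "(a, b) \<in> frel \<alpha> \<beta>" "(a', b') \<in> frel \<alpha> \<beta>"
  shows "(a + a', b + b') \<in> frel \<alpha> \<beta>"
proof -
  obtain Q D Q' D' where "meval \<alpha> D \<noteq> 0" "meval \<beta> D \<noteq> 0" "a = meval \<alpha> Q / meval \<alpha> D" "b = meval \<beta> Q / meval \<beta> D"
    "meval \<alpha> D' \<noteq> 0" "meval \<beta> D' \<noteq> 0" "a' = meval \<alpha> Q' / meval \<alpha> D'" "b' = meval \<beta> Q' / meval \<beta> D'"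
    using assms by (elim frelE) blast
  then show ?thesis
    by (intro frelI[of _ "D * D'" _ _ "Q * D' + Q' * D"]) (simp_all add: meval_hom add_frac_eq)
qed

lemma frel_mult:
  assumes "(a, b) \<in> frel \<alpha> \<beta>" "(a', b') \<in> frel \<alpha> \<beta>"
  shows "(a * a', b * b') \<in> frel \<alpha> \<beta>"
proof -
  obtain Q D Q' D' where "meval \<alpha> D \<noteq> 0" "meval \<beta> D \<noteq> 0" "a = meval \<alpha> Q / meval \<alpha> D" "b = meval \<beta> Q / meval \<beta> D"
    "meval \<alpha> D' \<noteq> 0" "meval \<beta> D' \<noteq> 0" "a' = meval \<alpha> Q' / meval \<alpha> D'" "b' = meval \<beta> Q' / meval \<beta> D'"
    using assms by (elim frelE) blast
  then show ?thesis
    by (intro frelI[of _ "D * D'" _ _ "Q * Q'"]) (simp_all add: meval_hom)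
qed

lemma frel_uminus: "(a, b) \<in> frel \<alpha> \<beta> \<Longrightarrow> (- a, - b) \<in> frel \<alpha> \<beta>"
  using frel_mult[OF frel_of_int[of "-1"]] by force

lemma frel_diff:
  "(a, b) \<in> frel \<alpha> \<beta> \<Longrightarrow> (a', b') \<in> frel \<alpha> \<beta> \<Longrightarrow> (a - a', b - b') \<in> frel \<alpha> \<beta>"
  using frel_add[OF _ frel_uminus] by fastforce

lemma frel_inverse:
  assumes "(a, b) \<in> frel \<alpha> \<beta>" "a \<noteq> 0" "b \<noteq> 0"
  shows "(inverse a, inverse b) \<in> frel \<alpha> \<beta>"
proof -
  obtain Q D where "meval \<alpha> D \<noteq> 0" "meval \<beta> D \<noteq> 0" "a = meval \<alpha> Q / meval \<alpha> D" "b = meval \<beta> Q / meval \<beta> D"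
    using assms by (elim frelE) blast
  then show ?thesis using assms
    by (intro frelI[of _ "Q" _ _ "D"]) (auto simp: meval_hom field_simps)
qed

lemma frel_zero:
  assumes "(0, b) \<in> frel \<alpha> \<beta>" "\<And>P. meval \<alpha> P = 0 \<Longrightarrow> meval \<beta> P = 0"
  shows "b = 0"
  using assms by (auto elim!: frelE)

lemma frel_sum:
  "(\<And>i. i \<in> A \<Longrightarrow> (f i, g i) \<in> frel \<alpha> \<beta>) \<Longrightarrow> (sum f A, sum g A) \<in> frel \<alpha> \<beta>"
  by (induction A rule: infinite_finite_induct) (auto intro: frel_add frel_0)

lemma perms_in: "\<sigma> \<in> perms n \<Longrightarrow> i \<in> {1..n} \<Longrightarrow> \<sigma> i \<in> {1..n}"
  unfolding mem_perms by (simp only: permutes_in_image)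

lemma perms_out: "\<sigma> \<in> perms n \<Longrightarrow> i \<notin> {1..n} \<Longrightarrow> \<sigma> i = i"
  unfolding mem_perms by (rule permutes_not_in)

section \<open>Values fixed by all relation-preserving permutations are integers\<close>

text \<open>The default 0 outside \<open>1..n\<close> makes the value of every element of
  \<open>mpol\<close> an element of the splitting field.\<close>

definition extended_roots :: "nat \<Rightarrow> int poly \<Rightarrow> (nat \<Rightarrow> complex) \<Rightarrow> bool" where
  "extended_roots n f \<alpha> \<longleftrightarrow> root_labelling n f \<alpha> \<and> (\<forall>k. k \<notin> {1..n} \<longrightarrow> \<alpha> k = 0)"

text \<open>Frees the variable \<open>n + 1\<close>, which then serves as the indeterminate of a
  one-variable polynomial, without changing values at \<open>extended_roots\<close>.\<close>

definition mcut :: "nat \<Rightarrow> mpol \<Rightarrow> mpol" where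
  "mcut n P = meval (\<lambda>k. if k \<in> {1..n} then mvar k else 0) P"

lemma meval_mcut: "meval \<rho> (mcut n P) = meval (\<lambda>k. if k \<in> {1..n} then \<rho> k else 0) P"
  by (simp add: mcut_def meval_meval if_distrib[of "meval \<rho>"] meval_0 cong: if_cong)

lemma esub_int:
  assumes "extended_roots n f \<alpha>"
  shows "esub n \<alpha> k = of_int (if k \<in> {1..n} then Polynomial.coeff f (n - k) else 0)"
proof -
  have "rootpoly n \<alpha> = map_poly of_int f" using assms by (simp add: extended_roots_def root_labelling_def rootpoly_def)
  then show ?thesis using assms by (auto simp: esub_def coeff_map_poly extended_roots_def)
qed

text \<open>The variable \<open>n + 1\<close> is not moved by \<open>perms n\<close>, so it can act
  as an indeterminate; the other variables enter only through the coefficients of \<open>f\<close>,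
  which are integers.\<close>

lemma symm_int_poly:
  assumes r: "extended_roots n f \<alpha>" and R: "symm n R"
  obtains A :: "int poly" where "\<And>y. ipeval A y = meval (\<alpha>(Suc n := y)) R"
proof -
  obtain P where P: "R = meval (esub n mvar) P" using symmetric_function_theorem[OF R] by blast
  define \<rho> :: "nat \<Rightarrow> int poly" where
    "\<rho> k = (if k = Suc n then [:0, 1:] else if k \<in> {1..n} then [:Polynomial.coeff f (n - k):] else 0)" for k
  have "rootpoly n (\<alpha>(Suc n := y)) = rootpoly n \<alpha>" for y unfolding rootpoly_def by (intro prod.cong) auto
  then have e: "esub n (\<alpha>(Suc n := y)) k = ipeval (\<rho> k) y" for y k
    using esub_int[OF r, of k] by (auto simp: esub_def \<rho>_def)
  have "ipeval (meval \<rho> P) y = meval (\<alpha>(Suc n := y)) R" for y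
    by (simp add: ipeval_meval P meval_meval_esub flip: e)
  then show ?thesis by (rule that)
qed

lemma symm_mvar: "k \<notin> {1..n} \<Longrightarrow> symm n (mvar k)"
  by (auto simp: symm_def permutes_not_in)

text \<open>Every conjugate of a polynomial in the roots is one and the same integer polynomial in
  the corresponding conjugate of \<open>lform\<close>, divided by the interpolation denominator.
  Keeping the denominator as a factor on the right keeps \<open>A\<close> integral.\<close>

lemma lagr_int_poly:
  assumes r: "extended_roots n f \<alpha>"
  obtains A :: "int poly" where
    "\<And>\<pi>. \<pi> \<in> perms n \<Longrightarrow> ipeval A (meval (\<lambda>k. \<alpha> (\<pi> k)) (lform n c)) = meval (\<lambda>k. \<alpha> (\<pi> k)) P *
    (\<Prod>\<sigma>'\<in>perms n - {\<pi>}. meval (\<lambda>k. \<alpha> (\<pi> k)) (lform n c) - meval (\<lambda>k. \<alpha> (\<sigma>' k)) (lform n c))"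
proof -
  obtain A where A: "\<And>y. ipeval A y = meval (\<alpha>(Suc n := y)) (lagr n (mvar (Suc n)) (lform n c) (mcut n P))"
    using symm_int_poly[OF r symm_lagr[OF symm_mvar]] by (metis Suc_n_not_le_n atLeastAtMost_iff)
  have "ipeval A (meval (\<lambda>k. \<alpha> (\<pi> k)) (lform n c)) = meval (\<lambda>k. \<alpha> (\<pi> k)) P *
    (\<Prod>\<sigma>'\<in>perms n - {\<pi>}. meval (\<lambda>k. \<alpha> (\<pi> k)) (lform n c) - meval (\<lambda>k. \<alpha> (\<sigma>' k)) (lform n c))"
    if \<pi>: "\<pi> \<in> perms n" for \<pi>
  proof -
    define y where "y = meval (\<lambda>k. \<alpha> (\<pi> k)) (lform n c)"
    let ?r = "\<alpha>(Suc n := y)"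
    have l: "meval (\<lambda>k. ?r (\<sigma> k)) (lform n c) = meval (\<lambda>k. \<alpha> (\<sigma> k)) (lform n c)" if \<sigma>: "\<sigma> \<in> perms n" for \<sigma>
      unfolding meval_lform
    proof (rule sum.cong[OF refl])
      fix i assume "i \<in> {1..n}"
      then have "\<sigma> i \<in> {1..n}" by (rule perms_in[OF \<sigma>])
      then show "of_nat (c ^ i) * ?r (\<sigma> i) = of_nat (c ^ i) * \<alpha> (\<sigma> i)" by auto
    qed
    have "(if k \<in> {1..n} then ?r (\<pi> k) else 0) = \<alpha> (\<pi> k)" for k
    proof (cases "k \<in> {1..n}")
      case True
      then have "\<pi> k \<in> {1..n}" by (rule perms_in[OF \<pi>])
      then show ?thesis using True by auto
    next
      case False
      then have "\<pi> k = k" "k \<notin> {1..n}" using \<pi> by (auto simp: permutes_not_in)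
      then show ?thesis using r by (auto simp: extended_roots_def)
    qed
    then have cutP: "meval (\<lambda>k. ?r (\<pi> k)) (mcut n P) = meval (\<lambda>k. \<alpha> (\<pi> k)) P" by (simp only: meval_mcut)
    have "meval ?r (mvar (Suc n)) = meval (\<lambda>k. ?r (\<pi> k)) (lform n c)" using l[OF \<pi>] by (simp add: y_def)
    from meval_lagr_at[OF \<pi> this, of "mcut n P"]
    have "ipeval A y = meval (\<lambda>k. \<alpha> (\<pi> k)) P *
      (\<Prod>\<sigma>'\<in>perms n - {\<pi>}. meval (\<lambda>k. ?r (\<pi> k)) (lform n c) - meval (\<lambda>k. ?r (\<sigma>' k)) (lform n c))"
      by (simp only: A cutP)
    also have "(\<Prod>\<sigma>'\<in>perms n - {\<pi>}. meval (\<lambda>k. ?r (\<pi> k)) (lform n c) - meval (\<lambda>k. ?r (\<sigma>' k)) (lform n c)) =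
       (\<Prod>\<sigma>'\<in>perms n - {\<pi>}. meval (\<lambda>k. \<alpha> (\<pi> k)) (lform n c) - meval (\<lambda>k. \<alpha> (\<sigma>' k)) (lform n c))"
      by (intro prod.cong refl) (use l \<pi> in auto)
    finally show ?thesis by (simp add: y_def)
  qed
  then show ?thesis by (rule that)
qed

lemma map_poly_of_int_eq_0 [simp]: "map_poly of_int A = (0 :: complex poly) \<longleftrightarrow> A = 0"
  by (auto simp: poly_eq_iff coeff_map_poly)

lemma degree_of_int_poly [simp]: "Polynomial.degree (map_poly of_int A :: complex poly) = Polynomial.degree A"
  by (intro degree_map_poly) auto

text \<open>The fixed field theorem, proved by hand. The value \<open>u id\<close> of a separating
  form is a primitive element; the conjugates of \<open>u id\<close> over the rationals come from
  permutations in \<open>relperms\<close>. An invariant value \<open>v\<close> is therefore the same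
  quotient of two integer polynomials at all these conjugates, which forces \<open>v\<close> to be
  rational. Being also an algebraic integer, it is an integer.\<close>

lemma relperms_invariant_int:
  assumes r: "extended_roots n f \<alpha>" and inj: "inj_on \<alpha> {1..n}"
    and inv: "\<And>\<tau>. \<tau> \<in> relperms n \<alpha> \<Longrightarrow> meval (\<lambda>k. \<alpha> (\<tau> k)) \<theta> = meval \<alpha> \<theta>"
  shows "meval \<alpha> \<theta> \<in> \<int>"
proof -
  obtain c where sep: "separates n \<alpha> c" using separates_exists[OF inj] by blast
  define u where "u \<pi> = meval (\<lambda>k. \<alpha> (\<pi> k)) (lform n c)" for \<pi>
  have uinj: "inj_on u (perms n)" using sep unfolding separates_def by (simp add: u_def[abs_def])
  define U' where "U' \<pi> = (\<Prod>\<sigma>'\<in>perms n - {\<pi>}. u \<pi> - u \<sigma>')" for \<pi>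
  have U'0: "U' \<pi> \<noteq> 0" if "\<pi> \<in> perms n" for \<pi>
    using that uinj by (auto simp: U'_def inj_on_def)
  have lag: "\<exists>A. \<forall>\<pi>\<in>perms n. ipeval A (u \<pi>) = meval (\<lambda>k. \<alpha> (\<pi> k)) P * U' \<pi>" for P
    using lagr_int_poly[OF r, of c P] unfolding u_def U'_def by metis
  have id: "id \<in> perms n" by (simp add: permutes_id)
  have uid: "meval \<alpha> Q = meval (\<lambda>k. \<alpha> (id k)) Q" for Q by simp
  obtain U :: "int poly" where U: "\<And>y. ipeval U y = (\<Prod>\<sigma>\<in>perms n. y - u \<sigma>)"
  proof -
    let ?R = "\<Prod>\<sigma>\<in>perms n. mvar (Suc n) - pact \<sigma> (lform n c)"
    have R: "symm n ?R" unfolding symm_alt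
    proof
      fix \<tau> assume t: "\<tau> \<in> perms n"
      then have "\<tau> (Suc n) = Suc n" by (auto simp: permutes_not_in)
      then have "pact \<tau> ?R = (\<Prod>\<sigma>\<in>perms n. mvar (Suc n) - pact (\<lambda>k. \<tau> (\<sigma> k)) (lform n c))"
        by (simp add: pact_def[of \<tau>] meval_hom) (simp add: pact_def)
      also have "\<dots> = ?R" by (rule prod.reindex_bij_betw[OF bij_perms_left[OF t]])
      finally show "pact \<tau> ?R = ?R" .
    qed
    obtain A where A: "\<And>y. ipeval A y = meval (\<alpha>(Suc n := y)) ?R" using symm_int_poly[OF r R] by blast
    have "ipeval A y = (\<Prod>\<sigma>\<in>perms n. y - u \<sigma>)" for y
    proof -
      have "meval (\<lambda>k. (\<alpha>(Suc n := y)) (\<sigma> k)) (lform n c) = u \<sigma>" if s: "\<sigma> \<in> perms n" for \<sigma>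
        unfolding u_def meval_lform
      proof (rule sum.cong[OF refl])
        fix i assume "i \<in> {1..n}"
        then have "\<sigma> i \<in> {1..n}" by (rule perms_in[OF s])
        then show "of_nat (c ^ i) * (\<alpha>(Suc n := y)) (\<sigma> i) = of_nat (c ^ i) * \<alpha> (\<sigma> i)" by auto
      qed
      then show ?thesis by (simp add: A meval_hom)
    qed
    then show ?thesis by (rule that)
  qed
  have Upoly: "map_poly of_int U = (\<Prod>\<sigma>\<in>perms n. [:- u \<sigma>, 1:])"
    unfolding poly_eq_poly_eq_iff[symmetric] by (intro ext) (simp add: poly_prod flip: U ipeval_def)
  have U0: "U \<noteq> 0"
  proof
    assume "U = 0"
    then have "(\<Prod>\<sigma>\<in>perms n. [:- u \<sigma>, 1:]) = 0" using Upoly by simp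
    then show False by (auto simp: prod_zero_iff)
  qed
  have degU: "Polynomial.degree U = card (perms n)"
  proof -
    have "Polynomial.degree (map_poly of_int U :: complex poly) = card (perms n)"
      unfolding Upoly by (subst degree_prod_eq_sum_degree) auto
    then show ?thesis by simp
  qed
  have Uroots: "ipeval U y = 0 \<longleftrightarrow> y \<in> u ` perms n" for y
    by (auto simp: U prod_zero_iff)
  \<comment> \<open>The minimal polynomial of \<open>u id\<close> up to a constant factor. It need
    not be monic, hence the pseudo-divisions below.\<close>
  define m where "m = arg_min Polynomial.degree (\<lambda>m. m \<noteq> 0 \<and> ipeval m (u id) = 0)"
  have "U \<noteq> 0 \<and> ipeval U (u id) = 0" using U0 Uroots id by blast
  from arg_min_nat_lemma[of "\<lambda>m. m \<noteq> 0 \<and> ipeval m (u id) = 0", OF this, of Polynomial.degree]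
  have m0: "m \<noteq> 0" "ipeval m (u id) = 0"
    and mmin: "\<And>p. p \<noteq> 0 \<Longrightarrow> ipeval p (u id) = 0 \<Longrightarrow> Polynomial.degree m \<le> Polynomial.degree p"
    unfolding m_def by blast+
  have pdiv: "\<exists>a q. a \<noteq> 0 \<and> Polynomial.smult a p = m * q" if pu: "ipeval p (u id) = 0" for p
  proof -
    obtain a q where aq: "a \<noteq> 0" "Polynomial.smult a p = m * q + pseudo_mod p m"
      using pseudo_mod(1)[OF m0(1)] by blast
    have "of_int a * ipeval p (u id) = ipeval m (u id) * ipeval q (u id) + ipeval (pseudo_mod p m) (u id)"
      using arg_cong[OF aq(2), of "\<lambda>p. ipeval p (u id)"] by (simp add: ipeval_smult ipeval_add ipeval_mult)
    then have "ipeval (pseudo_mod p m) (u id) = 0" using pu m0 by simp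
    then have "pseudo_mod p m = 0" using mmin pseudo_mod(2)[OF m0(1), of p] by fastforce
    then show ?thesis using aq by auto
  qed
  define Z where "Z = {y. ipeval m y = (0::complex)}"
  have finZ: "finite Z" unfolding Z_def ipeval_def by (rule poly_roots_finite) (use m0 in simp)
  have Zsub: "Z \<subseteq> u ` perms n"
  proof
    fix y assume y: "y \<in> Z"
    obtain a q where "a \<noteq> 0" "Polynomial.smult a U = m * q"
      using pdiv[of U] Uroots id by blast
    then have "of_int a * ipeval U y = ipeval m y * ipeval q y" by (metis ipeval_mult ipeval_smult)
    then have "ipeval U y = 0" using y \<open>a \<noteq> 0\<close> by (simp add: Z_def)
    then show "y \<in> u ` perms n" using Uroots by blast
  qed
  \<comment> \<open>Up to a constant \<open>m\<close> divides \<open>U\<close>, and \<open>U\<close>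
    has only simple zeros since \<open>u\<close> is injective; so \<open>m\<close> has as many zeros
    as its degree.\<close>
  have cardZ: "card Z \<ge> Polynomial.degree m"
  proof -
    obtain a q where aq: "a \<noteq> 0" "Polynomial.smult a U = m * q"
      using pdiv[of U] Uroots id by blast
    have q0: "q \<noteq> 0" using aq U0 by auto
    have d: "card (perms n) = Polynomial.degree m + Polynomial.degree q"
      using aq q0 m0 degU by (metis degree_mult_eq degree_smult_eq)
    have sub: "u ` perms n \<subseteq> Z \<union> {y. ipeval q y = 0}"
    proof
      fix y assume "y \<in> u ` perms n"
      then have "ipeval U y = 0" using Uroots by blast
      then have "ipeval m y * ipeval q y = 0" using aq by (metis ipeval_mult ipeval_smult mult_zero_right)
      then show "y \<in> Z \<union> {y. ipeval q y = 0}" by (auto simp: Z_def)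
    qed
    have q0': "map_poly of_int q \<noteq> (0 :: complex poly)" using q0 by simp
    have "card (perms n) = card (u ` perms n)" using card_image[OF uinj] by simp
    also have "\<dots> \<le> card (Z \<union> {y. ipeval q y = 0})"
      using poly_roots_finite[OF q0'] by (intro card_mono[OF _ sub]) (simp add: finZ ipeval_def)
    also have "\<dots> \<le> card Z + card {y. ipeval q y = (0::complex)}" by (rule card_Un_le)
    also have "card {y. ipeval q y = (0::complex)} \<le> Polynomial.degree q"
      using card_poly_roots_bound[OF q0'] by (simp add: ipeval_def)
    finally show ?thesis using d by linarith
  qed
  \<comment> \<open>A relation \<open>P\<close> at \<open>\<alpha>\<close> makes its interpolant
    \<open>A\<close> vanish at \<open>u id\<close>, hence modulo \<open>m\<close>, hence at
    \<open>u \<pi>\<close>; the nonzero factor \<open>U' \<pi>\<close> can be cancelled.\<close>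
  have Zrel: "\<pi> \<in> relperms n \<alpha>" if \<pi>: "\<pi> \<in> perms n" "u \<pi> \<in> Z" for \<pi>
  proof -
    have "meval (\<lambda>k. \<alpha> (\<pi> k)) P = 0" if P: "meval \<alpha> P = 0" for P
    proof -
      obtain A where A: "\<And>\<pi>. \<pi>\<in>perms n \<Longrightarrow> ipeval A (u \<pi>) = meval (\<lambda>k. \<alpha> (\<pi> k)) P * U' \<pi>" using lag by blast
      have "ipeval A (u id) = 0" using A[OF id] P by simp
      then obtain a q where aq: "a \<noteq> 0" "Polynomial.smult a A = m * q" using pdiv by blast
      then have "of_int a * ipeval A (u \<pi>) = ipeval m (u \<pi>) * ipeval q (u \<pi>)" by (metis ipeval_mult ipeval_smult)
      then have "ipeval A (u \<pi>) = 0" using aq \<pi> by (simp add: Z_def)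
      then show ?thesis using A[OF \<pi>(1)] U'0[OF \<pi>(1)] by simp
    qed
    then show ?thesis using \<pi> by (simp add: relperms_def)
  qed
  define v where "v = meval \<alpha> \<theta>"
  obtain A where A: "\<And>\<pi>. \<pi>\<in>perms n \<Longrightarrow> ipeval A (u \<pi>) = meval (\<lambda>k. \<alpha> (\<pi> k)) \<theta> * U' \<pi>" using lag by blast
  \<comment> \<open>Interpolating the constant 1 yields the denominators themselves, so
    \<open>v\<close> is the quotient of \<open>A\<close> and \<open>B\<close> at every zero of
    \<open>m\<close>.\<close>
  obtain B where B: "\<And>\<pi>. \<pi>\<in>perms n \<Longrightarrow> ipeval B (u \<pi>) = U' \<pi>" using lag[of 1] unfolding meval_1 mult_1_left by blast
  obtain a q where aq: "a \<noteq> 0" "Polynomial.smult a A = m * q + pseudo_mod A m"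
    using pseudo_mod(1)[OF m0(1)] by blast
  obtain b q' where bq: "b \<noteq> 0" "Polynomial.smult b B = m * q' + pseudo_mod B m"
    using pseudo_mod(1)[OF m0(1)] by blast
  define rA where "rA = pseudo_mod A m"
  define rB where "rB = pseudo_mod B m"
  have rA: "of_int a * ipeval A y = ipeval rA y" if "y \<in> Z" for y
    using arg_cong[OF aq(2), of "\<lambda>p. ipeval p y"] that by (simp add: Z_def ipeval_smult ipeval_add ipeval_mult rA_def)
  have rB: "of_int b * ipeval B y = ipeval rB y" if "y \<in> Z" for y
    using arg_cong[OF bq(2), of "\<lambda>p. ipeval p y"] that by (simp add: Z_def ipeval_smult ipeval_add ipeval_mult rB_def)
  have uZ: "u id \<in> Z" using m0 by (simp add: Z_def)
  have "rB \<noteq> 0" using rB[OF uZ] B[OF id] U'0[OF id] bq by auto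
  then have degm: "Polynomial.degree m > 0" using pseudo_mod(2)[OF m0(1), of B] by (simp add: rB_def)
  \<comment> \<open>At a zero \<open>y\<close> of \<open>m\<close> this is
    \<open>a * b * (A(y) - v * B(y)) = 0\<close>. Its degree is below the number of such zeros, so
    it vanishes identically, and any nonzero coefficient of \<open>rB\<close> expresses
    \<open>v\<close> as a fraction.\<close>
  define w where "w = Polynomial.smult (of_int b) (map_poly of_int rA) - Polynomial.smult (of_int a * v) (map_poly of_int rB)"
  have w0: "poly w y = 0" if yZ: "y \<in> Z" for y
  proof -
    obtain \<pi> where \<pi>: "\<pi> \<in> perms n" "y = u \<pi>" using yZ Zsub by blast
    then have "meval (\<lambda>k. \<alpha> (\<pi> k)) \<theta> = v" using inv Zrel that by (simp add: v_def)
    then have "ipeval A y = v * ipeval B y" using A B \<pi> by simp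
    then show ?thesis using rA[OF that] rB[OF that] by (simp add: w_def flip: ipeval_def) (metis mult.commute mult.left_commute)
  qed
  have "Polynomial.degree rA < Polynomial.degree m" "Polynomial.degree rB < Polynomial.degree m"
    unfolding rA_def rB_def using pseudo_mod(2)[OF m0(1), of A] pseudo_mod(2)[OF m0(1), of B] degm
    by (metis degree_0)+
  then have "Polynomial.degree w < Polynomial.degree m" unfolding w_def
    by (intro degree_diff_less) (auto intro: le_less_trans[OF degree_smult_le])
  then have "w = 0" using cardZ by (intro poly_eq_0_of_roots[OF w0, of Z "\<lambda>y. y"]) auto
  obtain i where i: "Polynomial.coeff rB i \<noteq> 0" using \<open>rB \<noteq> 0\<close> by (auto simp: poly_eq_iff)
  have "Polynomial.coeff w i = 0" using \<open>w = 0\<close> by simp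
  then have "v = of_int (b * Polynomial.coeff rA i) / of_int (a * Polynomial.coeff rB i)"
    using i aq by (simp add: w_def coeff_map_poly field_simps)
  then have vQ: "v \<in> \<rat>" by (metis Rats_divide Rats_of_int)
  \<comment> \<open>\<open>v\<close> is a zero of the monic polynomial whose zeros are the values of
    \<theta> under all permutations of the roots, with integer coefficients by symmetry.\<close>
  have "algebraic_int v"
  proof -
    let ?R = "\<Prod>\<sigma>\<in>perms n. mvar (Suc n) - pact \<sigma> (mcut n \<theta>)"
    have R: "symm n ?R" unfolding symm_alt
    proof
      fix \<tau> assume t: "\<tau> \<in> perms n"
      then have "\<tau> (Suc n) = Suc n" by (auto simp: permutes_not_in)
      then have "pact \<tau> ?R = (\<Prod>\<sigma>\<in>perms n. mvar (Suc n) - pact (\<lambda>k. \<tau> (\<sigma> k)) (mcut n \<theta>))"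
        by (simp add: pact_def[of \<tau>] meval_hom) (simp add: pact_def)
      also have "\<dots> = ?R" by (rule prod.reindex_bij_betw[OF bij_perms_left[OF t]])
      finally show "pact \<tau> ?R = ?R" .
    qed
    obtain E where E: "\<And>y. ipeval E y = meval (\<alpha>(Suc n := y)) ?R" using symm_int_poly[OF r R] by blast
    have Ey: "ipeval E y = (\<Prod>\<sigma>\<in>perms n. y - meval (\<lambda>k. \<alpha> (\<sigma> k)) \<theta>)" for y
    proof -
      have "meval (\<lambda>k. (\<alpha>(Suc n := y)) (\<sigma> k)) (mcut n \<theta>) = meval (\<lambda>k. \<alpha> (\<sigma> k)) \<theta>" if s: "\<sigma> \<in> perms n" for \<sigma>
      proof -
        have "(if k \<in> {1..n} then (\<alpha>(Suc n := y)) (\<sigma> k) else 0) = \<alpha> (\<sigma> k)" for k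
        proof (cases "k \<in> {1..n}")
          case True
          then have "\<sigma> k \<in> {1..n}" by (rule perms_in[OF s])
          then show ?thesis using True by auto
        next
          case False
          then have "\<sigma> k = k" "k \<notin> {1..n}" using s by (auto simp: permutes_not_in)
          then show ?thesis using r by (auto simp: extended_roots_def)
        qed
        then show ?thesis by (simp only: meval_mcut)
      qed
      then show ?thesis by (simp add: E meval_hom)
    qed
    have Epoly: "map_poly of_int E = (\<Prod>\<sigma>\<in>perms n. [:- meval (\<lambda>k. \<alpha> (\<sigma> k)) \<theta>, 1:])"
      unfolding poly_eq_poly_eq_iff[symmetric] by (intro ext) (simp add: poly_prod flip: Ey ipeval_def)
    show ?thesis
    proof (rule algebraic_int.intros[of "map_poly of_int E"])
      show "lead_coeff (map_poly of_int E :: complex poly) = 1"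
        unfolding Epoly lead_coeff_prod by simp
      show "\<forall>i. Polynomial.coeff (map_poly of_int E :: complex poly) i \<in> \<int>" by (simp add: coeff_map_poly)
      have "ipeval E v = 0" using id by (auto simp: Ey prod_zero_iff v_def intro!: bexI[of _ id])
      then show "poly (map_poly of_int E) v = 0" by (simp add: ipeval_def)
    qed
  qed
  then show ?thesis using vQ rational_algebraic_int_is_int by (simp add: v_def)
qed

section \<open>The Galois group\<close>

lemma complex_ring_simps [simp]:
  "carrier complex_ring = UNIV" "monoid.mult complex_ring = (*)" "monoid.one complex_ring = 1"
  "ring.zero complex_ring = 0" "ring.add complex_ring = (+)"
  by (simp_all add: ring_of_type_algebra_def fun_eq_iff)

lemma complex_ring_a_inv [simp]: "a_inv complex_ring h = - h"
  unfolding a_inv_def m_inv_def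
  by (rule the_equality) (auto simp: eq_neg_iff_add_eq_0 add.commute)

lemma complex_ring_m_inv [simp]: "h \<noteq> 0 \<Longrightarrow> m_inv complex_ring h = inverse h"
  unfolding m_inv_def by (rule the_equality) (auto intro: inverse_unique[symmetric])

text \<open>On the diagonal, \<open>frel\<close> just says that \<open>a\<close> is a quotient of
  two polynomial values in the roots; such quotients form a field that contains the rationals and
  the roots.\<close>

lemma splitting_field_eq:
  assumes "extended_roots n f \<alpha>"
  shows "a \<in> splitting_field f \<longleftrightarrow> (a, a) \<in> frel \<alpha> \<alpha>"
proof
  have f: "map_poly of_int f = rootpoly n \<alpha>"
    using assms by (simp add: extended_roots_def root_labelling_def rootpoly_def)
  have roots: "{z. poly (complex_poly f) z = 0} = \<alpha> ` {1..n}"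
    by (auto simp: f poly_rootpoly prod_zero_iff)
  let ?H = "\<rat> \<union> {z. poly (complex_poly f) z = 0}"
  {
    assume "a \<in> splitting_field f"
    then have "a \<in> generate_field complex_ring ?H" by (simp add: splitting_field_def)
    then show "(a, a) \<in> frel \<alpha> \<alpha>"
    proof (induction rule: generate_field.induct)
      case one
      show ?case using frel_1 by simp
    next
      case (incl h)
      then show ?case
      proof
        assume "h \<in> \<rat>"
        then obtain p q where pq: "h = of_int p / of_int q" "q \<noteq> 0" by (auto elim!: Rats_cases')
        then show ?thesis by (intro frelI[of _ "of_int q" _ _ "of_int p"]) auto
      next
        assume "h \<in> {z. poly (complex_poly f) z = 0}"
        then show ?thesis unfolding roots using frel_var by blast
      qed
    next
      case (m_inv h)
      then show ?case using frel_inverse by simp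
    qed (simp_all add: frel_add frel_mult frel_uminus)
  }
  {
    assume "(a, a) \<in> frel \<alpha> \<alpha>"
    then obtain Q D where D: "meval \<alpha> D \<noteq> 0" and a: "a = meval \<alpha> Q / meval \<alpha> D" by (elim frelE)
    have P: "meval \<alpha> P \<in> generate_field complex_ring ?H" for P
    proof (induction P rule: mpol_induct)
      case (const c)
      show ?case by (intro generate_field.incl) simp
    next
      case (var k)
      show ?case
      proof (cases "k \<in> {1..n}")
        case True
        then show ?thesis unfolding roots by (intro generate_field.incl) simp
      next
        case False
        then have "\<alpha> k = 0" using assms by (simp add: extended_roots_def)
        then show ?thesis by (intro generate_field.incl) simp
      qed
    next
      case (add p q)
      then show ?case using generate_field.eng_add[OF add] by (simp add: meval_hom)
    next
      case (mult p q)
      then show ?case using generate_field.eng_mult[OF mult] by (simp add: meval_hom)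
    qed
    have "inverse (meval \<alpha> D) \<in> generate_field complex_ring ?H"
      using generate_field.m_inv[OF P[of D]] D by simp
    from generate_field.eng_mult[OF P[of Q] this] show "a \<in> splitting_field f"
      by (simp add: splitting_field_def a divide_inverse)
  }
qed

text \<open>Since \<tau> preserves relations in both directions, \<open>frel\<close> between
  \<open>\<alpha>\<close> and its rearrangement is the graph of a bijection of the splitting field,
  compatible with sums and products.\<close>

lemma relation_permutation_induces_automorphism:
  assumes r: "extended_roots n f \<alpha>" and \<tau>: "\<tau> \<in> relperms n \<alpha>"
  obtains s where "s \<in> carrier (galois_group f)" "\<And>k. s (\<alpha> k) = \<alpha> (\<tau> k)"
proof -
  define \<beta> where "\<beta> = (\<lambda>k. \<alpha> (\<tau> k))"
  define K where "K = splitting_field f"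
  note K = splitting_field_eq[OF r, folded K_def]
  have iff: "meval \<beta> P = 0 \<longleftrightarrow> meval \<alpha> P = 0" for P
    unfolding \<beta>_def by (rule relperms_iff[OF \<tau>])
  have total: "\<exists>b. (a, b) \<in> frel \<alpha> \<beta>" if "a \<in> K" for a
    using that unfolding K by (elim frelE) (metis frelI iff)
  have uniq: "b = b'" if "(a, b) \<in> frel \<alpha> \<beta>" "(a, b') \<in> frel \<alpha> \<beta>" for a b b'
    using frel_zero[of "b - b'" \<alpha> \<beta>] frel_diff[OF that] iff by auto
  have inj: "a = a'" if "(a, b) \<in> frel \<alpha> \<beta>" "(a', b) \<in> frel \<alpha> \<beta>" for a a' b
  proof -
    have "(a - a', 0) \<in> frel \<alpha> \<beta>" using frel_diff[OF that] by simp
    then show ?thesis by (auto elim!: frelE simp: iff)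
  qed
  have inK: "b \<in> K" if "(a, b) \<in> frel \<alpha> \<beta>" for a b
    using that
  proof (elim frelE)
    fix Q D assume QD: "meval \<beta> D \<noteq> 0" "b = meval \<beta> Q / meval \<beta> D"
    show "b \<in> K" unfolding K
      by (rule frelI[of _ "pact \<tau> D" _ _ "pact \<tau> Q"]) (use QD in \<open>simp_all add: \<beta>_def\<close>)
  qed
  have aK: "a \<in> K" if "(a, b) \<in> frel \<alpha> \<beta>" for a b
    using that unfolding K by (elim frelE) (metis frelI)
  have surj: "\<exists>a. (a, b) \<in> frel \<alpha> \<beta>" if "b \<in> K" for b
    using that unfolding K
  proof (elim frelE)
    fix Q D assume QD: "meval \<alpha> D \<noteq> 0" "b = meval \<alpha> Q / meval \<alpha> D"
    let ?i = "inv_into UNIV \<tau>"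
    have *: "meval \<beta> (pact ?i P) = meval \<alpha> P" for P
      using \<tau> permutes_inverses(1)[of \<tau> "{1..n}"] unfolding \<beta>_def relperms_def by simp
    have "meval \<alpha> (pact ?i D) \<noteq> 0" using QD(1) iff[of "pact ?i D"] * by simp
    then show ?thesis
      by (intro exI[of _ "meval \<alpha> (pact ?i Q) / meval \<alpha> (pact ?i D)"] frelI[of _ "pact ?i D" _ _ "pact ?i Q"])
        (use QD * in simp_all)
  qed
  \<comment> \<open>\<open>restrict\<close> because the members of \<open>galois_group\<close> are
    extensional functions.\<close>
  define s where "s = restrict (\<lambda>a. THE b. (a, b) \<in> frel \<alpha> \<beta>) K"
  have s: "s a = b" if "(a, b) \<in> frel \<alpha> \<beta>" for a b
    using aK[OF that] uniq that unfolding s_def by (auto intro!: the_equality)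
  have s': "(a, s a) \<in> frel \<alpha> \<beta>" if "a \<in> K" for a
    using total[OF that] s by metis
  have bij: "bij_betw s K K"
  proof (rule bij_betw_imageI)
    show "inj_on s K"
    proof (rule inj_onI)
      fix a a' assume "a \<in> K" "a' \<in> K" "s a = s a'"
      then show "a = a'" using s'[of a] s'[of a'] inj by metis
    qed
    show "s ` K = K"
    proof
      show "s ` K \<subseteq> K" using s' inK by blast
      show "K \<subseteq> s ` K"
      proof
        fix b assume "b \<in> K"
        then obtain a where "(a, b) \<in> frel \<alpha> \<beta>" using surj by blast
        then show "b \<in> s ` K" using s aK by blast
      qed
    qed
  qed
  have ratK: "(q, q) \<in> frel \<alpha> \<beta>" if "q \<in> \<rat>" for q
  proof -
    obtain a b where "q = of_int a / of_int b" "b \<noteq> 0" using \<open>q \<in> \<rat>\<close> by (auto elim!: Rats_cases')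
    then show ?thesis by (intro frelI[of _ "of_int b" _ _ "of_int a"]) auto
  qed
  have "s \<in> carrier (galois_group f)"
  proof -
    have "s \<in> Bij K" using bij by (simp add: Bij_def s_def)
    moreover have "s \<in> ring_hom (complex_ring\<lparr>carrier := K\<rparr>) (complex_ring\<lparr>carrier := K\<rparr>)"
    proof (rule ring_hom_memI)
      show "s \<one>\<^bsub>complex_ring\<lparr>carrier := K\<rparr>\<^esub> = \<one>\<^bsub>complex_ring\<lparr>carrier := K\<rparr>\<^esub>"
        by (simp add: s frel_1)
    next
      fix x assume "x \<in> carrier (complex_ring\<lparr>carrier := K\<rparr>)"
      then show "s x \<in> carrier (complex_ring\<lparr>carrier := K\<rparr>)" using bij by (auto simp: bij_betw_def)
    next
      fix x y assume "x \<in> carrier (complex_ring\<lparr>carrier := K\<rparr>)" "y \<in> carrier (complex_ring\<lparr>carrier := K\<rparr>)"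
      then have "x \<in> K" "y \<in> K" by auto
      note xy = s'[OF this(1)] s'[OF this(2)]
      show "s (x \<otimes>\<^bsub>complex_ring\<lparr>carrier := K\<rparr>\<^esub> y) = s x \<otimes>\<^bsub>complex_ring\<lparr>carrier := K\<rparr>\<^esub> s y"
        using s[OF frel_mult[OF xy]] by simp
      show "s (x \<oplus>\<^bsub>complex_ring\<lparr>carrier := K\<rparr>\<^esub> y) = s x \<oplus>\<^bsub>complex_ring\<lparr>carrier := K\<rparr>\<^esub> s y"
        using s[OF frel_add[OF xy]] by simp
    qed
    moreover have "\<forall>q\<in>\<rat>. s q = q" using s[OF ratK] by blast
    ultimately show ?thesis by (simp add: galois_group_def Let_def K_def)
  qed
  moreover have "s (\<alpha> k) = \<alpha> (\<tau> k)" for k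
    using s[OF frel_var[of \<alpha> k \<beta>]] by (simp add: \<beta>_def)
  ultimately show ?thesis by (rule that)
qed

text \<open>The automorphism \<open>s\<close> induced by \<tau> moves the roots both as \<tau> and
  as \<open>\<phi> s\<close> prescribe. The roots being distinct, the two permutations
  coincide.\<close>

lemma relperms_subset_galois:
  assumes r: "extended_roots n f \<alpha>" and inj: "inj_on \<alpha> {1..n}"
    and iso: "\<phi> \<in> iso (galois_group f) ((sym_group n)\<lparr>carrier := G\<rparr>)"
    and compat: "\<forall>\<sigma>\<in>carrier (galois_group f). \<forall>i\<in>{1..n}. \<sigma> (\<alpha> i) = \<alpha> (\<phi> \<sigma> i)"
    and G: "G \<subseteq> perms n"
  shows "relperms n \<alpha> \<subseteq> G"
proof
  fix \<tau> assume \<tau>: "\<tau> \<in> relperms n \<alpha>"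
  obtain s where s: "s \<in> carrier (galois_group f)" "\<And>k. s (\<alpha> k) = \<alpha> (\<tau> k)"
    using relation_permutation_induces_automorphism[OF r \<tau>] by blast
  have \<phi>s: "\<phi> s \<in> G" using iso s(1) by (auto simp: iso_def hom_def)
  have \<tau>p: "\<tau> \<in> perms n" using \<tau> by (simp add: relperms_def)
  have \<phi>p: "\<phi> s \<in> perms n" using \<phi>s G by blast
  have "\<tau> k = \<phi> s k" for k
  proof (cases "k \<in> {1..n}")
    case True
    then have "\<alpha> (\<tau> k) = \<alpha> (\<phi> s k)" using s compat by metis
    then show ?thesis using inj_onD[OF inj] perms_in[OF \<tau>p True] perms_in[OF \<phi>p True] by blast
  next
    case False
    then show ?thesis using perms_out[OF \<tau>p] perms_out[OF \<phi>p] by metis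
  qed
  then have "\<tau> = \<phi> s" by blast
  then show "\<tau> \<in> G" using \<phi>s by simp
qed

lemma subgroup_relperms: "subgroup (relperms n \<alpha>) (sym_group n)"
proof
  show "relperms n \<alpha> \<subseteq> carrier (sym_group n)" by (auto simp: relperms_def sym_group_def)
  show "x \<otimes>\<^bsub>sym_group n\<^esub> y \<in> relperms n \<alpha>" if "x \<in> relperms n \<alpha>" "y \<in> relperms n \<alpha>" for x y
    using relperms_comp[OF that] by (simp add: sym_group_def o_def)
  show "\<one>\<^bsub>sym_group n\<^esub> \<in> relperms n \<alpha>" using relperms_id by (simp add: sym_group_def)
  show "inv\<^bsub>sym_group n\<^esub> x \<in> relperms n \<alpha>" if "x \<in> relperms n \<alpha>" for x
  proof -
    have "x \<in> carrier (sym_group n)" using that by (auto simp: relperms_def sym_group_def)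
    then have "inv\<^bsub>sym_group n\<^esub> x = inv_into UNIV x" by (rule sym_group_inv_equality)
    then show ?thesis using relperms_inv[OF that] by simp
  qed
qed

section \<open>The roots of a slice near infinity\<close>

text \<open>Only the shape of the remainder matters, so no division by factorials occurs and any
  commutative ring is allowed, power series included.\<close>

lemma ipeval_taylor:
  "\<exists>r. ipeval p (y + h) = ipeval p y + h * ipeval (pderiv p) y + h\<^sup>2 * r"
proof (induction p)
  case 0
  show ?case by (intro exI[of _ 0]) simp
next
  case (pCons a p)
  then obtain r where r: "ipeval p (y + h) = ipeval p y + h * ipeval (pderiv p) y + h\<^sup>2 * r" by blast
  show ?case
    by (intro exI[of _ "ipeval (pderiv p) y + (y + h) * r"])
      (simp add: ipeval_pCons pderiv_pCons ipeval_add r, simp add: algebra_simps power2_eq_square)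
qed

lemma ipeval_diff_dvd: "y - z dvd ipeval p y - ipeval p z"
proof -
  obtain r where "ipeval p (z + (y - z)) = ipeval p z + (y - z) * ipeval (pderiv p) z + (y - z)\<^sup>2 * r"
    using ipeval_taylor by blast
  then have "ipeval p y - ipeval p z = (y - z) * (ipeval (pderiv p) z + (y - z) * r)"
    by (simp add: algebra_simps power2_eq_square)
  then show ?thesis by simp
qed

lemma fps_X_power_dvdI:
  fixes f :: "'a::comm_ring_1 fps"
  assumes "\<And>i. i < k \<Longrightarrow> fps_nth f i = 0"
  shows "fps_X ^ k dvd f"
proof -
  have "f = fps_X ^ k * fps_shift k f"
    using assms by (intro fps_ext) (simp add: fps_X_power_mult_nth)
  then show ?thesis by (metis dvd_triv_left)
qed

lemma fps_X_power_dvdD: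
  fixes f :: "'a::comm_ring_1 fps"
  shows "fps_X ^ k dvd f \<Longrightarrow> i < k \<Longrightarrow> fps_nth f i = 0"
  by (auto elim!: dvdE simp: fps_X_power_mult_nth)

lemma ipeval_fps_nth_0: "fps_nth (ipeval p y) 0 = ipeval p (fps_nth y 0)"
  by (induction p) (simp_all add: ipeval_pCons fps_of_int)

lemma ipeval_fps_to_fls: "ipeval p (fps_to_fls y) = fps_to_fls (ipeval p y)"
  by (induction p) (simp_all add: ipeval_pCons fls_times_fps_to_fls)

lemma coeff_rootpoly_second: "Polynomial.coeff (rootpoly (Suc m) x) m = - (\<Sum>i=1..Suc m. x i)"
proof (induction m)
  case (Suc m)
  then show ?case by (simp add: coeff_rootpoly_Suc[of "Suc m"] algebra_simps)
qed (simp add: coeff_rootpoly_Suc)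

lemma ipeval_rootpoly:
  assumes "extended_roots n f \<alpha>"
  shows "ipeval f y = (\<Prod>i=1..n. y - \<alpha> i)"
proof -
  have "map_poly of_int f = rootpoly n \<alpha>"
    using assms by (simp add: extended_roots_def root_labelling_def rootpoly_def)
  then show ?thesis by (simp add: ipeval_def poly_rootpoly)
qed

lemma extended_roots_monic:
  assumes "extended_roots n f \<alpha>"
  shows "Polynomial.degree f = n" "Polynomial.coeff f n = 1"
proof -
  have f: "map_poly of_int f = rootpoly n \<alpha>"
    using assms by (simp add: extended_roots_def root_labelling_def rootpoly_def)
  then show d: "Polynomial.degree f = n" using degree_of_int_poly[of f] by simp
  have "of_int (Polynomial.coeff f n) = Polynomial.coeff (rootpoly n \<alpha>) n"
    by (simp add: coeff_map_poly flip: f)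
  then show "Polynomial.coeff f n = 1" by simp
qed

lemma ipeval_pderiv_root:
  assumes "extended_roots n f \<alpha>" "inj_on \<alpha> {1..n}" "i \<in> {1..n}"
  shows "ipeval (pderiv f) (\<alpha> i) \<noteq> 0"
proof -
  have "map_poly of_int f = rootpoly n \<alpha>"
    using assms by (simp add: extended_roots_def root_labelling_def rootpoly_def)
  also have "\<dots> = [:- \<alpha> i, 1:] * (\<Prod>j\<in>{1..n} - {i}. [:- \<alpha> j, 1:])"
    unfolding rootpoly_def using assms by (subst prod.remove[of _ i]) auto
  finally have f: "map_poly of_int f = [:- \<alpha> i, 1:] * (\<Prod>j\<in>{1..n} - {i}. [:- \<alpha> j, 1:])" .
  have "map_poly of_int (pderiv f) = pderiv (map_poly of_int f :: complex poly)"
    by (intro poly_eqI) (simp add: coeff_map_poly coeff_pderiv)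
  then have "ipeval (pderiv f) (\<alpha> i) = (\<Prod>j\<in>{1..n} - {i}. \<alpha> i - \<alpha> j)"
    unfolding ipeval_def f pderiv_mult by (simp add: pderiv_pCons poly_prod)
  moreover have "\<alpha> i - \<alpha> j \<noteq> 0" if j: "j \<in> {1..n} - {i}" for j
    using inj_onD[OF assms(2), of i j] assms(3) j by auto
  ultimately show ?thesis by (auto simp: prod_zero_iff)
qed

lemma frel_ipeval: "(a, b) \<in> frel \<alpha> \<beta> \<Longrightarrow> (ipeval p a, ipeval p b) \<in> frel \<alpha> \<beta>"
  by (induction p) (auto simp: ipeval_pCons intro: frel_0 frel_add frel_mult frel_of_int)

section \<open>Series whose coefficients correspond under a field map\<close>

definition fpsrel :: "(nat \<Rightarrow> 'a::field) \<Rightarrow> (nat \<Rightarrow> 'a) \<Rightarrow> ('a fps \<times> 'a fps) set" where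
  "fpsrel \<alpha> \<beta> = {(f, g). \<forall>j. (fps_nth f j, fps_nth g j) \<in> frel \<alpha> \<beta>}"

lemma fpsrel_add: "(f, g) \<in> fpsrel \<alpha> \<beta> \<Longrightarrow> (f', g') \<in> fpsrel \<alpha> \<beta> \<Longrightarrow> (f + f', g + g') \<in> fpsrel \<alpha> \<beta>"
  by (auto simp: fpsrel_def intro: frel_add)

lemma fpsrel_diff: "(f, g) \<in> fpsrel \<alpha> \<beta> \<Longrightarrow> (f', g') \<in> fpsrel \<alpha> \<beta> \<Longrightarrow> (f - f', g - g') \<in> fpsrel \<alpha> \<beta>"
  by (auto simp: fpsrel_def intro: frel_diff)

lemma fpsrel_mult: "(f, g) \<in> fpsrel \<alpha> \<beta> \<Longrightarrow> (f', g') \<in> fpsrel \<alpha> \<beta> \<Longrightarrow> (f * f', g * g') \<in> fpsrel \<alpha> \<beta>"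
  by (auto simp: fpsrel_def fps_mult_nth intro!: frel_sum frel_mult)

lemma fpsrel_const: "(a, b) \<in> frel \<alpha> \<beta> \<Longrightarrow> (fps_const a, fps_const b) \<in> fpsrel \<alpha> \<beta>"
  by (auto simp: fpsrel_def frel_0)

lemma fpsrel_X: "(fps_X, fps_X) \<in> fpsrel \<alpha> \<beta>"
  by (auto simp: fpsrel_def frel_0 frel_1 fps_X_def)

lemma fpsrel_of_int: "(of_int k, of_int k) \<in> fpsrel \<alpha> \<beta>"
  using fpsrel_const[OF frel_of_int] by (simp add: fps_of_int)

lemma fpsrel_ipeval: "(f, g) \<in> fpsrel \<alpha> \<beta> \<Longrightarrow> (ipeval p f, ipeval p g) \<in> fpsrel \<alpha> \<beta>"
  by (induction p) (use fpsrel_of_int[of 0] in \<open>auto simp: ipeval_pCons intro: fpsrel_add fpsrel_mult fpsrel_of_int\<close>)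

definition flsrel :: "(nat \<Rightarrow> 'a::field) \<Rightarrow> (nat \<Rightarrow> 'a) \<Rightarrow> ('a fls \<times> 'a fls) set" where
  "flsrel \<alpha> \<beta> = {(f, g). \<forall>j. (fls_nth f j, fls_nth g j) \<in> frel \<alpha> \<beta>}"

lemma flsrel_add: "(f, g) \<in> flsrel \<alpha> \<beta> \<Longrightarrow> (f', g') \<in> flsrel \<alpha> \<beta> \<Longrightarrow> (f + f', g + g') \<in> flsrel \<alpha> \<beta>"
  by (auto simp: flsrel_def intro: frel_add)

lemma flsrel_diff: "(f, g) \<in> flsrel \<alpha> \<beta> \<Longrightarrow> (f', g') \<in> flsrel \<alpha> \<beta> \<Longrightarrow> (f - f', g - g') \<in> flsrel \<alpha> \<beta>"
  by (auto simp: flsrel_def intro: frel_diff)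

text \<open>Related series may have different subdegrees. Common lower bounds let both product
  coefficients be summed over the same index range, where they can be compared term by term.\<close>

lemma fls_mult_nth_common:
  fixes f g :: "'a::comm_ring_1 fls"
  assumes "a \<le> fls_subdegree f" "b \<le> fls_subdegree g"
  shows "fls_nth (f * g) k = (\<Sum>i=a..k - b. fls_nth f i * fls_nth g (k - i))"
  unfolding fls_times_nth(2)
proof (rule sum.mono_neutral_left)
  show "\<forall>i\<in>{a..k - b} - {fls_subdegree f..k - fls_subdegree g}. fls_nth f i * fls_nth g (k - i) = 0"
  proof
    fix i assume "i \<in> {a..k - b} - {fls_subdegree f..k - fls_subdegree g}"
    then have "i < fls_subdegree f \<or> k - i < fls_subdegree g" by auto
    then show "fls_nth f i * fls_nth g (k - i) = 0" by auto
  qed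
qed (use assms in auto)

lemma flsrel_mult:
  assumes "(f, g) \<in> flsrel \<alpha> \<beta>" "(f', g') \<in> flsrel \<alpha> \<beta>"
  shows "(f * f', g * g') \<in> flsrel \<alpha> \<beta>"
proof -
  let ?a = "min (fls_subdegree f) (fls_subdegree g)" and ?b = "min (fls_subdegree f') (fls_subdegree g')"
  show ?thesis
    using assms unfolding flsrel_def
    by (auto simp: fls_mult_nth_common[of ?a f ?b f'] fls_mult_nth_common[of ?a g ?b g'] intro!: frel_sum frel_mult)
qed

lemma flsrel_fps: "(f, g) \<in> fpsrel \<alpha> \<beta> \<Longrightarrow> (fps_to_fls f, fps_to_fls g) \<in> flsrel \<alpha> \<beta>"
  by (auto simp: flsrel_def fpsrel_def frel_0)

lemma flsrel_0: "(0, 0) \<in> flsrel \<alpha> \<beta>"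
  by (simp add: flsrel_def frel_0)

lemma flsrel_sum:
  "(\<And>i. i \<in> A \<Longrightarrow> (f i, g i) \<in> flsrel \<alpha> \<beta>) \<Longrightarrow> (sum f A, sum g A) \<in> flsrel \<alpha> \<beta>"
  by (induction A rule: infinite_finite_induct) (auto intro: flsrel_add flsrel_0)

lemma flsrel_of_int: "(of_int k, of_int k) \<in> flsrel \<alpha> \<beta>"
  using flsrel_fps[OF fpsrel_of_int] by simp

lemma flsrel_X_inv: "(fls_X_inv, fls_X_inv) \<in> flsrel \<alpha> \<beta>"
  by (auto simp: flsrel_def frel_0 frel_1)

section \<open>The coefficients of a slice as functions of its parameter\<close>

text \<open>The values to be substituted for the output of \<open>esub\<close>: \<open>t\<close> at
  index 0, then the coefficients of \<open>f\<^sub>0 + t W\<close>, then integer parameters.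
  \<open>extend_params\<close> is the matching assignment on the side of the roots.\<close>

definition scoeff :: "nat \<Rightarrow> int poly \<Rightarrow> int poly \<Rightarrow> (nat \<Rightarrow> int) \<Rightarrow> nat \<Rightarrow> int poly" where
  "scoeff m f\<^sub>0 W p k = (if k = 0 then [:0, 1:] else if k \<le> Suc m
     then [:Polynomial.coeff f\<^sub>0 (Suc m - k), Polynomial.coeff W (Suc m - k):] else [:p k:])"

definition extend_params :: "nat \<Rightarrow> (nat \<Rightarrow> 'a::comm_ring_1) \<Rightarrow> 'a \<Rightarrow> (nat \<Rightarrow> int) \<Rightarrow> nat \<Rightarrow> 'a" where
  "extend_params n x y p k = (if k = 0 then y else if k \<le> n then x k else of_int (p k))"

lemma rootpoly_extend_params [simp]: "rootpoly n (extend_params n x y p) = rootpoly n x"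
  unfolding rootpoly_def by (intro prod.cong) (auto simp: extend_params_def)

lemma degree_scoeff: "Polynomial.degree (scoeff m f\<^sub>0 W p k) \<le> 1"
  by (simp add: scoeff_def)

lemma esub_scoeff:
  fixes y :: "'a::comm_ring_1"
  assumes "rootpoly (Suc m) x = map_poly of_int f\<^sub>0 + Polynomial.smult y (map_poly of_int W)"
  shows "esub (Suc m) (extend_params (Suc m) x y p) k = ipeval (scoeff m f\<^sub>0 W p k) y"
proof -
  let ?X = "extend_params (Suc m) x y p"
  show ?thesis
  proof (cases "k \<in> {1..Suc m}")
    case True
    have "esub (Suc m) ?X k = Polynomial.coeff (rootpoly (Suc m) x) (Suc m - k)"
      unfolding esub_def rootpoly_extend_params using True by (rule if_P)
    also have "\<dots> = of_int (Polynomial.coeff f\<^sub>0 (Suc m - k)) + y * of_int (Polynomial.coeff W (Suc m - k))"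
      unfolding assms Polynomial.coeff_add Polynomial.coeff_smult by (simp only: coeff_map_poly of_int_0)
    also have "\<dots> = ipeval (scoeff m f\<^sub>0 W p k) y"
      using True by (auto simp: scoeff_def ipeval_pCons)
    finally show ?thesis .
  next
    case False
    then have "esub (Suc m) ?X k = ?X k" unfolding esub_def by (rule if_not_P)
    also have "?X k = ipeval (scoeff m f\<^sub>0 W p k) y"
      using False by (auto simp: scoeff_def extend_params_def)
    finally show ?thesis .
  qed
qed

text \<open>The variable of the series is \<open>1 / t\<close>: as \<open>t\<close> tends to infinity, \<open>m\<close> of the roots of
  \<open>f\<^sub>0 + t W\<close> tend to the roots of \<open>W\<close>, and the remaining one has a pole.\<close>

locale slice =
  fixes m :: nat and W f\<^sub>0 :: "int poly" and \<beta> :: "nat \<Rightarrow> complex"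
  assumes m: "m \<ge> 1" and roots: "extended_roots m W \<beta>" and inj: "inj_on \<beta> {1..m}"
    and full: "relperms m \<beta> = perms m"
    and f0: "Polynomial.degree f\<^sub>0 = Suc m" "Polynomial.coeff f\<^sub>0 (Suc m) = 1" "Polynomial.coeff f\<^sub>0 m = 0"
    and coprime: "\<And>j. j \<in> {1..m} \<Longrightarrow> ipeval f\<^sub>0 (\<beta> j) \<noteq> 0"
begin

text \<open>With \<open>fps_X\<close> in the role of \<open>1 / t\<close> this is the slice
  polynomial divided by \<open>t\<close>.\<close>

definition err :: "complex fps \<Rightarrow> complex fps" where
  "err y = ipeval W y + fps_X * ipeval f\<^sub>0 y"

text \<open>The derivative is frozen at its constant term. One order of \<open>fps_X\<close> is
  still gained per step, and all coefficients are rational expressions in \<open>b\<close>, formed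
  by the same recipe for every root of \<open>W\<close>.\<close>

fun newton :: "complex \<Rightarrow> nat \<Rightarrow> complex fps" where
  "newton b 0 = fps_const b"
| "newton b (Suc k) = newton b k - fps_const (inverse (ipeval (pderiv W) b)) * err (newton b k)"

definition branch :: "complex \<Rightarrow> complex fps" where
  "branch b = Abs_fps (\<lambda>k. fps_nth (newton b k) k)"

lemma newton_step:
  assumes b: "ipeval W b = 0" "ipeval (pderiv W) b \<noteq> 0"
  shows "fps_X ^ Suc k dvd err (newton b k) \<and> fps_nth (newton b k) 0 = b"
proof (induction k)
  case 0
  have "fps_nth (err (fps_const b)) 0 = 0" by (simp add: err_def ipeval_fps_nth_0 b)
  then have "fps_X ^ Suc 0 dvd err (newton b 0)" by (intro fps_X_power_dvdI) auto
  then show ?case by simp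
next
  case (Suc k)
  define y where "y = newton b k"
  define E where "E = err y"
  define c where "c = fps_const (inverse (ipeval (pderiv W) b))"
  have dvdE: "fps_X ^ Suc k dvd E" and y0: "fps_nth y 0 = b" using Suc by (auto simp: y_def E_def)
  have E0: "fps_nth E 0 = 0" by (rule fps_X_power_dvdD[OF dvdE]) simp
  have ny: "newton b (Suc k) = y + - (c * E)" by (simp add: y_def E_def c_def)
  obtain r where r: "ipeval W (y + - (c * E)) = ipeval W y + - (c * E) * ipeval (pderiv W) y + (- (c * E))\<^sup>2 * r"
    using ipeval_taylor by blast
  obtain r' where r': "ipeval f\<^sub>0 (y + - (c * E)) = ipeval f\<^sub>0 y + - (c * E) * ipeval (pderiv f\<^sub>0) y + (- (c * E))\<^sup>2 * r'"
    using ipeval_taylor by blast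
  \<comment> \<open>The factor by which one step multiplies the error. As \<open>E\<close> has
    constant term 0, the constant term of \<open>G\<close> is
    \<open>1 - W'(b) / W'(b) = 0\<close>.\<close>
  define G where "G = 1 - c * (ipeval (pderiv W) y + fps_X * ipeval (pderiv f\<^sub>0) y) + c\<^sup>2 * E * (r + fps_X * r')"
  have "err (newton b (Suc k)) = E + - (c * E) * (ipeval (pderiv W) y + fps_X * ipeval (pderiv f\<^sub>0) y)
      + (- (c * E))\<^sup>2 * (r + fps_X * r')"
    unfolding ny err_def r r' by (simp add: E_def err_def algebra_simps)
  also have "\<dots> = E * G" by (simp add: G_def algebra_simps power2_eq_square)
  finally have "err (newton b (Suc k)) = E * G" .
  moreover have "fps_X ^ 1 dvd G"
  proof (rule fps_X_power_dvdI)
    fix i :: nat assume "i < 1"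
    then show "fps_nth G i = 0" using b by (simp add: G_def c_def ipeval_fps_nth_0 y0 E0)
  qed
  then have "fps_X ^ Suc k * fps_X ^ 1 dvd E * G" using dvdE by (intro mult_dvd_mono)
  moreover have "fps_nth (newton b (Suc k)) 0 = b" using y0 E0 by (simp add: y_def E_def)
  ultimately show ?case by (simp add: mult.commute)
qed

lemma branch:
  assumes b: "ipeval W b = 0" "ipeval (pderiv W) b \<noteq> 0"
  shows "err (branch b) = 0" "fps_nth (branch b) 0 = b"
proof -
  have step: "fps_nth (newton b (Suc j)) i = fps_nth (newton b j) i" if "i \<le> j" for i j
  proof -
    have "fps_X ^ Suc j dvd fps_const (inverse (ipeval (pderiv W) b)) * err (newton b j)"
      using newton_step[OF b] by (intro dvd_mult) blast
    from fps_X_power_dvdD[OF this, of i] that show ?thesis by simp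
  qed
  have stable: "fps_nth (newton b (i + d)) i = fps_nth (newton b i) i" for i d
    by (induction d) (use step in auto)
  have bn: "fps_X ^ Suc k dvd branch b - newton b k" for k
  proof (rule fps_X_power_dvdI)
    fix i assume "i < Suc k"
    then show "fps_nth (branch b - newton b k) i = 0"
      using stable[of i "k - i"] by (simp add: branch_def)
  qed
  show "err (branch b) = 0"
  proof (rule fps_ext)
    fix k
    have eq: "err (branch b) = err (newton b k) + (ipeval W (branch b) - ipeval W (newton b k)) +
        fps_X * (ipeval f\<^sub>0 (branch b) - ipeval f\<^sub>0 (newton b k))"
      by (simp add: err_def algebra_simps)
    have "fps_X ^ Suc k dvd err (branch b)"
      unfolding eq using newton_step[OF b, of k] dvd_trans[OF bn ipeval_diff_dvd]
      by (intro dvd_add dvd_mult) blast+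
    from fps_X_power_dvdD[OF this, of k] show "fps_nth (err (branch b)) k = fps_nth 0 k" by simp
  qed
  show "fps_nth (branch b) 0 = b" by (simp add: branch_def)
qed

lemma W_root: "i \<in> {1..m} \<Longrightarrow> ipeval W (\<beta> i) = 0"
  by (auto simp: ipeval_rootpoly[OF roots] prod_zero_iff)

lemmas W_deriv = ipeval_pderiv_root[OF roots inj]

text \<open>The branches at \<open>\<beta> i\<close> and at its image under \<sigma> arise from one
  algebraic construction, so their coefficients correspond as the two roots do.\<close>

lemma fpsrel_branch:
  assumes \<sigma>: "\<sigma> \<in> perms m" and i: "i \<in> {1..m}"
  shows "(branch (\<beta> i), branch (\<beta> (\<sigma> i))) \<in> fpsrel \<beta> (\<lambda>k. \<beta> (\<sigma> k))"
proof -
  let ?r = "frel \<beta> (\<lambda>k. \<beta> (\<sigma> k))" and ?R = "fpsrel \<beta> (\<lambda>k. \<beta> (\<sigma> k))"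
  have b: "(\<beta> i, \<beta> (\<sigma> i)) \<in> ?r" by (rule frel_var)
  have inv: "(inverse (ipeval (pderiv W) (\<beta> i)), inverse (ipeval (pderiv W) (\<beta> (\<sigma> i)))) \<in> ?r"
    by (intro frel_inverse frel_ipeval b W_deriv i perms_in[OF \<sigma>])
  have "(newton (\<beta> i) k, newton (\<beta> (\<sigma> i)) k) \<in> ?R" for k
  proof (induction k)
    case 0
    show ?case using fpsrel_const[OF b] by simp
  next
    case (Suc k)
    then show ?case unfolding newton.simps err_def
      by (intro fpsrel_diff fpsrel_mult fpsrel_add fpsrel_const inv fpsrel_X fpsrel_ipeval)
  qed
  then show ?thesis by (simp add: fpsrel_def branch_def)
qed

text \<open>The last root is forced by the sum of the roots: the second coefficient of the slice
  polynomial is \<open>0 + t\<close>, so all roots add up to \<open>-t\<close>.\<close>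

definition x :: "nat \<Rightarrow> complex fls" where
  "x k = (if k = 0 then fls_X_inv else if k \<in> {1..m} then fps_to_fls (branch (\<beta> k))
     else if k = Suc m then - fls_X_inv - (\<Sum>i=1..m. fps_to_fls (branch (\<beta> i))) else 0)"

lemma x_0 [simp]: "x 0 = fls_X_inv" by (simp add: x_def)

lemma x_branch: "i \<in> {1..m} \<Longrightarrow> x i = fps_to_fls (branch (\<beta> i))"
  by (auto simp: x_def)

lemma x_last: "x (Suc m) = - fls_X_inv - fps_to_fls (\<Sum>i=1..m. branch (\<beta> i))"
proof -
  have "fps_to_fls (\<Sum>i\<in>A. branch (\<beta> i)) = (\<Sum>i\<in>A. fps_to_fls (branch (\<beta> i)))" for A
    by (induction A rule: infinite_finite_induct) auto
  then show ?thesis by (simp add: x_def)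
qed

lemma x_outside: "k > Suc m \<Longrightarrow> x k = 0" by (simp add: x_def)

lemma inj_x: "inj_on x {1..Suc m}"
proof (rule inj_onI)
  fix i j assume ij: "i \<in> {1..Suc m}" "j \<in> {1..Suc m}" "x i = x j"
  have c0: "fls_nth (x i) 0 = \<beta> i" if "i \<in> {1..m}" for i
    using that branch(2)[OF W_root W_deriv] by (simp add: x_branch)
  have cm: "fls_nth (x i) (-1) = 0" if "i \<in> {1..m}" for i using that by (simp add: x_branch)
  have cl: "fls_nth (x (Suc m)) (-1) = -1" by (simp add: x_last)
  show "i = j"
  proof (cases "i = Suc m \<or> j = Suc m")
    case True
    then show ?thesis using ij cm cl by (metis (no_types, lifting) atLeastAtMost_iff le_Suc_eq zero_neq_neg_one)
  next
    case False
    then have "i \<in> {1..m}" "j \<in> {1..m}" using ij by auto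
    then show ?thesis using c0 ij inj by (metis inj_onD)
  qed
qed

text \<open>The difference of both sides has degree below \<open>m\<close>, where the coefficient at
  \<open>m\<close> agrees by the choice of the last root, and it vanishes at the \<open>m\<close>
  distinct branches.\<close>

lemma rootpoly_x:
  "rootpoly (Suc m) x = map_poly of_int f\<^sub>0 + Polynomial.smult fls_X_inv (map_poly of_int W)" (is "?L = ?R")
proof -
  note W = extended_roots_monic[OF roots]
  define d where "d = ?L - ?R"
  have cR: "Polynomial.coeff ?R k = of_int (Polynomial.coeff f\<^sub>0 k) + fls_X_inv * of_int (Polynomial.coeff W k)" for k
    by (simp add: coeff_map_poly)
  have sumx: "(\<Sum>i=1..Suc m. x i) = - fls_X_inv"
  proof -
    have "(\<Sum>i=1..m. x i) = (\<Sum>i=1..m. fps_to_fls (branch (\<beta> i)))"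
      by (intro sum.cong refl x_branch)
    then show ?thesis by (simp add: x_def)
  qed
  have "Polynomial.coeff d k = 0" if k: "k \<ge> m" for k
  proof -
    consider "k = m" | "k = Suc m" | "k > Suc m" using k by linarith
    then show ?thesis
    proof cases
      case 1
      then show ?thesis unfolding d_def Polynomial.coeff_diff cR coeff_rootpoly_second sumx 1 by (simp add: f0 W)
    next
      case 2
      have "Polynomial.coeff W (Suc m) = 0" using W by (intro coeff_eq_0) simp
      then show ?thesis unfolding d_def Polynomial.coeff_diff cR 2 by (simp add: f0)
    next
      case 3
      have "Polynomial.coeff W k = 0" "Polynomial.coeff f\<^sub>0 k = 0" "Polynomial.coeff ?L k = 0"
        using W f0 3 by (auto intro: coeff_eq_0)
      then show ?thesis unfolding d_def Polynomial.coeff_diff cR by simp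
    qed
  qed
  then have dd: "Polynomial.degree d < m"
    using m by (cases "d = 0") (auto intro: degree_lessI)
  have rt: "poly d (x i) = 0" if i: "i \<in> {1..m}" for i
  proof -
    have "poly ?L (x i) = 0" using i by (auto simp: poly_rootpoly prod_zero_iff)
    moreover have "poly ?R (x i) = fls_X_inv * fps_to_fls (err (branch (\<beta> i)))"
    proof -
      have "poly ?R (x i) = ipeval f\<^sub>0 (x i) + fls_X_inv * ipeval W (x i)" by (simp add: ipeval_def)
      also have "\<dots> = fls_X_inv * (ipeval W (x i) + fls_X * ipeval f\<^sub>0 (x i))"
        by (simp add: algebra_simps fls_X_times_conv_shift fls_X_inv_times_conv_shift)
      finally show ?thesis by (simp add: x_branch[OF i] ipeval_fps_to_fls err_def fls_times_fps_to_fls)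
    qed
    ultimately show ?thesis using branch(1)[OF W_root W_deriv, OF i i] by (simp add: d_def)
  qed
  have "inj_on x {1..m}" using inj_x by (rule inj_on_subset) auto
  then have "d = 0" using dd by (intro poly_eq_0_of_roots[OF rt]) auto
  then show ?thesis by (simp add: d_def)
qed

lemma x_root: "i \<in> {1..Suc m} \<Longrightarrow> ipeval f\<^sub>0 (x i) + fls_X_inv * ipeval W (x i) = 0"
proof -
  assume i: "i \<in> {1..Suc m}"
  have "poly (rootpoly (Suc m) x) (x i) = 0" using i unfolding poly_rootpoly by (intro prod_zero) auto
  then show ?thesis unfolding rootpoly_x by (simp add: ipeval_def)
qed

text \<open>This is where the pole is used. The reciprocal \<open>s\<close> of the last root is a
  power series without constant term, so the constant term of the reflected polynomial at
  \<open>s\<close> is the leading coefficient of \<open>p\<close>.\<close>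

lemma x_last_transcendental:
  assumes "ipeval p (x (Suc m)) = 0"
  shows "p = 0"
proof (rule ccontr)
  assume p: "p \<noteq> 0"
  define S where "S = (\<Sum>i=1..m. branch (\<beta> i))"
  define s where "s = - fps_X * inverse (1 + fps_X * S)"
  have "(1 + fps_X * S) * inverse (1 + fps_X * S) = 1" by (intro inverse_mult_eq_1') simp
  then have "fls_X_inv * fls_X * fps_to_fls ((1 + fps_X * S) * inverse (1 + fps_X * S)) = 1"
    by (simp add: fls_X_inv_times_conv_shift fls_X_conv_shift_1)
  moreover have "x (Suc m) * fps_to_fls s = fls_X_inv * fls_X * fps_to_fls ((1 + fps_X * S) * inverse (1 + fps_X * S))"
  proof -
    have "x (Suc m) = - fls_X_inv * fps_to_fls (1 + fps_X * S)"
      unfolding x_last S_def[symmetric]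
      by (simp add: fls_times_fps_to_fls distrib_left fls_X_times_conv_shift fls_X_inv_times_conv_shift)
    then show ?thesis by (simp add: s_def fls_times_fps_to_fls)
  qed
  ultimately have xs: "x (Suc m) * fps_to_fls s = 1" by simp
  then have s0: "fps_to_fls s \<noteq> 0" and inv: "inverse (fps_to_fls s) = x (Suc m)"
    by (auto intro: inverse_unique simp: mult.commute)
  have refl: "map_poly of_int (reflect_poly p) = reflect_poly (map_poly of_int p :: complex fls poly)"
    by (intro poly_eqI) (simp add: coeff_map_poly coeff_reflect_poly degree_map_poly)
  have "ipeval (reflect_poly p) (fps_to_fls s) = fps_to_fls s ^ Polynomial.degree p * ipeval p (x (Suc m))"
    unfolding ipeval_def refl by (subst poly_reflect_poly_nz[OF s0]) (simp add: inv degree_map_poly)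
  then have "ipeval (reflect_poly p) s = 0" using assms by (simp add: ipeval_fps_to_fls)
  then have "ipeval (reflect_poly p) (fps_nth s 0) = 0" by (metis ipeval_fps_nth_0 fps_zero_nth)
  moreover have "fps_nth s 0 = 0" by (simp add: s_def)
  moreover have "ipeval q (0::complex) = of_int (Polynomial.coeff q 0)" for q
    by (cases q) (simp add: ipeval_pCons)
  ultimately show False using p by simp
qed

text \<open>Otherwise \<open>f\<^sub>0\<close> vanishes at the same root: impossible at the last
  root by transcendence, and at a branch because the constant terms would give \<open>W\<close> and
  \<open>f\<^sub>0\<close> a common root.\<close>

lemma W_x_nonzero:
  assumes "i \<in> {1..Suc m}"
  shows "ipeval W (x i) \<noteq> 0"
proof
  assume 0: "ipeval W (x i) = 0"
  then have 1: "ipeval f\<^sub>0 (x i) = 0" using x_root[OF assms] by simp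
  show False
  proof (cases "i = Suc m")
    case True
    then have "f\<^sub>0 = 0" using 1 x_last_transcendental by blast
    then show False using f0 by simp
  next
    case False
    then have i: "i \<in> {1..m}" using assms by auto
    have "ipeval f\<^sub>0 (branch (\<beta> i)) = 0" using 1 by (simp add: x_branch[OF i] ipeval_fps_to_fls)
    then have "ipeval f\<^sub>0 (fps_nth (branch (\<beta> i)) 0) = 0" by (metis ipeval_fps_nth_0 fps_zero_nth)
    then show False using coprime[OF i] branch(2)[OF W_root W_deriv, OF i i] by simp
  qed
qed

text \<open>All roots are conjugate over the rational functions in \<open>t\<close>. Each root
  determines \<open>t\<close> as \<open>-f\<^sub>0(x) / W(x)\<close>, so a relation between
  \<open>t\<close> and the last root becomes a polynomial in that root alone; by transcendence this
  polynomial is zero and can be read at any other root.\<close>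

lemma x_last_generic:
  fixes B :: "nat \<Rightarrow> int poly"
  assumes "(\<Sum>k\<le>d. ipeval (B k) fls_X_inv * x (Suc m) ^ k) = 0" "j \<in> {1..Suc m}"
  shows "(\<Sum>k\<le>d. ipeval (B k) fls_X_inv * x j ^ k) = 0"
proof -
  define D where "D = Max (Polynomial.degree ` B ` {..d})"
  have D: "Polynomial.degree (B k) \<le> D" if "k \<le> d" for k using that by (auto simp: D_def)
  \<comment> \<open>The polynomial \<open>c\<close>, homogenised in degree \<open>D\<close>, at the
    numerator and denominator of \<open>t = -f\<^sub>0(x) / W(x)\<close>; \<open>hom\<close> clears
    the denominators.\<close>
  define h where "h c = (\<Sum>l\<le>D. Polynomial.smult (Polynomial.coeff c l) ((- f\<^sub>0) ^ l * W ^ (D - l)))" for c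
  have ip: "ipeval c y = (\<Sum>l\<le>D. of_int (Polynomial.coeff c l) * y ^ l)" if "Polynomial.degree c \<le> D" for c and y :: "complex fls"
  proof -
    have "ipeval c y = (\<Sum>l\<le>Polynomial.degree c. of_int (Polynomial.coeff c l) * y ^ l)"
      by (simp add: ipeval_def poly_altdef coeff_map_poly degree_map_poly)
    also have "\<dots> = (\<Sum>l\<le>D. of_int (Polynomial.coeff c l) * y ^ l)"
      using that by (intro sum.mono_neutral_left) (auto simp: coeff_eq_0)
    finally show ?thesis .
  qed
  have hom: "ipeval (h c) (x i) = ipeval W (x i) ^ D * ipeval c fls_X_inv"
    if "Polynomial.degree c \<le> D" and i: "i \<in> {1..Suc m}" for c i
  proof -
    have eq: "- ipeval f\<^sub>0 (x i) = fls_X_inv * ipeval W (x i)" using x_root[OF i] by (simp add: neg_eq_iff_add_eq_0)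
    have "ipeval (h c) (x i) = (\<Sum>l\<le>D. of_int (Polynomial.coeff c l) * ((- ipeval f\<^sub>0 (x i)) ^ l * ipeval W (x i) ^ (D - l)))"
      by (simp add: h_def ipeval_sum ipeval_smult ipeval_mult ipeval_power ipeval_minus)
    also have "\<dots> = (\<Sum>l\<le>D. ipeval W (x i) ^ D * (of_int (Polynomial.coeff c l) * fls_X_inv ^ l))"
    proof (rule sum.cong[OF refl])
      fix l assume "l \<in> {..D}"
      then have "ipeval W (x i) ^ D = ipeval W (x i) ^ l * ipeval W (x i) ^ (D - l)"
        by (simp flip: power_add)
      then show "of_int (Polynomial.coeff c l) * ((- ipeval f\<^sub>0 (x i)) ^ l * ipeval W (x i) ^ (D - l)) =
          ipeval W (x i) ^ D * (of_int (Polynomial.coeff c l) * fls_X_inv ^ l)"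
        unfolding eq power_mult_distrib by (simp add: algebra_simps)
    qed
    also have "\<dots> = ipeval W (x i) ^ D * ipeval c fls_X_inv"
      by (simp add: ip[OF that(1)] sum_distrib_left)
    finally show ?thesis .
  qed
  define b where "b = (\<Sum>k\<le>d. h (B k) * [:0, 1:] ^ k)"
  have b: "ipeval b (x i) = ipeval W (x i) ^ D * (\<Sum>k\<le>d. ipeval (B k) fls_X_inv * x i ^ k)"
    if i: "i \<in> {1..Suc m}" for i
    by (simp add: b_def ipeval_sum ipeval_mult ipeval_power hom[OF D i] sum_distrib_left mult.assoc)
  have "ipeval b (x (Suc m)) = 0" using b[of "Suc m"] assms(1) by simp
  then have "b = 0" by (rule x_last_transcendental)
  then have "ipeval W (x j) ^ D * (\<Sum>k\<le>d. ipeval (B k) fls_X_inv * x j ^ k) = 0"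
    using b[OF assms(2)] by simp
  then show ?thesis using W_x_nonzero[OF assms(2)] by simp
qed

lemma esub_x: "esub (Suc m) x k = ipeval (scoeff m f\<^sub>0 W (\<lambda>_. 0) k) fls_X_inv"
proof -
  have "x = extend_params (Suc m) x fls_X_inv (\<lambda>_. 0)"
    by (rule ext) (simp add: extend_params_def x_outside)
  then show ?thesis using esub_scoeff[OF rootpoly_x] by metis
qed

text \<open>A permutation of the roots of \<open>W\<close> preserves their relations by
  \<open>full\<close>, hence acts on series coefficientwise. It permutes the branches and fixes
  \<open>t\<close> and the last root, which is symmetric in the branches.\<close>

lemma perms_last_fixed: "perms m \<subseteq> relperms (Suc m) x"
proof (rule subsetI)
  fix \<sigma> assume \<sigma>: "\<sigma> \<in> perms m"
  let ?b = "\<lambda>k. \<beta> (\<sigma> k)"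
  have out: "\<sigma> k = k" if k: "k \<notin> {1..m}" for k
    using perms_out[OF \<sigma> k] by blast
  have "(x k, x (\<sigma> k)) \<in> flsrel \<beta> ?b" for k
  proof -
    have br: "(x i, x (\<sigma> i)) \<in> flsrel \<beta> ?b" if i: "i \<in> {1..m}" for i
    proof -
      have "x (\<sigma> i) = fps_to_fls (branch (\<beta> (\<sigma> i)))" by (rule x_branch[OF perms_in[OF \<sigma> i]])
      then show ?thesis using flsrel_fps[OF fpsrel_branch[OF \<sigma> i]] x_branch[OF i] by metis
    qed
    consider "k = 0" | "k \<in> {1..m}" | "k = Suc m" | "k > Suc m" unfolding atLeastAtMost_iff by linarith
    then show ?thesis
    proof cases
      case 1
      then show ?thesis using out[of 0] flsrel_X_inv by simp
    next
      case 2
      then show ?thesis by (rule br)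
    next
      case 3
      have xl: "x (Suc m) = 0 - fls_X_inv - (\<Sum>i\<in>{1..m}. x i)"
      proof -
        have "(\<Sum>i\<in>{1..m}. x i) = (\<Sum>i=1..m. fps_to_fls (branch (\<beta> i)))"
          by (intro sum.cong refl x_branch)
        then show ?thesis by (simp add: x_def[of "Suc m"])
      qed
      also have "(\<Sum>i\<in>{1..m}. x i) = (\<Sum>i\<in>{1..m}. x (\<sigma> i))"
        using \<sigma> by (subst sum.permute[of \<sigma>]) (simp_all add: o_def)
      finally have "x (Suc m) = 0 - fls_X_inv - (\<Sum>i\<in>{1..m}. x (\<sigma> i))" .
      moreover have "(0 - fls_X_inv - (\<Sum>i\<in>{1..m}. x i), 0 - fls_X_inv - (\<Sum>i\<in>{1..m}. x (\<sigma> i))) \<in> flsrel \<beta> ?b"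
        using flsrel_of_int[of 0] by (intro flsrel_diff flsrel_sum br flsrel_X_inv) auto
      ultimately show ?thesis using xl out[of "Suc m"] 3 by simp
    next
      case 4
      then show ?thesis using out[of k] flsrel_of_int[of 0] by (simp add: x_outside)
    qed
  qed
  then have rel: "(meval x P, meval (\<lambda>k. x (\<sigma> k)) P) \<in> flsrel \<beta> ?b" for P
    by (induction P rule: mpol_induct) (simp_all add: meval_hom flsrel_of_int flsrel_add flsrel_mult)
  have r: "meval ?b P = 0" if "meval \<beta> P = 0" for P
  proof -
    have "\<sigma> \<in> relperms m \<beta>" using full \<sigma> by blast
    then show ?thesis using that unfolding relperms_def by blast
  qed
  have "meval (\<lambda>k. x (\<sigma> k)) P = 0" if P: "meval x P = 0" for P
  proof (rule fls_eqI)
    fix k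
    have "(0, fls_nth (meval (\<lambda>k. x (\<sigma> k)) P) k) \<in> frel \<beta> ?b"
      using rel[of P] P by (auto simp: flsrel_def)
    then show "fls_nth (meval (\<lambda>k. x (\<sigma> k)) P) k = fls_nth 0 k"
      using frel_zero[of _ \<beta> ?b] r by simp
  qed
  moreover have "\<sigma> permutes {1..Suc m}" using \<sigma> permutes_subset[of \<sigma> "{1..m}" "{1..Suc m}"] by auto
  ultimately show "\<sigma> \<in> relperms (Suc m) x" by (simp add: relperms_def)
qed

text \<open>The group contains the full stabiliser of the last root, and the last root is conjugate
  to every other one. To use both for a relation \<open>P\<close> and a permutation \<rho>, the
  relation is averaged over the stabiliser by Lagrange interpolation. The average is a relation
  between \<open>t\<close> and the last root only, which \<rho> may move; the interpolation is then
  undone at \<rho>.\<close>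

theorem relperms_x: "relperms (Suc m) x = perms (Suc m)"
proof (rule subset_antisym)
  show "relperms (Suc m) x \<subseteq> perms (Suc m)" by (auto simp: relperms_def)
  show "perms (Suc m) \<subseteq> relperms (Suc m) x"
  proof (rule subsetI)
    fix \<rho> assume \<rho>: "\<rho> \<in> perms (Suc m)"
    obtain c where c: "separates (Suc m) x c" using separates_exists[OF inj_x] by blast
    let ?L = "lform (Suc m) c"
    have "meval (\<lambda>k. x (\<rho> k)) P = 0" if P: "meval x P = 0" for P
    proof -
      define q where "q = (\<Sum>\<sigma>\<in>perms m. Polynomial.smult (meval (\<lambda>k. x (\<rho> (\<sigma> k))) P)
        (\<Prod>\<sigma>'\<in>perms m - {\<sigma>}. [:- meval (\<lambda>k. x (\<rho> (\<sigma>' k))) ?L, 1:]))"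
      have qy: "poly q Y = (\<Sum>\<sigma>\<in>perms m. meval (\<lambda>k. x (\<rho> (\<sigma> k))) P *
          (\<Prod>\<sigma>'\<in>perms m - {\<sigma>}. Y - meval (\<lambda>k. x (\<rho> (\<sigma>' k))) ?L))" for Y
        by (simp add: q_def poly_sum poly_prod)
      \<comment> \<open>Natural numbers as interpolation points are trivially symmetric and
        rational; infinitely many of them make \<open>q\<close> zero as a polynomial.\<close>
      have "poly q (of_nat y) = 0" for y :: nat
      proof -
        let ?A = "lagr m (of_nat y) ?L P"
        have "symm m (of_nat y)" by (simp add: symm_def)
        then have "symm m ?A" by (rule symm_lagr)
        then obtain Q where Q: "?A = (\<Sum>k\<le>m. meval (esub (Suc m) mvar) (Q k) * mvar (Suc m) ^ k)"
          using almost_symmetric_expansion by blast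
        define B where "B k = meval (scoeff m f\<^sub>0 W (\<lambda>_. 0)) (Q k)" for k
        have ev: "meval (\<lambda>k. x (\<pi> k)) ?A = (\<Sum>k\<le>m. ipeval (B k) fls_X_inv * x (\<pi> (Suc m)) ^ k)"
          if \<pi>: "\<pi> \<in> perms (Suc m)" for \<pi>
        proof -
          have "esub (Suc m) (\<lambda>k. x (\<pi> k)) k = ipeval (scoeff m f\<^sub>0 W (\<lambda>_. 0) k) fls_X_inv" for k
            using \<pi> by (simp only: mem_perms esub_permute esub_x)
          then have "esub (Suc m) (\<lambda>k. x (\<pi> k)) = (\<lambda>k. ipeval (scoeff m f\<^sub>0 W (\<lambda>_. 0) k) fls_X_inv)" by blast
          then show ?thesis unfolding Q meval_sum meval_mult meval_power meval_meval_esub meval_var B_def ipeval_meval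
            by simp
        qed
        have "meval x ?A = 0"
          unfolding meval_lagr
        proof (rule sum.neutral, rule ballI)
          fix \<sigma> assume "\<sigma> \<in> perms m"
          then have "meval (\<lambda>k. x (\<sigma> k)) P = 0" using perms_last_fixed P by (auto simp: relperms_def)
          then show "meval (\<lambda>k. x (\<sigma> k)) P * (\<Prod>\<sigma>'\<in>perms m - {\<sigma>}. meval x (of_nat y) - meval (\<lambda>k. x (\<sigma>' k)) ?L) = 0"
            by simp
        qed
        moreover have "id \<in> perms (Suc m)" by (simp add: permutes_id)
        ultimately have "(\<Sum>k\<le>m. ipeval (B k) fls_X_inv * x (Suc m) ^ k) = 0"
          using ev[of id] by simp
        moreover have "\<rho> (Suc m) \<in> {1..Suc m}" by (rule perms_in[OF \<rho>]) simp
        ultimately have "meval (\<lambda>k. x (\<rho> k)) ?A = 0"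
          unfolding ev[OF \<rho>] by (rule x_last_generic)
        then show ?thesis by (simp add: meval_lagr qy)
      qed
      then have "{c::nat. poly q (of_nat c) = 0} = UNIV" by blast
      then have "q = 0" using card_vanishing_nats(1)[of q] by fastforce
      have idm: "id \<in> perms m" by (simp add: permutes_id)
      \<comment> \<open>At this argument only the term of \<open>id\<close> survives, and its
        denominator is nonzero because \<open>c\<close> separates.\<close>
      have "poly q (meval (\<lambda>k. x (\<rho> k)) ?L) = meval (\<lambda>k. x (\<rho> k)) P *
          (\<Prod>\<sigma>'\<in>perms m - {id}. meval (\<lambda>k. x (\<rho> k)) ?L - meval (\<lambda>k. x (\<rho> (\<sigma>' k))) ?L)"
        unfolding qy
      proof -
        let ?y = "meval (\<lambda>k. x (\<rho> k)) ?L"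
        let ?t = "\<lambda>\<sigma>. meval (\<lambda>k. x (\<rho> (\<sigma> k))) P * (\<Prod>\<sigma>'\<in>perms m - {\<sigma>}. ?y - meval (\<lambda>k. x (\<rho> (\<sigma>' k))) ?L)"
        have "(\<Sum>\<sigma>\<in>perms m. ?t \<sigma>) = (\<Sum>\<sigma>\<in>{id}. ?t \<sigma>)"
        proof (rule sum.mono_neutral_right)
          show "\<forall>i\<in>perms m - {id}. ?t i = 0"
          proof
            fix i assume "i \<in> perms m - {id}"
            then have "(\<Prod>\<sigma>'\<in>perms m - {i}. ?y - meval (\<lambda>k. x (\<rho> (\<sigma>' k))) ?L) = 0"
              using idm by (intro prod_zero) (auto intro!: bexI[of _ id])
            then show "?t i = 0" by simp
          qed
        qed (use idm in auto)
        then show "(\<Sum>\<sigma>\<in>perms m. ?t \<sigma>) = meval (\<lambda>k. x (\<rho> k)) P *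
          (\<Prod>\<sigma>'\<in>perms m - {id}. ?y - meval (\<lambda>k. x (\<rho> (\<sigma>' k))) ?L)" by simp
      qed
      moreover have "(\<Prod>\<sigma>'\<in>perms m - {id}. meval (\<lambda>k. x (\<rho> k)) ?L - meval (\<lambda>k. x (\<rho> (\<sigma>' k))) ?L) \<noteq> 0"
      proof -
        have "meval (\<lambda>k. x (\<rho> k)) ?L \<noteq> meval (\<lambda>k. x (\<rho> (\<sigma>' k))) ?L" if s: "\<sigma>' \<in> perms m - {id}" for \<sigma>'
        proof
          assume eq: "meval (\<lambda>k. x (\<rho> k)) ?L = meval (\<lambda>k. x (\<rho> (\<sigma>' k))) ?L"
          have "\<sigma>' \<in> perms (Suc m)" using s perms_last_fixed by (auto simp: relperms_def)
          then have "(\<lambda>k. \<rho> (\<sigma>' k)) \<in> perms (Suc m)" by (rule perms_compose[OF \<rho>])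
          then have "\<rho> = (\<lambda>k. \<rho> (\<sigma>' k))"
            using c \<rho> eq unfolding separates_def by (auto dest: inj_onD)
          then have "\<rho> (\<sigma>' k) = \<rho> k" for k by metis
          moreover have "inj \<rho>" using \<rho> by (auto intro: permutes_inj)
          ultimately have "\<sigma>' k = k" for k by (metis injD)
          then have "\<sigma>' = id" by auto
          then show False using s by simp
        qed
        then show ?thesis by auto
      qed
      ultimately show ?thesis using \<open>q = 0\<close> by simp
    qed
    then show "\<rho> \<in> relperms (Suc m) x" using \<rho> by (simp add: relperms_def)
  qed
qed

end

section \<open>Forms vanishing on a residue class\<close>

text \<open>Erdos's argument: a number up to \<open>y\<close> is a squarefree number, determined by
  its set of primes, times a square whose root is at most \<open>sqrt y\<close>. Hence
  \<open>y\<close> is at most \<open>2 ^ card S * sqrt y\<close>.\<close>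

lemma card_primes_lower_bound:
  fixes y :: nat
  assumes "y \<ge> 1"
  shows "y \<le> 4 ^ card {p. prime p \<and> p \<le> y}"
proof -
  define S where "S = {p. prime p \<and> p \<le> y}"
  define T where "T = {j::nat. 1 \<le> j \<and> j\<^sup>2 \<le> y}"
  have finS: "finite S" by (rule finite_subset[of _ "{..y}"]) (auto simp: S_def)
  have "j \<le> y" if "j\<^sup>2 \<le> y" for j
    using that power2_nat_le_imp_le by blast
  then have finT: "finite T" by (intro finite_subset[of T "{..y}"]) (auto simp: T_def)
  have T1: "1 \<in> T" using assms by (simp add: T_def)
  define f where "f = (\<lambda>k::nat. (prime_factors (squarefree_part k), square_part k))"
  have "inj_on f {1..y}"
  proof (rule inj_onI)
    fix k k' assume k: "k \<in> {1..y}" "k' \<in> {1..y}" "f k = f k'"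
    have sq: "squarefree_part n = \<Prod>(prime_factors (squarefree_part n))" if "n > 0" for n :: nat
    proof -
      have "squarefree (squarefree_part n)" by (rule squarefree_squarefree_part)
      moreover have "squarefree_part n \<noteq> 0" using that by simp
      ultimately have "\<And>p. p \<in> prime_factors (squarefree_part n) \<Longrightarrow> multiplicity p (squarefree_part n) = 1"
        using squarefree_factorial_semiring'[of "squarefree_part n"] by blast
      then have "(\<Prod>p\<in>prime_factors (squarefree_part n). p ^ multiplicity p (squarefree_part n)) =
          \<Prod>(prime_factors (squarefree_part n))"
        by (intro prod.cong) auto
      then show ?thesis using prime_factorization_nat[of "squarefree_part n"] \<open>squarefree_part n \<noteq> 0\<close> by simp
    qed
    have "squarefree_part k = squarefree_part k'" using k sq[of k] sq[of k'] by (simp add: f_def)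
    moreover have "square_part k = square_part k'" using k by (simp add: f_def)
    ultimately show "k = k'" using squarefree_decompose[of k] squarefree_decompose[of k'] by metis
  qed
  moreover have "f ` {1..y} \<subseteq> Pow S \<times> T"
  proof
    fix z assume "z \<in> f ` {1..y}"
    then obtain k where k: "1 \<le> k" "k \<le> y" and z: "z = f k" by auto
    have "prime_factors (squarefree_part k) \<subseteq> S"
    proof
      fix p assume p: "p \<in> prime_factors (squarefree_part k)"
      then have "p dvd k" using squarefree_decompose[of k] by (metis dvd_mult2 in_prime_factors_imp_dvd)
      then show "p \<in> S" using p k by (auto simp: S_def dest: dvd_imp_le)
    qed
    moreover have "square_part k ^ 2 \<le> y"
      using k square_part_square_dvd[of k] by (meson dvd_imp_le le_trans less_le_trans zero_less_one)
    moreover have "square_part k \<ge> 1"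
    proof -
      have "square_part k \<noteq> 0" using k by simp
      then show ?thesis by linarith
    qed
    ultimately show "z \<in> Pow S \<times> T" by (simp add: z f_def T_def)
  qed
  ultimately have "card {1..y} \<le> card (Pow S \<times> T)"
    using finS finT by (metis card_inj_on_le finite_Pow_iff finite_SigmaI)
  then have y: "y \<le> 2 ^ card S * card T" by (simp add: card_cartesian_product card_Pow finS)
  have "T \<subseteq> {1..Max T}" using finT by (auto simp: T_def)
  then have "card T \<le> Max T" using card_mono[of "{1..Max T}" T] by simp
  moreover have "Max T \<in> T" using Max_in[OF finT] T1 by blast
  then have "(Max T)\<^sup>2 \<le> y" unfolding T_def by blast
  ultimately have cT: "(card T)\<^sup>2 \<le> y" by (meson le_trans power_mono zero_le)
  have "y * y \<le> (2 ^ card S * card T) * (2 ^ card S * card T)" using y by (intro mult_mono) auto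
  also have "\<dots> = 4 ^ card S * (card T)\<^sup>2"
    by (simp add: power2_eq_square algebra_simps flip: power_mult_distrib)
  also have "\<dots> \<le> 4 ^ card S * y" using cT by simp
  finally show ?thesis using assms by (simp add: S_def)
qed

lemma prod_primes_dvd:
  fixes A :: nat
  assumes "finite S" "\<And>p. p \<in> S \<Longrightarrow> prime p \<and> p dvd A"
  shows "\<Prod>S dvd A"
  using assms
proof (induction S rule: finite_induct)
  case (insert p S)
  have "coprime p (\<Prod>S)"
    using insert by (intro prod_coprime_right) (metis insertCI primes_coprime)
  then show ?case using insert by (simp add: divides_mult)
qed simp

text \<open>With \<open>a = 4 ^ (K + 1)\<close> the previous bound reads
  \<open>y ^ (K + 1) \<le> a ^ card S\<close>. All but \<open>a\<close> of the primes exceed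
  \<open>a\<close>, so their product falls short of this by a factor of at most
  \<open>a ^ a\<close>, which is less than \<open>y\<close>.\<close>

lemma all_small_primes_dvd_imp_large:
  "\<exists>y0. \<forall>y\<ge>y0. \<forall>A::nat. A > 0 \<longrightarrow> (\<forall>p. prime p \<longrightarrow> p \<le> y \<longrightarrow> p dvd A) \<longrightarrow> A > y ^ K"
proof (intro exI allI impI)
  define a :: nat where "a = 4 ^ (K + 1)"
  fix y A :: nat assume y: "a ^ a + 1 \<le> y" and A: "A > 0" and dvd: "\<forall>p. prime p \<longrightarrow> p \<le> y \<longrightarrow> p dvd A"
  define S where "S = {p. prime p \<and> p \<le> y}"
  define S' where "S' = {p\<in>S. p > a}"
  have finS: "finite S" by (rule finite_subset[of _ "{..y}"]) (auto simp: S_def)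
  have a4: "a \<ge> 4" by (simp add: a_def)
  have yS: "y \<le> 4 ^ card S" using card_primes_lower_bound[of y] y by (simp add: S_def)
  have "4 ^ a \<le> a ^ a" using a4 by (intro power_mono) auto
  then have "(4::nat) ^ a < 4 ^ card S" using y yS by linarith
  then have aS: "a < card S" by (simp add: power_strict_increasing_iff)
  have "S \<subseteq> S' \<union> {1..a}" by (auto simp: S'_def S_def Suc_le_eq dest: prime_gt_0_nat)
  then have "card S \<le> card (S' \<union> {1..a})" using finS by (intro card_mono) (auto simp: S'_def)
  also have "\<dots> \<le> card S' + a" using card_Un_le[of S' "{1..a}"] by simp
  finally have c: "card S - a \<le> card S'" by simp
  have "a ^ card S = a ^ (card S - a) * a ^ a" using aS by (simp flip: power_add)
  also have "\<dots> \<le> a ^ card S' * a ^ a" using c a4 by (intro mult_right_mono power_increasing) auto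
  also have "a ^ card S' \<le> \<Prod>S'"
    using prod_mono[of S' "\<lambda>_. a" "\<lambda>p. p"] by (auto simp: S'_def)
  also have "\<Prod>S' \<le> A"
  proof (rule dvd_imp_le[OF _ A])
    show "\<Prod>S' dvd A"
      by (rule prod_primes_dvd) (use finS dvd in \<open>auto simp: S'_def S_def\<close>)
  qed
  finally have 1: "a ^ card S \<le> A * a ^ a" by simp
  have "y ^ K * y = y ^ (K + 1)" by simp
  also have "\<dots> \<le> (4 ^ card S) ^ (K + 1)" using yS by (intro power_mono) auto
  also have "\<dots> = a ^ card S" by (simp only: a_def flip: power_mult) (simp add: mult.commute)
  finally have "y ^ K * y \<le> A * a ^ a" using 1 by linarith
  moreover have "A * a ^ a < A * y" using A y by simp
  ultimately have "y ^ K * y < A * y" by linarith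
  then show "A > y ^ K" by simp
qed

section \<open>Polynomials in two variables and Hensel lifting\<close>

lemma poly_taylor:
  fixes p :: "'a::idom poly"
  shows "\<exists>r. poly p (y + h) = poly p y + h * poly (pderiv p) y + h\<^sup>2 * r"
proof (induction p)
  case 0
  show ?case by (intro exI[of _ 0]) simp
next
  case (pCons a p)
  then obtain r where r: "poly p (y + h) = poly p y + h * poly (pderiv p) y + h\<^sup>2 * r" by blast
  show ?case
    by (intro exI[of _ "poly (pderiv p) y + (y + h) * r"])
      (simp add: pderiv_pCons r, simp add: algebra_simps power2_eq_square)
qed

lemma poly_diff_dvd:
  fixes p :: "'a::idom poly"
  shows "y - z dvd poly p y - poly p z"
proof -
  obtain r where "poly p (z + (y - z)) = poly p z + (y - z) * poly (pderiv p) z + (y - z)\<^sup>2 * r"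
    using poly_taylor by blast
  then have "poly p y - poly p z = (y - z) * (poly (pderiv p) z + (y - z) * r)"
    by (simp add: algebra_simps power2_eq_square)
  then show ?thesis by simp
qed

definition bieval :: "int poly poly \<Rightarrow> int \<Rightarrow> int \<Rightarrow> int" where
  "bieval F z t = poly (map_poly (\<lambda>c. poly c t) F) z"

lemma bieval_pCons: "bieval (pCons c F) z t = poly c t + z * bieval F z t"
  by (simp add: bieval_def map_poly_pCons)

lemma bieval_0 [simp]: "bieval 0 z t = 0" by (simp add: bieval_def)

lemma poly_poly_bieval: "poly (poly F Y) t = bieval F (poly Y t) t"
  by (induction F) (simp_all add: bieval_pCons)

lemma bieval_poly_poly: "bieval F z t = poly (poly F [:z:]) t"
  by (simp add: poly_poly_bieval)

lemma bieval_cong_dvd: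
  assumes "l dvd z - z'" "l dvd t - t'"
  shows "l dvd bieval F z t - bieval F z' t'"
proof -
  have "l dvd poly (map_poly (\<lambda>c. poly c t) F) z - poly (map_poly (\<lambda>c. poly c t) F) z'"
    using assms(1) poly_diff_dvd by (rule dvd_trans)
  then have 1: "l dvd bieval F z t - bieval F z' t" by (simp add: bieval_def)
  have 2: "l dvd bieval F z' t - bieval F z' t'"
    unfolding bieval_poly_poly using assms(2) poly_diff_dvd by (rule dvd_trans)
  show ?thesis using dvd_add[OF 1 2] by simp
qed

lemma bieval_taylor:
  "\<exists>r. bieval F (z + h) t = bieval F z t + h * bieval (pderiv F) z t + h\<^sup>2 * r"
proof -
  obtain r where "poly F ([:z:] + [:h:]) = poly F [:z:] + [:h:] * poly (pderiv F) [:z:] + [:h:]\<^sup>2 * r"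
    using poly_taylor by blast
  from arg_cong[OF this, of "\<lambda>p. poly p t"]
  have "bieval F (z + h) t = bieval F z t + h * bieval (pderiv F) z t + h\<^sup>2 * poly r t"
    by (simp add: poly_poly_bieval)
  then show ?thesis by blast
qed

text \<open>Lifting is done with an integer polynomial \<open>Y\<close> in \<open>t\<close>, so that
  one \<open>Y\<close> approximates all points of the class at once. Each step uses the fixed
  inverse \<open>w\<close> of the derivative at the base point and multiplies the error
  \<open>h\<close> by a multiple of \<open>l\<close>.\<close>

lemma hensel_parametrisation:
  fixes F :: "int poly poly" and l w z0 t0 :: int
  assumes w: "l dvd w * bieval (pderiv F) z0 t0 - 1"
  shows "\<exists>Y. \<forall>z t. bieval F z t = 0 \<longrightarrow> l dvd z - z0 \<longrightarrow> l dvd t - t0 \<longrightarrow> l ^ Suc M dvd z - poly Y t"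
proof (induction M)
  case 0
  show ?case by (intro exI[of _ "[:z0:]"]) simp
next
  case (Suc M)
  then obtain Y where Y: "\<And>z t. bieval F z t = 0 \<Longrightarrow> l dvd z - z0 \<Longrightarrow> l dvd t - t0 \<Longrightarrow> l ^ Suc M dvd z - poly Y t"
    by blast
  have "l ^ Suc (Suc M) dvd z - poly (Y - Polynomial.smult w (poly F Y)) t"
    if F: "bieval F z t = 0" and z: "l dvd z - z0" and t: "l dvd t - t0" for z t
  proof -
    define h where "h = z - poly Y t"
    have dh: "l ^ Suc M dvd h" using Y[OF that] by (simp add: h_def)
    then have "l dvd h" by (metis dvd_trans dvd_triv_left power_Suc)
    then have dl: "l dvd poly Y t - z0" using dvd_diff[OF z, of h] by (simp add: h_def)
    obtain r where r: "bieval F (poly Y t + h) t = bieval F (poly Y t) t + h * bieval (pderiv F) (poly Y t) t + h\<^sup>2 * r"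
      using bieval_taylor by blast
    then have FY: "bieval F (poly Y t) t = - h * bieval (pderiv F) (poly Y t) t - h\<^sup>2 * r"
      using F by (simp add: h_def algebra_simps)
    have "z - poly (Y - Polynomial.smult w (poly F Y)) t = h + w * bieval F (poly Y t) t"
      by (simp add: h_def poly_poly_bieval)
    also have "\<dots> = h * ((1 - w * bieval (pderiv F) z0 t0) -
        w * (bieval (pderiv F) (poly Y t) t - bieval (pderiv F) z0 t0) - w * r * h)"
      by (simp add: FY algebra_simps power2_eq_square)
    finally have eq: "z - poly (Y - Polynomial.smult w (poly F Y)) t =
        h * ((1 - w * bieval (pderiv F) z0 t0) -
        w * (bieval (pderiv F) (poly Y t) t - bieval (pderiv F) z0 t0) - w * r * h)" .
    have "l dvd 1 - w * bieval (pderiv F) z0 t0" using w by (simp add: dvd_diff_commute)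
    moreover have "l dvd bieval (pderiv F) (poly Y t) t - bieval (pderiv F) z0 t0"
      by (rule bieval_cong_dvd[OF dl t])
    ultimately have "l dvd (1 - w * bieval (pderiv F) z0 t0) -
        w * (bieval (pderiv F) (poly Y t) t - bieval (pderiv F) z0 t0) - w * r * h"
      using \<open>l dvd h\<close> dvd_diff dvd_mult by metis
    then have "l ^ Suc M * l dvd h * ((1 - w * bieval (pderiv F) z0 t0) -
        w * (bieval (pderiv F) (poly Y t) t - bieval (pderiv F) z0 t0) - w * r * h)"
      by (rule mult_dvd_mono[OF dh])
    then show ?thesis unfolding eq by (simp add: mult.commute)
  qed
  then show ?case by blast
qed

section \<open>Auxiliary forms by the pigeonhole principle\<close>

text \<open>Expanded at \<open>t0\<close>, the coefficient of \<open>(t - t0) ^ k\<close> matters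
  only modulo \<open>q ^ (N - k)\<close>, since the power itself is divisible by
  \<open>q ^ k\<close>. There are thus \<open>q ^ (\<Sum>k<N. N - k)\<close> classes for the
  coefficient vectors, and two vectors in the same class differ by the desired form.\<close>

lemma auxiliary_form:
  fixes Y :: "int poly" and B :: "nat \<Rightarrow> nat \<Rightarrow> nat" and q :: nat
  assumes q: "q \<ge> 1" and big: "q ^ (\<Sum>k<N. N - k) < (\<Prod>i<d. \<Prod>j<J. B i j + 1)"
  obtains g :: "nat \<Rightarrow> nat \<Rightarrow> int" where "\<exists>i<d. \<exists>j<J. g i j \<noteq> 0"
    "\<And>i j. i < d \<Longrightarrow> j < J \<Longrightarrow> \<bar>g i j\<bar> \<le> int (B i j)"
    "\<And>t. int q dvd t - t0 \<Longrightarrow> int (q ^ N) dvd (\<Sum>i<d. \<Sum>j<J. g i j * poly Y t ^ i * t ^ j)"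
proof -
  define I where "I = {..<d} \<times> {..<J}"
  define A where "A = (\<Pi>\<^sub>E p\<in>I. {0..int (B (fst p) (snd p))})"
  \<comment> \<open>Composition with \<open>t0 + X\<close> gives the Taylor expansion at
    \<open>t0\<close>.\<close>
  define G where "G c = pcompose (\<Sum>p\<in>I. Polynomial.smult (c p) (Y ^ fst p * [:0, 1:] ^ snd p)) [:t0, 1:]" for c :: "nat \<times> nat \<Rightarrow> int"
  define \<Phi> where "\<Phi> c = (\<lambda>k\<in>{..<N}. Polynomial.coeff (G c) k mod int (q ^ (N - k)))" for c
  define R where "R = (\<Pi>\<^sub>E k\<in>{..<N}. {0..<int (q ^ (N - k))})"
  have finI: "finite I" by (simp add: I_def)
  have finR: "finite R" by (auto simp: R_def intro!: finite_PiE)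
  have cardR: "card R = q ^ (\<Sum>k<N. N - k)" by (simp add: R_def card_PiE power_sum nat_power_eq)
  have cardA: "card A = (\<Prod>i<d. \<Prod>j<J. B i j + 1)"
    by (simp add: A_def card_PiE finI) (simp add: I_def prod.cartesian_product case_prod_unfold nat_add_distrib)
  have "\<Phi> c \<in> R" for c
    unfolding \<Phi>_def R_def restrict_PiE_iff using q by simp
  then have "\<Phi> ` A \<subseteq> R" by blast
  then have "card (\<Phi> ` A) \<le> card R" by (rule card_mono[OF finR])
  then have "card (\<Phi> ` A) < card A" using big cardR cardA by simp
  then have "\<not> inj_on \<Phi> A" by (rule pigeonhole)
  then obtain c c' where c: "c \<in> A" "c' \<in> A" "c \<noteq> c'" "\<Phi> c = \<Phi> c'" unfolding inj_on_def by blast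
  define g where "g i j = c (i, j) - c' (i, j)" for i j
  show ?thesis
  proof (rule that[of g])
    show "\<exists>i<d. \<exists>j<J. g i j \<noteq> 0"
    proof (rule ccontr)
      assume "\<not> (\<exists>i<d. \<exists>j<J. g i j \<noteq> 0)"
      then have "c p = c' p" if "p \<in> I" for p using that by (auto simp: g_def I_def)
      then have "c = c'" using c by (auto simp: A_def intro: PiE_ext)
      then show False using c by simp
    qed
    show "\<bar>g i j\<bar> \<le> int (B i j)" if "i < d" "j < J" for i j
    proof -
      have "(i, j) \<in> I" using that by (simp add: I_def)
      then have "c (i, j) \<in> {0..int (B i j)}" "c' (i, j) \<in> {0..int (B i j)}"
        using c(1,2) unfolding A_def by (force dest: PiE_mem)+
      then show ?thesis by (auto simp: g_def)
    qed
    show "int (q ^ N) dvd (\<Sum>i<d. \<Sum>j<J. g i j * poly Y t ^ i * t ^ j)" if t: "int q dvd t - t0" for t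
    proof -
      define D where "D = G c - G c'"
      have "(\<Sum>i<d. \<Sum>j<J. g i j * poly Y t ^ i * t ^ j) = (\<Sum>p\<in>I. (c p - c' p) * (poly Y t ^ fst p * t ^ snd p))"
        by (simp add: I_def sum.cartesian_product case_prod_unfold g_def mult.assoc)
      also have "\<dots> = poly D (t - t0)"
        by (simp add: D_def G_def poly_pcompose poly_sum sum_subtractf algebra_simps)
      also have "\<dots> = (\<Sum>k\<le>Polynomial.degree D. Polynomial.coeff D k * (t - t0) ^ k)" by (rule poly_altdef)
      finally have eq: "(\<Sum>i<d. \<Sum>j<J. g i j * poly Y t ^ i * t ^ j) =
        (\<Sum>k\<le>Polynomial.degree D. Polynomial.coeff D k * (t - t0) ^ k)" .
      have "int (q ^ N) dvd Polynomial.coeff D k * (t - t0) ^ k" for k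
      proof (cases "k < N")
        case True
        then have "Polynomial.coeff (G c) k mod int (q ^ (N - k)) = Polynomial.coeff (G c') k mod int (q ^ (N - k))"
          using fun_cong[OF c(4), of k] by (simp add: \<Phi>_def)
        then have "int (q ^ (N - k)) dvd Polynomial.coeff D k" by (simp add: D_def mod_eq_dvd_iff)
        moreover have "int q ^ k dvd (t - t0) ^ k" using t by (rule dvd_power_same)
        ultimately have "int (q ^ (N - k)) * int q ^ k dvd Polynomial.coeff D k * (t - t0) ^ k" by (rule mult_dvd_mono)
        moreover have "int (q ^ (N - k)) * int q ^ k = int (q ^ N)" using True by (simp flip: power_add)
        ultimately show ?thesis by simp
      next
        case False
        have "int q ^ N dvd (t - t0) ^ N" using t by (rule dvd_power_same)
        also have "\<dots> dvd (t - t0) ^ k" using False by (intro le_imp_power_dvd) simp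
        finally show ?thesis by simp
      qed
      then show ?thesis unfolding eq by (intro dvd_sum)
    qed
  qed
qed

text \<open>With \<open>N = d * J\<close>, the left side is the product over all \<open>N\<close>
  monomials \<open>z^i t^j\<close> of \<open>N + 1\<close> times their maximum, the right side is
  \<open>q ^ (N * (N - 1) / 2)\<close>. This is the inequality that makes a Bombieri-Pila
  determinant vanish.\<close>

definition large_modulus :: "nat \<Rightarrow> nat \<Rightarrow> nat \<Rightarrow> nat \<Rightarrow> nat \<Rightarrow> bool" where
  "large_modulus d J Z T q \<longleftrightarrow>
     (d * J + 1) ^ (d * J) * Z ^ (J * (\<Sum>i<d. i)) * T ^ (d * (\<Sum>j<J. j)) \<le> q ^ (\<Sum>k<d * J. k)"

text \<open>At a point of the class \<open>z\<close> may be replaced by \<open>Y(t)\<close> modulo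
  \<open>q ^ N\<close>, so the value of the form is divisible by \<open>q ^ N\<close>; the size of
  the coefficients keeps it below \<open>q ^ N\<close>.\<close>

lemma vanishing_form_on_class:
  fixes F :: "int poly poly" and l e d J Z T :: nat and z0 t0 :: int
  defines "N \<equiv> d * J"
  defines "q \<equiv> l ^ e"
  assumes l: "prime l" and e: "e \<ge> 1" and N: "N \<ge> 1" and ZT: "Z \<ge> 1" "T \<ge> 1"
    and sep: "\<not> int l dvd bieval (pderiv F) z0 t0"
    and large: "large_modulus d J Z T q"
  obtains g :: "nat \<Rightarrow> nat \<Rightarrow> int" where "\<exists>i<d. \<exists>j<J. g i j \<noteq> 0"
    "\<And>z t. bieval F z t = 0 \<Longrightarrow> int l dvd z - z0 \<Longrightarrow> int q dvd t - t0 \<Longrightarrow> \<bar>z\<bar> \<le> int Z \<Longrightarrow> \<bar>t\<bar> \<le> int T \<Longrightarrow>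
        (\<Sum>i<d. \<Sum>j<J. g i j * z ^ i * t ^ j) = 0"
proof -
  have l0: "l > 0" and q0: "q > 0" using l by (auto simp: q_def prime_gt_0_nat)
  have ineq: "real ((N + 1) ^ N * Z ^ (J * (\<Sum>i<d. i)) * T ^ (d * (\<Sum>j<J. j))) \<le> real (q ^ (\<Sum>k<N. k))"
    using large unfolding large_modulus_def N_def by (simp only: of_nat_le_iff)
  \<comment> \<open>Each of the \<open>N\<close> terms is then at most
    \<open>q ^ N / (N + 1)\<close>, so their sum stays strictly below \<open>q ^ N\<close>.\<close>
  define B where "B i j = q ^ N div ((N + 1) * Z ^ i * T ^ j)" for i j
  have "coprime (int l) (bieval (pderiv F) z0 t0)"
    using l sep by (intro prime_imp_coprime) auto
  then have "coprime (bieval (pderiv F) z0 t0) (int l)" by (simp add: coprime_commute)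
  then obtain w where w: "int l dvd w * bieval (pderiv F) z0 t0 - 1"
  proof -
    assume a: "\<And>w. int l dvd w * bieval (pderiv F) z0 t0 - 1 \<Longrightarrow> thesis"
    obtain u v where "u * bieval (pderiv F) z0 t0 + v * int l = 1"
      using bezout_int[of "bieval (pderiv F) z0 t0" "int l"] \<open>coprime (bieval (pderiv F) z0 t0) (int l)\<close> by auto
    then have "u * bieval (pderiv F) z0 t0 - 1 = int l * (- v)" by (simp add: algebra_simps)
    then show thesis by (intro a[of u]) (metis dvd_triv_left)
  qed
  obtain Y where Y: "\<And>z t. bieval F z t = 0 \<Longrightarrow> int l dvd z - z0 \<Longrightarrow> int l dvd t - t0 \<Longrightarrow> int l ^ Suc (e * N) dvd z - poly Y t"
    using hensel_parametrisation[OF w] by blast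
  \<comment> \<open>The real quotients \<open>V i j\<close> already have a large enough product, by
    \<open>large\<close> and \<open>(\<Sum>k<N. N - k) + (\<Sum>k<N. k) = N * N\<close>; the rounded
    \<open>B i j + 1\<close> exceed them strictly.\<close>
  have big: "q ^ (\<Sum>k<N. N - k) < (\<Prod>i<d. \<Prod>j<J. B i j + 1)"
  proof -
    define V where "V i j = real (q ^ N) / real ((N + 1) * Z ^ i * T ^ j)" for i j
    have XB: "V i j < real (B i j + 1)" for i j
    proof -
      have "(N + 1) * Z ^ i * T ^ j > 0" using ZT by simp
      then have "q ^ N < (B i j + 1) * ((N + 1) * Z ^ i * T ^ j)"
        unfolding B_def by (metis add.commute dividend_less_div_times mult.commute mult_Suc plus_1_eq_Suc)
      then have "real (q ^ N) < real ((B i j + 1) * ((N + 1) * Z ^ i * T ^ j))" by (simp only: of_nat_less_iff)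
      then have "real (q ^ N) < real (B i j + 1) * real ((N + 1) * Z ^ i * T ^ j)" by (simp only: of_nat_mult)
      moreover have "real ((N + 1) * Z ^ i * T ^ j) > 0"
        using \<open>(N + 1) * Z ^ i * T ^ j > 0\<close> by (simp only: of_nat_0_less_iff)
      ultimately show ?thesis unfolding V_def by (simp only: pos_divide_less_eq)
    qed
    have X0: "V i j > 0" for i j
    proof -
      have "q ^ N > 0" "(N + 1) * Z ^ i * T ^ j > 0" using q0 ZT by auto
      then show ?thesis unfolding V_def by (intro divide_pos_pos) (simp_all only: of_nat_0_less_iff)
    qed
    have prodX: "(\<Prod>i<d. \<Prod>j<J. V i j) = real (q ^ N) ^ N / real ((N + 1) ^ N * Z ^ (J * (\<Sum>i<d. i)) * T ^ (d * (\<Sum>j<J. j)))"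
    proof -
      have "(\<Prod>i<d. \<Prod>j<J. V i j) = (\<Prod>i<d. \<Prod>j<J. real (q ^ N)) / (\<Prod>i<d. \<Prod>j<J. real ((N + 1) * Z ^ i * T ^ j))"
        by (simp add: V_def prod_dividef)
      also have "(\<Prod>i<d. \<Prod>j<J. real (q ^ N)) = real (q ^ N) ^ N"
      proof -
        have "(\<Prod>i<d. \<Prod>j<J. c) = c ^ N" for c :: real
          by (simp add: N_def mult.commute flip: power_mult)
        then show ?thesis .
      qed
      also have "(\<Prod>i<d. \<Prod>j<J. real ((N + 1) * Z ^ i * T ^ j)) = real ((N + 1) ^ N * Z ^ (J * (\<Sum>i<d. i)) * T ^ (d * (\<Sum>j<J. j)))"
      proof -
        have "(\<Prod>i<d. \<Prod>j<J. (N + 1) * Z ^ i * T ^ j) = (N + 1) ^ N * Z ^ (J * (\<Sum>i<d. i)) * T ^ (d * (\<Sum>j<J. j))"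
        proof -
          have 1: "(\<Prod>i<d. \<Prod>j<J. c) = c ^ N" for c :: nat
            by (simp add: N_def mult.commute flip: power_mult)
          have 2: "(\<Prod>i<d. \<Prod>j<J. Z ^ i) = Z ^ (J * (\<Sum>i<d. i))"
            by (simp add: power_sum sum_distrib_left mult.commute flip: power_mult)
          have 3: "(\<Prod>i<d. \<Prod>j<J. T ^ j) = T ^ (d * (\<Sum>j<J. j))"
            by (simp add: mult.commute flip: power_mult power_sum)
          show ?thesis by (simp only: prod.distrib 1 2 3)
        qed
        then show ?thesis by (metis (no_types, lifting) of_nat_prod prod.cong)
      qed
      finally show ?thesis .
    qed
    have expo: "(\<Sum>k<N. N - k) + (\<Sum>k<N. k) = N * N"
      by (simp flip: sum.distrib)
    have "real (q ^ (\<Sum>k<N. N - k)) * real (q ^ (\<Sum>k<N. k)) = real (q ^ N) ^ N"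
      by (simp flip: power_add power_mult add: expo)
    then have "real (q ^ (\<Sum>k<N. N - k)) * real ((N + 1) ^ N * Z ^ (J * (\<Sum>i<d. i)) * T ^ (d * (\<Sum>j<J. j))) \<le> real (q ^ N) ^ N"
      using mult_left_mono[OF ineq, of "real (q ^ (\<Sum>k<N. N - k))"] by linarith
    moreover have "real ((N + 1) ^ N * Z ^ (J * (\<Sum>i<d. i)) * T ^ (d * (\<Sum>j<J. j))) > 0" using ZT by simp
    ultimately have "real (q ^ (\<Sum>k<N. N - k)) \<le> (\<Prod>i<d. \<Prod>j<J. V i j)"
      unfolding prodX by (simp only: pos_le_divide_eq)
    also have "\<dots> < (\<Prod>i<d. \<Prod>j<J. real (B i j + 1))"
    proof -
      have dJ: "0 < d" "0 < J" using N by (auto simp: N_def)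
      have inner: "0 < (\<Prod>j<J. V i j)" "(\<Prod>j<J. V i j) < (\<Prod>j<J. real (B i j + 1))" for i
      proof -
        show "0 < (\<Prod>j<J. V i j)" using X0 by (intro prod_pos) auto
        show "(\<Prod>j<J. V i j) < (\<Prod>j<J. real (B i j + 1))"
        proof (rule prod_mono_strict[of 0])
          fix j
          show "0 \<le> V i j \<and> V i j \<le> real (B i j + 1)"
            using X0[of i j] XB[of i j] by linarith
        qed (use dJ XB in auto)
      qed
      show ?thesis
      proof (rule prod_mono_strict[of 0])
        fix i
        show "0 \<le> (\<Prod>j<J. V i j) \<and> (\<Prod>j<J. V i j) \<le> (\<Prod>j<J. real (B i j + 1))"
          using inner[of i] by linarith
        show "0 < (\<Prod>j<J. real (B i j + 1))" using inner[of i] by linarith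
      qed (use dJ inner in auto)
    qed
    also have "\<dots> = real (\<Prod>i<d. \<Prod>j<J. B i j + 1)" by simp
    finally show ?thesis by (simp only: of_nat_less_iff)
  qed
  have q1: "1 \<le> q" using q0 by simp
  from auxiliary_form[OF q1 big, of t0 Y] obtain g
    where g: "\<exists>i<d. \<exists>j<J. g i j \<noteq> 0" "\<And>i j. i < d \<Longrightarrow> j < J \<Longrightarrow> \<bar>g i j\<bar> \<le> int (B i j)"
    "\<And>t. int q dvd t - t0 \<Longrightarrow> int (q ^ N) dvd (\<Sum>i<d. \<Sum>j<J. g i j * poly Y t ^ i * t ^ j)"
    by blast
  have "(\<Sum>i<d. \<Sum>j<J. g i j * z ^ i * t ^ j) = 0"
    if F: "bieval F z t = 0" and z: "int l dvd z - z0" and t: "int q dvd t - t0" and zb: "\<bar>z\<bar> \<le> int Z" and tb: "\<bar>t\<bar> \<le> int T" for z t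
  proof -
    let ?S = "\<lambda>z. \<Sum>i<d. \<Sum>j<J. g i j * z ^ i * t ^ j"
    have "int l dvd int q" using e by (simp add: q_def dvd_power)
    then have tl: "int l dvd t - t0" using t by (rule dvd_trans)
    have "int (q ^ N) dvd int l ^ Suc (e * N)" by (simp add: q_def flip: power_mult)
    also have "\<dots> dvd z - poly Y t" by (rule Y[OF F z tl])
    finally have zY: "int (q ^ N) dvd z - poly Y t" .
    have "int (q ^ N) dvd ?S z - ?S (poly Y t)"
    proof -
      have "?S z - ?S (poly Y t) = (\<Sum>i<d. \<Sum>j<J. g i j * t ^ j * (z ^ i - poly Y t ^ i))"
        by (simp add: sum_subtractf algebra_simps)
      also have "int (q ^ N) dvd \<dots>"
      proof (intro dvd_sum dvd_mult)
        fix i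
        have "z - poly Y t dvd z ^ i - poly Y t ^ i"
          using poly_diff_dvd[of z "poly Y t" "Polynomial.monom 1 i"] by (simp add: poly_monom)
        then show "int (q ^ N) dvd z ^ i - poly Y t ^ i" using zY dvd_trans by blast
      qed
      finally show ?thesis .
    qed
    then have dvd: "int (q ^ N) dvd ?S z" using dvd_add[OF _ g(3)[OF t]] by fastforce
    have "\<bar>?S z\<bar> \<le> (\<Sum>i<d. \<Sum>j<J. \<bar>g i j * z ^ i * t ^ j\<bar>)"
      by (intro order_trans[OF sum_abs] sum_mono sum_abs)
    also have "\<dots> \<le> (\<Sum>i<d. \<Sum>j<J. int (B i j * Z ^ i * T ^ j))"
    proof (intro sum_mono)
      fix i j assume ij: "i \<in> {..<d}" "j \<in> {..<J}"
      have "\<bar>g i j * z ^ i * t ^ j\<bar> = \<bar>g i j\<bar> * \<bar>z\<bar> ^ i * \<bar>t\<bar> ^ j" by (simp add: abs_mult power_abs)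
      also have "\<dots> \<le> int (B i j) * int Z ^ i * int T ^ j"
        using g(2) ij zb tb by (intro mult_mono power_mono) auto
      finally show "\<bar>g i j * z ^ i * t ^ j\<bar> \<le> int (B i j * Z ^ i * T ^ j)" by simp
    qed
    finally have S1: "\<bar>?S z\<bar> \<le> int (\<Sum>i<d. \<Sum>j<J. B i j * Z ^ i * T ^ j)" by simp
    have "(N + 1) * (\<Sum>i<d. \<Sum>j<J. B i j * Z ^ i * T ^ j) \<le> (\<Sum>i<d. \<Sum>j<J. q ^ N)"
      unfolding sum_distrib_left
    proof (intro sum_mono)
      fix i j
      have "B i j * ((N + 1) * Z ^ i * T ^ j) \<le> q ^ N" unfolding B_def by (rule div_times_less_eq_dividend)
      then show "(N + 1) * (B i j * Z ^ i * T ^ j) \<le> q ^ N" by (simp only: ac_simps)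
    qed
    also have "\<dots> = N * q ^ N" by (simp add: N_def)
    also have "\<dots> < (N + 1) * q ^ N" using q0 by simp
    finally have "(\<Sum>i<d. \<Sum>j<J. B i j * Z ^ i * T ^ j) < q ^ N" by (simp only: mult_less_cancel1)
    then have "\<bar>?S z\<bar> < int (q ^ N)" using S1 by linarith
    show ?thesis
    proof (rule ccontr)
      assume "?S z \<noteq> 0"
      then have "\<bar>int (q ^ N)\<bar> \<le> \<bar>?S z\<bar>" using dvd by (rule dvd_imp_le_int)
      then show False using \<open>\<bar>?S z\<bar> < int (q ^ N)\<close> by linarith
    qed
  qed
  then show ?thesis by (rule that[OF g(1)])
qed

section \<open>Resolvents of a permutation group\<close>

definition translate :: "(nat \<Rightarrow> nat) \<Rightarrow> (nat \<Rightarrow> nat) set \<Rightarrow> (nat \<Rightarrow> nat) set" where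
  "translate \<tau> A = (\<lambda>\<pi> k. \<tau> (\<pi> k)) ` A"

text \<open>Left cosets, because composing a valuation with \<tau> turns \<open>theta\<close> at a
  coset into \<open>theta\<close> at its left translate.\<close>

definition lcos :: "nat \<Rightarrow> (nat \<Rightarrow> nat) set \<Rightarrow> (nat \<Rightarrow> nat) set set" where
  "lcos n G = (\<lambda>\<tau>. translate \<tau> G) ` perms n"

lemma translate_translate: "translate \<tau> (translate \<sigma> A) = translate (\<lambda>k. \<tau> (\<sigma> k)) A"
  by (simp add: translate_def image_image)

lemma translate_id [simp]: "translate id A = A" "translate (\<lambda>k. k) A = A"
  by (simp_all add: translate_def)

lemma inj_translate: "\<tau> \<in> perms n \<Longrightarrow> inj_on (\<lambda>\<pi> k. \<tau> (\<pi> k)) A"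
  by (rule inj_onI) (metis ext injD mem_perms permutes_inj)

lemma perms_inverse:
  assumes "\<tau> \<in> perms n"
  shows "inv_into UNIV \<tau> \<in> perms n" "\<tau> (inv_into UNIV \<tau> k) = k" "inv_into UNIV \<tau> (\<tau> k) = k"
  using assms unfolding mem_perms by (auto intro: permutes_inv simp: permutes_inverses)

lemma id_perms [simp]: "id \<in> perms n" by (simp add: permutes_id)

locale perm_group =
  fixes n :: nat and G :: "(nat \<Rightarrow> nat) set"
  assumes G: "subgroup G (sym_group n)"
begin

lemma G_perms: "g \<in> G \<Longrightarrow> g \<in> perms n"
  using subgroup.subset[OF G] by (auto simp: sym_group_def)

lemma id_G: "id \<in> G"
  using subgroup.one_closed[OF G] by (simp add: sym_group_def)

lemma comp_G: "g \<in> G \<Longrightarrow> h \<in> G \<Longrightarrow> (\<lambda>k. g (h k)) \<in> G"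
  using subgroup.m_closed[OF G, of g h] by (simp add: sym_group_def o_def)

lemma inv_G: assumes "g \<in> G" shows "inv_into UNIV g \<in> G"
proof -
  have "g \<in> carrier (sym_group n)" using G_perms[OF assms] by (simp add: sym_group_def)
  then have "inv\<^bsub>sym_group n\<^esub> g = inv_into UNIV g" by (rule sym_group_inv_equality)
  then show ?thesis using subgroup.m_inv_closed[OF G assms] by simp
qed

lemma finite_G: "finite G" by (rule finite_subset[OF _ finite_perms[of n]]) (use G_perms in blast)

abbreviation L where "L \<equiv> lcos n G"

lemma translate_G: assumes "g \<in> G" shows "translate g G = G"
proof
  show "translate g G \<subseteq> G" using comp_G[OF assms] by (auto simp: translate_def)
  show "G \<subseteq> translate g G"
  proof
    fix h assume h: "h \<in> G"
    have "h = (\<lambda>k. g ((\<lambda>k. inv_into UNIV g (h k)) k))"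
      using perms_inverse(2)[OF G_perms[OF assms]] by simp
    moreover have "(\<lambda>k. inv_into UNIV g (h k)) \<in> G" by (rule comp_G[OF inv_G[OF assms] h])
    ultimately show "h \<in> translate g G" unfolding translate_def by (rule image_eqI)
  qed
qed

lemma G_in_L: "G \<in> L" unfolding lcos_def by (rule image_eqI[of _ _ id]) auto

lemma finite_L [simp]: "finite L" by (simp add: lcos_def)

lemma translate_L: "\<tau> \<in> perms n \<Longrightarrow> A \<in> L \<Longrightarrow> translate \<tau> A \<in> L"
  unfolding lcos_def using perms_compose by (auto simp: translate_translate)

lemma bij_translate_L:
  assumes "\<tau> \<in> perms n"
  shows "bij_betw (translate \<tau>) L L"
proof (rule bij_betw_byWitness[where f' = "translate (inv_into UNIV \<tau>)"])
  show "\<forall>A\<in>L. translate (inv_into UNIV \<tau>) (translate \<tau> A) = A"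
    using perms_inverse[OF assms] by (simp add: translate_translate)
  show "\<forall>A\<in>L. translate \<tau> (translate (inv_into UNIV \<tau>) A) = A"
    using perms_inverse[OF assms] by (simp add: translate_translate)
  show "translate \<tau> ` L \<subseteq> L" using translate_L[OF assms] by blast
  show "translate (inv_into UNIV \<tau>) ` L \<subseteq> L" using translate_L[OF perms_inverse(1)[OF assms]] by blast
qed

lemma coset_eq: assumes "A \<in> L" "\<pi> \<in> A" shows "A = translate \<pi> G"
proof -
  obtain \<tau> g where "\<tau> \<in> perms n" "A = translate \<tau> G" "g \<in> G" "\<pi> = (\<lambda>k. \<tau> (g k))"
    using assms by (auto simp: lcos_def translate_def)
  then show ?thesis using translate_translate[of \<tau> g G] translate_G[of g] by simp
qed

lemma coset_perms: "A \<in> L \<Longrightarrow> \<pi> \<in> A \<Longrightarrow> \<pi> \<in> perms n"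
  using perms_compose G_perms by (fastforce simp: lcos_def translate_def)

lemma finite_coset: "A \<in> L \<Longrightarrow> finite A"
  by (rule finite_subset[OF _ finite_perms[of n]]) (use coset_perms in blast)

lemma coset_nonempty: "A \<in> L \<Longrightarrow> A \<noteq> {}"
  using id_G by (auto simp: lcos_def translate_def)

lemma coset_disjoint: "A \<in> L \<Longrightarrow> B \<in> L \<Longrightarrow> A \<noteq> B \<Longrightarrow> A \<inter> B = {}"
  using coset_eq by blast

lemma card_coset: "A \<in> L \<Longrightarrow> card A = card G"
  unfolding lcos_def translate_def by (auto simp: card_image[OF inj_translate])

lemma transitive_L:
  assumes "A \<in> L" "B \<in> L"
  obtains \<tau> where "\<tau> \<in> perms n" "translate \<tau> A = B"
proof -
  obtain \<sigma> \<rho> where s: "\<sigma> \<in> perms n" "A = translate \<sigma> G" "\<rho> \<in> perms n" "B = translate \<rho> G"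
    using assms by (auto simp: lcos_def)
  have "translate (\<lambda>k. \<rho> (inv_into UNIV \<sigma> k)) A = B"
    using perms_inverse[OF s(1)] by (simp add: s(2,4) translate_translate)
  moreover have "(\<lambda>k. \<rho> (inv_into UNIV \<sigma> k)) \<in> perms n"
    by (rule perms_compose[OF s(3) perms_inverse(1)[OF s(1)]])
  ultimately show ?thesis using that by blast
qed

text \<open>\<open>sym_index\<close> counts right cosets; both numbers are the quotient of the group
  orders.\<close>

lemma card_L: "card L = sym_index n G"
proof -
  have "\<Union>L = perms n"
  proof
    show "\<Union>L \<subseteq> perms n" using coset_perms by blast
    show "perms n \<subseteq> \<Union>L"
    proof
      fix \<pi> assume p: "\<pi> \<in> perms n"
      then have "translate \<pi> G \<in> L" by (auto simp: lcos_def)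
      moreover have "\<pi> \<in> translate \<pi> G" using id_G by (auto simp: translate_def intro!: image_eqI[of _ _ id])
      ultimately show "\<pi> \<in> \<Union>L" by blast
    qed
  qed
  then have "card G * card L = card (perms n)"
    using card_partition[of L "card G"] card_coset coset_disjoint by simp
  moreover have "card (rcosets\<^bsub>sym_group n\<^esub> G) * card G = card (perms n)"
  proof -
    interpret S: group "sym_group n" by (rule sym_group_is_group)
    from S.lagrange[OF G] show ?thesis by (simp add: Coset.order_def sym_group_def perms_def)
  qed
  moreover have "card G > 0" using id_G finite_G by (auto simp: card_gt_0_iff)
  ultimately show ?thesis unfolding sym_index_def by (metis mult.commute mult_left_cancel less_numeral_extra(3))
qed

lemma card_L_pos: "card L > 0" using G_in_L by (auto simp: card_gt_0_iff)

text \<open>The value at \<open>K\<close> of the polynomial whose zeros are the conjugates of a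
  separating form over the coset \<open>A\<close>. Different cosets give disjoint zero sets, hence
  different polynomials, whose values coincide at few \<open>K\<close> only.\<close>

definition theta :: "nat \<Rightarrow> nat \<Rightarrow> (nat \<Rightarrow> nat) set \<Rightarrow> mpol" where
  "theta c K A = (\<Prod>\<pi>\<in>A. of_nat K - pact \<pi> (lform n c))"

lemma meval_theta: "meval x (theta c K A) = (\<Prod>\<pi>\<in>A. of_nat K - meval (\<lambda>k. x (\<pi> k)) (lform n c))"
  by (simp add: theta_def meval_hom)

lemma meval_theta_translate:
  assumes "\<tau> \<in> perms n"
  shows "meval (\<lambda>k. x (\<tau> k)) (theta c K A) = meval x (theta c K (translate \<tau> A))"
  unfolding meval_theta translate_def
  by (subst prod.reindex[OF inj_translate[OF assms]]) simp

lemma pact_theta: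
  assumes "\<tau> \<in> perms n"
  shows "pact \<tau> (theta c K A) = theta c K (translate \<tau> A)"
  using meval_theta_translate[OF assms, of mvar] by (simp add: pact_def)

lemma theta_bad_bound:
  fixes x :: "nat \<Rightarrow> 'a::{idom, ring_char_0}"
  assumes "separates n x c"
  shows "finite {K. \<not> inj_on (\<lambda>A. meval x (theta c K A)) L}"
    "card {K. \<not> inj_on (\<lambda>A. meval x (theta c K A)) L} \<le> card (L \<times> L) * card G"
proof -
  define u where "u \<pi> = meval (\<lambda>k. x (\<pi> k)) (lform n c)" for \<pi>
  have uinj: "inj_on u (perms n)" using assms unfolding separates_def by (simp add: u_def[abs_def])
  define D where "D = {(A, B). A \<in> L \<and> B \<in> L \<and> A \<noteq> B}"
  define p where "p A = (\<Prod>\<pi>\<in>A. [:- u \<pi>, 1:])" for A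
  define q where "q = (\<lambda>(A, B). p A - p B)"
  have D: "D \<subseteq> L \<times> L" by (auto simp: D_def)
  then have finD: "finite D" by (rule finite_subset) simp
  have q0: "q d \<noteq> 0" if d: "d \<in> D" for d
  proof
    assume 0: "q d = 0"
    obtain A B where AB: "d = (A, B)" "A \<in> L" "B \<in> L" "A \<noteq> B" using d by (auto simp: D_def)
    obtain \<pi> where \<pi>: "\<pi> \<in> A" using coset_nonempty[OF AB(2)] by blast
    have "poly (p A) (u \<pi>) = 0" using \<pi> finite_coset[OF AB(2)] by (auto simp: p_def poly_prod prod_zero_iff)
    then have "poly (p B) (u \<pi>) = 0" using 0 by (simp add: q_def AB)
    then obtain \<rho> where \<rho>: "\<rho> \<in> B" "u \<pi> = u \<rho>" using finite_coset[OF AB(3)] by (auto simp: p_def poly_prod prod_zero_iff)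
    then have "\<pi> = \<rho>" using inj_onD[OF uinj] coset_perms AB \<pi> by metis
    then show False using coset_disjoint[OF AB(2-4)] \<pi> \<rho> by blast
  qed
  have degq: "Polynomial.degree (q d) \<le> card G" if d: "d \<in> D" for d
  proof -
    obtain A B where AB: "d = (A, B)" "A \<in> L" "B \<in> L" using d by (auto simp: D_def)
    have "Polynomial.degree (p A) \<le> card A" if "A \<in> L" for A
      unfolding p_def by (rule order_trans[OF degree_prod_sum_le[OF finite_coset[OF that]]]) auto
    then have "Polynomial.degree (p A) \<le> card G" "Polynomial.degree (p B) \<le> card G"
      using card_coset AB by metis+
    then show ?thesis by (simp add: q_def AB degree_diff_le)
  qed
  have sub: "{K. \<not> inj_on (\<lambda>A. meval x (theta c K A)) L} \<subseteq> (\<Union>d\<in>D. {K. poly (q d) (of_nat K) = 0})"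
  proof
    fix K assume "K \<in> {K. \<not> inj_on (\<lambda>A. meval x (theta c K A)) L}"
    then obtain A B where d: "A \<in> L" "B \<in> L" "A \<noteq> B" "meval x (theta c K A) = meval x (theta c K B)"
      unfolding inj_on_def by blast
    then have "poly (q (A, B)) (of_nat K) = 0"
      by (simp add: q_def p_def poly_prod meval_theta u_def)
    then show "K \<in> (\<Union>d\<in>D. {K. poly (q d) (of_nat K) = 0})"
      using d by (intro UN_I[of "(A, B)"]) (auto simp: D_def)
  qed
  have fin: "finite (\<Union>d\<in>D. {K. poly (q d) (of_nat K) = 0})"
    using finD q0 by (intro finite_UN_I card_vanishing_nats) auto
  show "finite {K. \<not> inj_on (\<lambda>A. meval x (theta c K A)) L}" by (rule finite_subset[OF sub fin])
  have "card {K. \<not> inj_on (\<lambda>A. meval x (theta c K A)) L} \<le> card (\<Union>d\<in>D. {K. poly (q d) (of_nat K) = 0})"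
    by (rule card_mono[OF fin sub])
  also have "\<dots> \<le> (\<Sum>d\<in>D. card {K::nat. poly (q d) (of_nat K) = 0})" by (rule card_UN_le[OF finD])
  also have "\<dots> \<le> (\<Sum>d\<in>D. card G)"
    using card_vanishing_nats(2)[OF q0] degq by (intro sum_mono) (meson le_trans)
  also have "\<dots> \<le> card (L \<times> L) * card G"
    using card_mono[OF _ D] by (simp del: card_cartesian_product)
  finally show "card {K. \<not> inj_on (\<lambda>A. meval x (theta c K A)) L} \<le> card (L \<times> L) * card G" .
qed

definition param_bound :: nat where
  "param_bound = card (perms n \<times> perms n) * n + card (L \<times> L) * card G"

text \<open>Each parameter has fewer bad values than \<open>param_bound + 1\<close>. As this bound
  does not depend on \<open>x\<close>, finitely many pairs \<open>(c, K)\<close> serve all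
  slices.\<close>

lemma good_params:
  fixes x :: "nat \<Rightarrow> 'a::{idom, ring_char_0}"
  assumes "inj_on x {1..n}"
  obtains c K where "c \<le> param_bound" "K \<le> param_bound" "separates n x c"
    "inj_on (\<lambda>A. meval x (theta c K A)) L"
proof -
  have pick: "\<exists>a\<le>b. a \<notin> S" if "finite S" "card S \<le> b" for S :: "nat set" and b
  proof (rule ccontr)
    assume "\<not> ?thesis"
    then have "{..b} \<subseteq> S" by blast
    from card_mono[OF that(1) this] have "Suc b \<le> card S" by simp
    then show False using that(2) by simp
  qed
  have 1: "card {c. \<not> separates n x c} \<le> param_bound"
    unfolding param_bound_def by (rule trans_le_add1[OF not_separates_bound(2)[OF assms]])
  obtain c where c: "c \<le> param_bound" "separates n x c"
    using pick[OF not_separates_bound(1)[OF assms] 1] by blast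
  have 2: "card {K. \<not> inj_on (\<lambda>A. meval x (theta c K A)) L} \<le> param_bound"
    unfolding param_bound_def by (rule trans_le_add2[OF theta_bad_bound(2)[OF c(2)]])
  obtain K where "K \<le> param_bound" "inj_on (\<lambda>A. meval x (theta c K A)) L"
    using pick[OF theta_bad_bound(1)[OF c(2)] 2] by blast
  then show ?thesis using c that by blast
qed

lemma symm_prod_L:
  assumes "\<And>\<tau> A. \<tau> \<in> perms n \<Longrightarrow> A \<in> L \<Longrightarrow> pact \<tau> (f A) = f (translate \<tau> A)"
  shows "symm n (\<Prod>A\<in>L. f A)"
  unfolding symm_alt
proof
  fix \<tau> assume t: "\<tau> \<in> perms n"
  have "pact \<tau> (\<Prod>A\<in>L. f A) = (\<Prod>A\<in>L. pact \<tau> (f A))" by (simp add: pact_def meval_hom)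
  also have "\<dots> = (\<Prod>A\<in>L. f (translate \<tau> A))" using assms[OF t] by (intro prod.cong) auto
  also have "\<dots> = (\<Prod>A\<in>L. f A)" by (rule prod.reindex_bij_betw[OF bij_translate_L[OF t]])
  finally show "pact \<tau> (\<Prod>A\<in>L. f A) = (\<Prod>A\<in>L. f A)" .
qed

lemma pact_param: "\<tau> \<in> perms n \<Longrightarrow> k \<notin> {1..n} \<Longrightarrow> pact \<tau> (mvar k) = mvar k"
  by (simp add: pact_def perms_out del: mem_perms atLeastAtMost_iff)

lemma pact_hom:
  "pact \<tau> (p + q) = pact \<tau> p + pact \<tau> q" "pact \<tau> (p - q) = pact \<tau> p - pact \<tau> q"
  "pact \<tau> (p * q) = pact \<tau> p * pact \<tau> q" "pact \<tau> (p ^ k) = pact \<tau> p ^ k"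
  "pact \<tau> (sum f A) = (\<Sum>a\<in>A. pact \<tau> (f a))" "pact \<tau> (prod f A) = (\<Prod>a\<in>A. pact \<tau> (f a))"
  by (simp_all add: pact_def meval_hom)

text \<open>The variable \<open>n + 1\<close> stands for the indeterminate \<open>z\<close>.\<close>

definition resolvent :: "nat \<Rightarrow> nat \<Rightarrow> mpol" where
  "resolvent c K = (\<Prod>A\<in>L. mvar (Suc n) - theta c K A)"

lemma symm_resolvent: "symm n (resolvent c K)"
  unfolding resolvent_def
  by (rule symm_prod_L) (simp add: pact_hom pact_param pact_theta)

definition resolvent_disc :: "nat \<Rightarrow> nat \<Rightarrow> mpol" where
  "resolvent_disc c K = (\<Prod>A\<in>L. \<Prod>B\<in>L - {A}. theta c K A - theta c K B)"

lemma symm_resolvent_disc: "symm n (resolvent_disc c K)"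
  unfolding resolvent_disc_def
proof (rule symm_prod_L)
  fix \<tau> A assume t: "\<tau> \<in> perms n" and A: "A \<in> L"
  have b: "bij_betw (translate \<tau>) (L - {A}) (L - {translate \<tau> A})"
  proof -
    have "translate \<tau> ` (L - {A}) = L - {translate \<tau> A}"
      using bij_translate_L[OF t] A inj_on_image_set_diff[of "translate \<tau>" L L "{A}"] unfolding bij_betw_def by auto
    then show ?thesis using bij_translate_L[OF t] unfolding bij_betw_def by (auto intro: inj_on_subset)
  qed
  show "pact \<tau> (\<Prod>B\<in>L - {A}. theta c K A - theta c K B) =
      (\<Prod>B\<in>L - {translate \<tau> A}. theta c K (translate \<tau> A) - theta c K B)"
    using prod.reindex_bij_betw[OF b, of "\<lambda>B. theta c K (translate \<tau> A) - theta c K B"]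
    by (simp add: pact_hom pact_theta[OF t])
qed

text \<open>The coefficients of the auxiliary form are the variables with index above \<open>n + 1\<close>.\<close>

definition form_norm :: "nat \<Rightarrow> nat \<Rightarrow> nat \<Rightarrow> nat \<Rightarrow> mpol" where
  "form_norm c K d J = (\<Prod>A\<in>L. \<Sum>i<d. \<Sum>j<J. mvar (n + 2 + (i * J + j)) * theta c K A ^ i * mvar 0 ^ j)"

lemma symm_form_norm: "symm n (form_norm c K d J)"
  unfolding form_norm_def
  by (rule symm_prod_L) (simp add: pact_hom pact_param pact_theta)

end

section \<open>Exceptional parameters of a slice\<close>

text \<open>Ordered pairs are used, so the product is symmetric without a sign.\<close>

definition discriminant :: "nat \<Rightarrow> mpol" where
  "discriminant n = (\<Prod>i\<in>{1..n}. \<Prod>j\<in>{1..n} - {i}. mvar i - mvar j)"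

lemma symm_discriminant: "symm n (discriminant n)"
  unfolding symm_alt
proof
  fix \<tau> assume t: "\<tau> \<in> perms n"
  then have b: "bij_betw \<tau> {1..n} {1..n}" unfolding mem_perms by (rule permutes_imp_bij)
  have b': "bij_betw \<tau> ({1..n} - {i}) ({1..n} - {\<tau> i})" if "i \<in> {1..n}" for i
  proof -
    have "\<tau> ` ({1..n} - {i}) = {1..n} - {\<tau> i}"
      using b that inj_on_image_set_diff[of \<tau> "{1..n}" "{1..n}" "{i}"] unfolding bij_betw_def by auto
    then show ?thesis using b unfolding bij_betw_def by (auto intro: inj_on_subset)
  qed
  have "pact \<tau> (discriminant n) = (\<Prod>i\<in>{1..n}. \<Prod>j\<in>{1..n} - {i}. mvar (\<tau> i) - mvar (\<tau> j))"
    by (simp add: discriminant_def pact_def meval_hom)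
  also have "\<dots> = (\<Prod>i\<in>{1..n}. \<Prod>j\<in>{1..n} - {\<tau> i}. mvar (\<tau> i) - mvar j)"
    by (intro prod.cong refl prod.reindex_bij_betw[OF b'])
  also have "\<dots> = discriminant n"
    unfolding discriminant_def by (rule prod.reindex_bij_betw[OF b])
  finally show "pact \<tau> (discriminant n) = discriminant n" .
qed

lemma meval_discriminant: "meval x (discriminant n) = 0 \<longleftrightarrow> \<not> inj_on x {1..n}"
  for x :: "nat \<Rightarrow> 'a::idom"
proof -
  have "meval x (discriminant n) = (\<Prod>i\<in>{1..n}. \<Prod>j\<in>{1..n} - {i}. x i - x j)"
    by (simp add: discriminant_def meval_hom)
  also have "\<dots> = 0 \<longleftrightarrow> (\<exists>i\<in>{1..n}. \<exists>j\<in>{1..n} - {i}. x i = x j)"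
    by (simp add: prod_zero_iff)
  also have "\<dots> \<longleftrightarrow> \<not> inj_on x {1..n}" unfolding inj_on_def by blast
  finally show ?thesis .
qed

text \<open>The outcome of the local analysis at infinity: a point of the slice over Laurent series
  with full symmetric group. Later bounds are uniform over everything that has such a germ.\<close>

definition germ :: "nat \<Rightarrow> int poly \<Rightarrow> int poly \<Rightarrow> (nat \<Rightarrow> complex fls) \<Rightarrow> bool" where
  "germ m W f\<^sub>0 x \<longleftrightarrow>
     rootpoly (Suc m) x = map_poly of_int f\<^sub>0 + Polynomial.smult fls_X_inv (map_poly of_int W) \<and>
     x 0 = fls_X_inv \<and> inj_on x {1..Suc m} \<and> relperms (Suc m) x = perms (Suc m)"

lemma (in slice) germ_x: "germ m W f\<^sub>0 x"
  using rootpoly_x inj_x relperms_x by (simp add: germ_def)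

lemma meval_scoeff:
  fixes y :: "'a::comm_ring_1"
  assumes "rootpoly (Suc m) x = map_poly of_int f\<^sub>0 + Polynomial.smult y (map_poly of_int W)"
  shows "meval (extend_params (Suc m) x y p) (meval (esub (Suc m) mvar) P) = ipeval (meval (scoeff m f\<^sub>0 W p) P) y"
proof -
  have "esub (Suc m) (extend_params (Suc m) x y p) = (\<lambda>k. ipeval (scoeff m f\<^sub>0 W p k) y)"
    using esub_scoeff[OF assms] by blast
  then show ?thesis unfolding meval_meval_esub ipeval_meval by simp
qed

lemma extended_roots_slice:
  assumes "extended_roots n (f\<^sub>0 + Polynomial.smult t W) \<alpha>"
  shows "rootpoly n \<alpha> = map_poly of_int f\<^sub>0 + Polynomial.smult (of_int t) (map_poly of_int W)"
proof -
  have "rootpoly n \<alpha> = map_poly of_int (f\<^sub>0 + Polynomial.smult t W)"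
    using assms by (simp add: extended_roots_def root_labelling_def rootpoly_def)
  also have "\<dots> = map_poly of_int f\<^sub>0 + Polynomial.smult (of_int t) (map_poly of_int W)"
    by (intro poly_eqI) (simp add: coeff_map_poly)
  finally show ?thesis .
qed

definition slice_zeros :: "nat \<Rightarrow> int poly \<Rightarrow> int poly \<Rightarrow> (nat \<Rightarrow> int) \<Rightarrow> mpol \<Rightarrow> int set" where
  "slice_zeros m W f\<^sub>0 p R = {t. \<exists>\<alpha>. extended_roots (Suc m) (f\<^sub>0 + Polynomial.smult t W) \<alpha> \<and>
     meval (extend_params (Suc m) \<alpha> (of_int t) p) R = 0}"

text \<open>On the slice \<open>R\<close> becomes a polynomial in \<open>t\<close> whose degree is
  bounded by \<open>R\<close> alone. If it were zero, \<open>R\<close> would vanish at the germ,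
  which is the point \<open>t = 1/X\<close> of the same slice.\<close>

lemma slice_zeros_bounded:
  assumes "symm (Suc m) R"
  shows "\<exists>D. \<forall>W f\<^sub>0 x p. germ m W f\<^sub>0 x \<longrightarrow> meval (extend_params (Suc m) x fls_X_inv p) R \<noteq> 0 \<longrightarrow>
     finite (slice_zeros m W f\<^sub>0 p R) \<and> card (slice_zeros m W f\<^sub>0 p R) \<le> D"
proof -
  obtain P where P: "R = meval (esub (Suc m) mvar) P" using symmetric_function_theorem[OF assms] by blast
  obtain D where D: "\<And>\<rho> :: nat \<Rightarrow> int poly. (\<forall>k. Polynomial.degree (\<rho> k) \<le> 1) \<Longrightarrow> Polynomial.degree (meval \<rho> P) \<le> D"
    using meval_degree_bound by blast
  show ?thesis
  proof (intro exI[of _ D] allI impI)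
    fix W f\<^sub>0 :: "int poly" and x :: "nat \<Rightarrow> complex fls" and p :: "nat \<Rightarrow> int"
    assume x: "germ m W f\<^sub>0 x" and nz: "meval (extend_params (Suc m) x fls_X_inv p) R \<noteq> 0"
    have rp: "rootpoly (Suc m) x = map_poly of_int f\<^sub>0 + Polynomial.smult fls_X_inv (map_poly of_int W)"
      using x by (simp add: germ_def)
    let ?S = "slice_zeros m W f\<^sub>0 p R"
    define r where "r = meval (scoeff m f\<^sub>0 W p) P"
    have r0: "r \<noteq> 0" using nz unfolding P meval_scoeff[OF rp] r_def by auto
    have deg: "Polynomial.degree r \<le> D" unfolding r_def by (intro D allI degree_scoeff)
    have sub: "?S \<subseteq> {t. poly r t = 0}"
    proof
      fix t assume "t \<in> ?S"
      then obtain \<alpha> where \<alpha>: "extended_roots (Suc m) (f\<^sub>0 + Polynomial.smult t W) \<alpha>"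
        "meval (extend_params (Suc m) \<alpha> (of_int t) p) R = 0" unfolding slice_zeros_def by blast
      then have "ipeval r (of_int t :: complex) = 0"
        unfolding P meval_scoeff[OF extended_roots_slice[OF \<alpha>(1)]] r_def by simp
      then show "t \<in> {t. poly r t = 0}" by (simp add: ipeval_of_int_arg)
    qed
    show "finite ?S \<and> card ?S \<le> D"
      using finite_subset[OF sub poly_roots_finite[OF r0]] card_mono[OF poly_roots_finite[OF r0] sub]
        card_poly_roots_bound[OF r0] deg by linarith
  qed
qed

section \<open>The resolvent as a polynomial in \<open>z\<close> and \<open>t\<close>\<close>

lemma bieval_add: "bieval (F + F') z t = bieval F z t + bieval F' z t"
  by (simp add: bieval_poly_poly)

lemma bieval_mult: "bieval (F * F') z t = bieval F z t * bieval F' z t"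
  by (simp add: bieval_poly_poly)

lemma bieval_of_int: "bieval (of_int a) z t = a"
  by (simp add: bieval_poly_poly of_int_poly)

lemma bieval_meval: "bieval (meval \<rho> P) z t = meval (\<lambda>k. bieval (\<rho> k) z t) P"
  by (induction P rule: mpol_induct) (simp_all add: meval_hom bieval_add bieval_mult bieval_of_int)

lemma of_int_meval: "of_int (meval \<rho> P) = meval (\<lambda>k. of_int (\<rho> k)) P"
  by (induction P rule: mpol_induct) (simp_all add: meval_hom)

lemma poly_eq_on_ints:
  fixes p q :: "complex poly"
  assumes "\<And>z::int. poly p (of_int z) = poly q (of_int z)"
  shows "p = q"
proof (rule ccontr)
  assume "p \<noteq> q"
  then have "finite {c::nat. poly (p - q) (of_nat c) = 0}" by (intro card_vanishing_nats) simp
  moreover have "{c::nat. poly (p - q) (of_nat c) = 0} = UNIV"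
    using assms[of "int _"] by simp
  ultimately show False by simp
qed

context perm_group
begin

lemma meval_theta_cong:
  assumes "A \<in> L" "\<And>i. i \<in> {1..n} \<Longrightarrow> x i = y i"
  shows "meval x (theta c K A) = meval y (theta c K A)"
  unfolding meval_theta meval_lform
proof (intro prod.cong refl arg_cong2[where f = minus] sum.cong arg_cong2[where f = times])
  fix \<pi> i assume "\<pi> \<in> A" "i \<in> {1..n}"
  then show "x (\<pi> i) = y (\<pi> i)" using assms(2) perms_in[OF coset_perms[OF assms(1)]] by blast
qed

lemma meval_theta_extend_params:
  assumes "A \<in> L"
  shows "meval (extend_params n x y p) (theta c K A) = meval x (theta c K A)"
  by (rule meval_theta_cong[OF assms]) (auto simp: extend_params_def)

definition resolvent_repr :: "nat \<Rightarrow> nat \<Rightarrow> mpol" where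
  "resolvent_repr c K = (SOME P. resolvent c K = meval (esub n mvar) P)"

lemma resolvent_repr: "resolvent c K = meval (esub n mvar) (resolvent_repr c K)"
  unfolding resolvent_repr_def
  by (rule someI_ex[OF symmetric_function_theorem[OF symm_resolvent]])

end

locale perm_group_Suc = perm_group "Suc m" G for m G
begin

definition bires :: "nat \<Rightarrow> nat \<Rightarrow> int poly \<Rightarrow> int poly \<Rightarrow> int poly poly" where
  "bires c K f\<^sub>0 W = meval (\<lambda>k. if k = Suc (Suc m) then [:0, 1:] else [:scoeff m f\<^sub>0 W (\<lambda>_. 0) k:]) (resolvent_repr c K)"

lemma bires:
  assumes "extended_roots (Suc m) (f\<^sub>0 + Polynomial.smult t W) \<alpha>"
  shows "of_int (bieval (bires c K f\<^sub>0 W) z t) = (\<Prod>A\<in>L. of_int z - meval \<alpha> (theta c K A))"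
proof -
  let ?p = "(\<lambda>_. 0)(Suc (Suc m) := z)"
  let ?X = "extend_params (Suc m) \<alpha> (of_int t) ?p"
  note r = extended_roots_slice[OF assms]
  have "bieval (if k = Suc (Suc m) then [:0, 1:] else [:scoeff m f\<^sub>0 W (\<lambda>_. 0) k:]) z t = poly (scoeff m f\<^sub>0 W ?p k) t" for k
    by (simp add: bieval_pCons scoeff_def)
  then have "of_int (bieval (bires c K f\<^sub>0 W) z t) = meval (\<lambda>k. of_int (poly (scoeff m f\<^sub>0 W ?p k) t)) (resolvent_repr c K)"
    by (simp add: bires_def bieval_meval of_int_meval)
  also have "\<dots> = ipeval (meval (scoeff m f\<^sub>0 W ?p) (resolvent_repr c K)) (of_int t)"
    unfolding ipeval_meval by (simp only: ipeval_of_int_arg)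
  also have "\<dots> = meval ?X (resolvent c K)"
    unfolding resolvent_repr by (rule meval_scoeff[OF r, symmetric])
  also have "\<dots> = (\<Prod>A\<in>L. of_int z - meval \<alpha> (theta c K A))"
  proof -
    have "?X (Suc (Suc m)) = of_int z" by (simp add: extend_params_def)
    then show ?thesis
      unfolding resolvent_def meval_prod meval_diff meval_var
      by (intro prod.cong refl) (simp only: meval_theta_extend_params)
  qed
  finally show ?thesis .
qed

text \<open>The derivative of a product of linear factors at one of its zeros. The right side is a
  fixed polynomial in the roots, so its size and its vanishing are controlled.\<close>

lemma bires_pderiv:
  assumes r: "extended_roots (Suc m) (f\<^sub>0 + Polynomial.smult t W) \<alpha>" and z: "of_int z = meval \<alpha> (theta c K G)"
  shows "of_int (bieval (pderiv (bires c K f\<^sub>0 W)) z t) =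
    (\<Prod>A\<in>L - {G}. meval \<alpha> (theta c K G) - meval \<alpha> (theta c K A))"
proof -
  let ?F = "bires c K f\<^sub>0 W" and ?u = "\<lambda>A. meval \<alpha> (theta c K A)"
  define Ft where "Ft = map_poly (\<lambda>c. poly c t) ?F"
  have "map_poly of_int Ft = (\<Prod>A\<in>L. [:- ?u A, 1:])"
  proof (rule poly_eq_on_ints)
    fix z :: int
    have "poly (map_poly of_int Ft) (of_int z :: complex) = of_int (bieval ?F z t)"
      using ipeval_of_int_arg[of Ft z] by (simp add: ipeval_def Ft_def bieval_def)
    then show "poly (map_poly of_int Ft) (of_int z) = poly (\<Prod>A\<in>L. [:- ?u A, 1:]) (of_int z)"
      by (simp add: bires[OF r] poly_prod)
  qed
  also have "\<dots> = [:- ?u G, 1:] * (\<Prod>A\<in>L - {G}. [:- ?u A, 1:])"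
    using G_in_L by (subst prod.remove[of _ G]) auto
  finally have Ft: "map_poly of_int Ft = [:- ?u G, 1:] * (\<Prod>A\<in>L - {G}. [:- ?u A, 1:])" .
  have 1: "map_poly of_int (pderiv Ft) = pderiv (map_poly of_int Ft :: complex poly)"
    by (intro poly_eqI) (simp add: coeff_map_poly coeff_pderiv)
  have 2: "map_poly (\<lambda>c. poly c t) (pderiv ?F) = pderiv Ft"
    unfolding Ft_def by (intro poly_eqI) (simp add: coeff_map_poly coeff_pderiv of_nat_poly)
  have "of_int (bieval (pderiv ?F) z t) = ipeval (pderiv Ft) (of_int z :: complex)"
    by (simp add: ipeval_of_int_arg bieval_def 2)
  also have "\<dots> = poly (pderiv (map_poly of_int Ft)) (?u G)" by (simp add: ipeval_def 1 z)
  also have "\<dots> = (\<Prod>A\<in>L - {G}. ?u G - ?u A)"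
    unfolding Ft pderiv_mult by (simp add: pderiv_pCons poly_prod)
  finally show ?thesis .
qed

text \<open>If one factor of the norm vanishes at the germ, all do, because every permutation
  preserves relations and the cosets are permuted transitively. A polynomial of degree less than
  \<open>card L\<close> in \<open>z\<close> then has \<open>card L\<close> distinct zeros, so all
  coefficients of the form vanish.\<close>

lemma form_norm_nonzero:
  fixes g :: "nat \<Rightarrow> nat \<Rightarrow> int"
  assumes x: "germ m W f\<^sub>0 x" and sep: "inj_on (\<lambda>A. meval x (theta c K A)) L"
    and g: "\<exists>i<card L. \<exists>j<J. g i j \<noteq> 0"
    and p: "\<And>i j. i < card L \<Longrightarrow> j < J \<Longrightarrow> p (Suc m + 2 + (i * J + j)) = g i j"
  shows "meval (extend_params (Suc m) x fls_X_inv p) (form_norm c K (card L) J) \<noteq> 0"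
proof
  let ?X = "extend_params (Suc m) x fls_X_inv p" and ?d = "card L"
  let ?S = "\<lambda>A. \<Sum>i<?d. \<Sum>j<J. of_int (g i j) * meval x (theta c K A) ^ i * fls_X_inv ^ j"
  assume "meval ?X (form_norm c K ?d J) = 0"
  moreover have "meval ?X (form_norm c K ?d J) = (\<Prod>A\<in>L. ?S A)"
    unfolding form_norm_def meval_prod
  proof (rule prod.cong[OF refl])
    fix A assume A: "A \<in> L"
    have X0: "?X 0 = fls_X_inv" by (simp add: extend_params_def)
    have Xp: "?X (Suc m + 2 + (i * J + j)) = of_int (g i j)" if "i < ?d" "j < J" for i j
      using p[OF that] by (simp add: extend_params_def)
    show "meval ?X (\<Sum>i<?d. \<Sum>j<J. mvar (Suc m + 2 + (i * J + j)) * theta c K A ^ i * mvar 0 ^ j) = ?S A"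
      unfolding meval_sum meval_mult meval_power meval_var meval_theta_extend_params[OF A] X0
      by (intro sum.cong refl) (simp only: Xp lessThan_iff)
  qed
  ultimately obtain A where A: "A \<in> L" "?S A = 0" by (auto simp: prod_zero_iff)
  define P where "P = (\<Sum>i<?d. \<Sum>j<J. of_int (g i j) * theta c K A ^ i * mvar 0 ^ j)"
  have x0: "x 0 = fls_X_inv" using x by (simp add: germ_def)
  have evP: "meval y P = (\<Sum>i<?d. \<Sum>j<J. of_int (g i j) * meval y (theta c K A) ^ i * y 0 ^ j)" for y :: "nat \<Rightarrow> complex fls"
    by (simp add: P_def meval_hom)
  have P0: "meval x P = 0" using A(2) by (simp only: evP x0)
  have SB: "?S B = 0" if B: "B \<in> L" for B
  proof -
    obtain \<tau> where \<tau>: "\<tau> \<in> perms (Suc m)" "translate \<tau> A = B" using transitive_L[OF A(1) B] by blast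
    have "\<tau> \<in> relperms (Suc m) x" using x \<tau> by (simp add: germ_def)
    then have "meval (\<lambda>k. x (\<tau> k)) P = 0" using P0 by (simp add: relperms_def)
    moreover have "\<tau> 0 = 0" by (rule perms_out[OF \<tau>(1)]) simp
    ultimately show ?thesis
      unfolding evP meval_theta_translate[OF \<tau>(1)] \<tau>(2) by (simp only: x0)
  qed
  define q where "q = (\<Sum>i<?d. Polynomial.monom (\<Sum>j<J. of_int (g i j) * (fls_X_inv :: complex fls) ^ j) i)"
  have qB: "poly q (meval x (theta c K B)) = 0" if "B \<in> L" for B
    using SB[OF that] by (simp add: q_def poly_sum poly_monom sum_distrib_left sum_distrib_right ac_simps)
  have "Polynomial.degree q \<le> ?d - 1" unfolding q_def
    by (intro degree_sum_le) (auto intro: order_trans[OF degree_monom_le])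
  then have "q = 0" using card_L_pos by (intro poly_eq_0_of_roots[OF qB sep]) auto
  obtain i j where ij: "i < ?d" "j < J" "g i j \<noteq> 0" using g by blast
  have "Polynomial.coeff q i = (\<Sum>j<J. of_int (g i j) * fls_X_inv ^ j)"
    using ij by (simp add: q_def coeff_sum coeff_monom sum.delta)
  then have "(\<Sum>j<J. of_int (g i j) * (fls_X_inv :: complex fls) ^ j) = 0" using \<open>q = 0\<close> by simp
  \<comment> \<open>The powers of \<open>fls_X_inv\<close> are linearly independent: the coefficient
    at \<open>-j\<close> isolates \<open>g i j\<close>.\<close>
  then have "fls_nth (\<Sum>j<J. of_int (g i j) * (fls_X_inv :: complex fls) ^ j) (- int j) = 0" by simp
  moreover have "fls_nth (\<Sum>j<J. of_int (g i j) * (fls_X_inv :: complex fls) ^ j) (- int j) =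
      (\<Sum>j'<J. if j' = j then of_int (g i j') else 0)"
  proof -
    have "fls_nth (of_int a * (fls_X_inv :: complex fls) ^ j') (- int j) = (if j' = j then of_int a else 0)" for a j'
      by (simp add: fls_of_int)
    then show ?thesis unfolding fls_nth_sum by (intro sum.cong refl)
  qed
  ultimately show False using ij by simp
qed

definition class_point :: "nat \<Rightarrow> nat \<Rightarrow> int poly \<Rightarrow> int poly \<Rightarrow> nat \<Rightarrow> nat \<Rightarrow> nat \<Rightarrow> int \<Rightarrow> int \<Rightarrow> bool" where
  "class_point c K W f\<^sub>0 l Z T z t \<longleftrightarrow> \<bar>z\<bar> \<le> int Z \<and> \<bar>t\<bar> \<le> int T \<and>
     \<not> int l dvd bieval (pderiv (bires c K f\<^sub>0 W)) z t \<and>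
     (\<exists>\<alpha>. extended_roots (Suc m) (f\<^sub>0 + Polynomial.smult t W) \<alpha> \<and> of_int z = meval \<alpha> (theta c K G))"

text \<open>The form differs from class to class, but its coefficients enter
  \<open>form_norm\<close> as parameters, so a single polynomial covers all forms and
  \<open>D\<close> depends on \<open>c\<close>, \<open>K\<close> and \<open>J\<close> only.\<close>

lemma class_bounded:
  "\<exists>D. \<forall>W f\<^sub>0 x S z l e Z T. germ m W f\<^sub>0 x \<longrightarrow> inj_on (\<lambda>A. meval x (theta c K A)) L \<longrightarrow>
     prime l \<longrightarrow> e \<ge> 1 \<longrightarrow> Z \<ge> 1 \<longrightarrow> T \<ge> 1 \<longrightarrow> J \<ge> 1 \<longrightarrow> large_modulus (card L) J Z T (l ^ e) \<longrightarrow>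
     (\<forall>t\<in>S. class_point c K W f\<^sub>0 l Z T (z t) t) \<longrightarrow>
     (\<forall>s\<in>S. \<forall>t\<in>S. int l dvd z s - z t \<and> int (l ^ e) dvd s - t) \<longrightarrow>
     card S \<le> D"
proof -
  let ?R = "form_norm c K (card L) J"
  obtain D where D: "\<And>W f\<^sub>0 x p. germ m W f\<^sub>0 x \<Longrightarrow> meval (extend_params (Suc m) x fls_X_inv p) ?R \<noteq> 0 \<Longrightarrow>
     finite (slice_zeros m W f\<^sub>0 p ?R) \<and> card (slice_zeros m W f\<^sub>0 p ?R) \<le> D"
    using slice_zeros_bounded[OF symm_form_norm[of c K "card L" J]] by blast
  show ?thesis
  proof (intro exI[of _ D] allI impI)
    fix W f\<^sub>0 :: "int poly" and x :: "nat \<Rightarrow> complex fls" and S :: "int set" and z :: "int \<Rightarrow> int" and l e Z T :: nat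
    assume x: "germ m W f\<^sub>0 x" and sep: "inj_on (\<lambda>A. meval x (theta c K A)) L"
      and l: "prime l" "e \<ge> 1" and Z: "Z \<ge> 1" and T: "T \<ge> 1" and J: "J \<ge> 1"
      and large: "large_modulus (card L) J Z T (l ^ e)"
      and S: "\<forall>t\<in>S. class_point c K W f\<^sub>0 l Z T (z t) t"
      and cong: "\<forall>s\<in>S. \<forall>t\<in>S. int l dvd z s - z t \<and> int (l ^ e) dvd s - t"
    show "card S \<le> D"
    proof (cases "S = {}")
      case False
      then obtain t0 where t0: "t0 \<in> S" by blast
      have N: "1 \<le> card L * J" using card_L_pos J by simp
      have nd: "\<not> int l dvd bieval (pderiv (bires c K f\<^sub>0 W)) (z t0) t0"
        using S t0 unfolding class_point_def by blast
      obtain g :: "nat \<Rightarrow> nat \<Rightarrow> int" where g: "\<exists>i<card L. \<exists>j<J. g i j \<noteq> 0"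
        "\<And>y t. bieval (bires c K f\<^sub>0 W) y t = 0 \<Longrightarrow> int l dvd y - z t0 \<Longrightarrow> int (l ^ e) dvd t - t0 \<Longrightarrow>
           \<bar>y\<bar> \<le> int Z \<Longrightarrow> \<bar>t\<bar> \<le> int T \<Longrightarrow> (\<Sum>i<card L. \<Sum>j<J. g i j * y ^ i * t ^ j) = 0"
        by (rule vanishing_form_on_class[OF l N Z T nd large]) blast
      \<comment> \<open>Inverts the numbering \<open>i * J + j\<close> of the coefficient
        variables.\<close>
      define p where "p k = (let a = k - (Suc m + 2) in g (a div J) (a mod J))" for k
      have p: "p (Suc m + 2 + (i * J + j)) = g i j" if "j < J" for i j
        using that by (simp add: p_def Let_def)
      have nz: "meval (extend_params (Suc m) x fls_X_inv p) ?R \<noteq> 0"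
        by (rule form_norm_nonzero[OF x sep g(1) p])
      from D[OF x nz] have fin: "finite (slice_zeros m W f\<^sub>0 p ?R)" and cZ: "card (slice_zeros m W f\<^sub>0 p ?R) \<le> D" by auto
      have "S \<subseteq> slice_zeros m W f\<^sub>0 p ?R"
      proof
        fix t assume t: "t \<in> S"
        then obtain \<alpha> where \<alpha>: "extended_roots (Suc m) (f\<^sub>0 + Polynomial.smult t W) \<alpha>"
          "of_int (z t) = meval \<alpha> (theta c K G)" "\<bar>z t\<bar> \<le> int Z" "\<bar>t\<bar> \<le> int T"
          using S unfolding class_point_def by blast
        have "of_int (bieval (bires c K f\<^sub>0 W) (z t) t) = (0::complex)"
          unfolding bires[OF \<alpha>(1)] using G_in_L \<alpha>(2) by (intro prod_zero) auto
        then have "bieval (bires c K f\<^sub>0 W) (z t) t = 0" by simp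
        then have s: "(\<Sum>i<card L. \<Sum>j<J. g i j * z t ^ i * t ^ j) = 0"
          using g(2) cong t t0 \<alpha> by blast
        \<comment> \<open>The factor of the norm at the coset \<open>G\<close> is the form evaluated
          at \<open>(z t, t)\<close>.\<close>
        have "meval (extend_params (Suc m) \<alpha> (of_int t) p) ?R = 0"
          unfolding form_norm_def meval_prod
        proof (rule prod_zero, simp, rule bexI[OF _ G_in_L])
          let ?X = "extend_params (Suc m) \<alpha> (of_int t) p"
          have X0: "?X 0 = of_int t" by (simp add: extend_params_def)
          have Xp: "?X (Suc m + 2 + (i * J + j)) = of_int (g i j)" if "j < J" for i j
            using p[OF that] by (simp add: extend_params_def)
          have "meval ?X (\<Sum>i<card L. \<Sum>j<J. mvar (Suc m + 2 + (i * J + j)) * theta c K G ^ i * mvar 0 ^ j) =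
              (\<Sum>i<card L. \<Sum>j<J. of_int (g i j) * of_int (z t) ^ i * of_int t ^ j)"
            unfolding meval_sum meval_mult meval_power meval_var meval_theta_extend_params[OF G_in_L] X0 \<alpha>(2)[symmetric]
            by (intro sum.cong refl) (simp only: Xp lessThan_iff)
          also have "\<dots> = of_int (\<Sum>i<card L. \<Sum>j<J. g i j * z t ^ i * t ^ j)" by simp
          finally show "meval ?X (\<Sum>i<card L. \<Sum>j<J. mvar (Suc m + 2 + (i * J + j)) * theta c K G ^ i * mvar 0 ^ j) = 0"
            using s by simp
        qed
        then show "t \<in> slice_zeros m W f\<^sub>0 p ?R" using \<alpha>(1) unfolding slice_zeros_def by blast
      qed
      from card_mono[OF fin this] cZ show ?thesis by linarith
    qed simp
  qed
qed

end

section \<open>Counting on a slice\<close>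

lemma real_sum_lessThan: "real (\<Sum>k<n. k) = real n * (real n - 1) / 2"
  by (induction n) (auto simp: field_simps)

text \<open>After taking logarithms and dividing by \<open>N / 2\<close>, \<open>T\<close>
  contributes \<open>(J - 1) * ln H\<close> and \<open>q\<close> contributes
  \<open>(N - 1) / d * ln H = (J - 1 / d) * ln H\<close>. So the exponent \<open>1 / d\<close> just
  suffices for \<open>T\<close>, and the surplus \<eta> pays for \<open>Z\<close> once
  \<open>J\<close> is large.\<close>

lemma determinant_inequality_eventually:
  fixes d \<kappa> :: nat and \<eta> C :: real
  assumes d: "d \<ge> 1" and \<eta>: "\<eta> > 0" and C: "C \<ge> 1"
  shows "\<exists>J\<ge>1. \<exists>H0\<ge>1. \<forall>H\<ge>H0. \<forall>Z T q :: nat. Z \<ge> 1 \<longrightarrow> T \<ge> 1 \<longrightarrow> real Z \<le> C * H ^ \<kappa> \<longrightarrow> real T \<le> H \<longrightarrow>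
     H powr (1 / real d + \<eta>) \<le> real q \<longrightarrow>
     large_modulus d J Z T q"
proof -
  \<comment> \<open>Makes \<open>(J - 1) * \<eta>\<close> at least
    \<open>(d - 1) * \<kappa> + 1\<close>; the extra 1 absorbs the constants collected in
    \<open>H0\<close>.\<close>
  define J where "J = nat \<lceil>((real d - 1) * real \<kappa> + 1) / \<eta>\<rceil> + 1"
  define N where "N = d * J"
  define H0 where "H0 = max 1 (exp (2 * ln (real N + 1) + (real d - 1) * ln C))"
  have J: "J \<ge> 1" by (simp add: J_def)
  have "((real d - 1) * real \<kappa> + 1) / \<eta> \<le> real J - 1"
    unfolding J_def by (simp add: of_nat_ceiling)
  then have J\<eta>: "(real d - 1) * real \<kappa> + 1 \<le> (real J - 1) * \<eta>" using \<eta> by (simp add: field_simps)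
  have "1 * J \<le> d * J" using d by (intro mult_right_mono) auto
  then have JN: "real J \<le> real N" unfolding N_def by (simp only: of_nat_le_iff mult_1)
  have "(real J - 1) * \<eta> \<le> (real N - 1) * \<eta>" using JN \<eta> by (intro mult_right_mono) auto
  then have N\<eta>: "(real d - 1) * real \<kappa> + 1 \<le> (real N - 1) * \<eta>" using J\<eta> by linarith
  have N1: "real N \<ge> 1" using JN J by simp
  show ?thesis
  proof (intro exI[of _ J] exI[of _ H0] conjI allI impI)
    show "1 \<le> H0" by (simp add: H0_def)
    fix H :: real and Z T q :: nat
    assume H: "H \<ge> H0" and Z: "Z \<ge> 1" "real Z \<le> C * H ^ \<kappa>" and T: "T \<ge> 1" "real T \<le> H"
      and q: "H powr (1 / real d + \<eta>) \<le> real q"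
    have H1: "H \<ge> 1" using H by (simp add: H0_def)
    have lnH: "ln H \<ge> 2 * ln (real N + 1) + (real d - 1) * ln C"
      using H H1 by (subst ln_ge_iff) (auto simp: H0_def)
    have lnH0: "ln H \<ge> 0" using H1 by simp
    have lnZ: "ln (real Z) \<le> ln C + real \<kappa> * ln H"
    proof -
      have "ln (real Z) \<le> ln (C * H ^ \<kappa>)" using Z by (subst ln_le_cancel_iff) (use C H1 in auto)
      also have "\<dots> = ln C + real \<kappa> * ln H" using C H1 by (simp add: ln_mult ln_realpow)
      finally show ?thesis .
    qed
    have lnT: "ln (real T) \<le> ln H" using T by (subst ln_le_cancel_iff) (use H1 in auto)
    have Hp: "H powr (1 / real d + \<eta>) > 0" using H1 by simp
    then have qp: "real q > 0" using q by linarith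
    have lnq: "(1 / real d + \<eta>) * ln H \<le> ln (real q)"
    proof -
      have "ln (H powr (1 / real d + \<eta>)) \<le> ln (real q)" using q Hp qp by (subst ln_le_cancel_iff) auto
      then show ?thesis using H1 by (simp add: ln_powr)
    qed
    have key: "2 * ln (real N + 1) + (real d - 1) * ln (real Z) + (real J - 1) * ln (real T) \<le> (real N - 1) * ln (real q)"
    proof -
      have d1: "real d - 1 \<ge> 0" using d by simp
      have "(real d - 1) * ln (real Z) \<le> (real d - 1) * (ln C + real \<kappa> * ln H)"
        by (intro mult_left_mono lnZ d1)
      moreover have "(real J - 1) * ln (real T) \<le> (real J - 1) * ln H"
        using J by (intro mult_left_mono lnT) auto
      moreover have "(real N - 1) * ((1 / real d + \<eta>) * ln H) \<le> (real N - 1) * ln (real q)"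
        using N1 by (intro mult_left_mono lnq) auto
      moreover have "(real N - 1) * ((1 / real d + \<eta>) * ln H) = (real J - 1 / real d + (real N - 1) * \<eta>) * ln H"
      proof -
        have "real J = real N / real d" using d by (simp add: N_def)
        then show ?thesis by (simp add: algebra_simps diff_divide_distrib)
      qed
      moreover have "((real d - 1) * real \<kappa> + 1) * ln H \<le> ((real N - 1) * \<eta>) * ln H"
        using N\<eta> lnH0 by (intro mult_right_mono) auto
      moreover have "(1 - 1 / real d) * ln H \<ge> 0" using d lnH0 by (intro mult_nonneg_nonneg) auto
      ultimately show ?thesis using lnH by (simp add: algebra_simps)
    qed
    let ?lhs = "real ((d * J + 1) ^ (d * J) * Z ^ (J * (\<Sum>i<d. i)) * T ^ (d * (\<Sum>j<J. j)))"
    have pos: "real (N + 1) > 0" "real Z > 0" "real T > 0" using Z T by auto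
    have "?lhs = real (N + 1) ^ N * real Z ^ (J * (\<Sum>i<d. i)) * real T ^ (d * (\<Sum>j<J. j))"
      by (simp add: N_def)
    then have "ln ?lhs = ln (real (N + 1) ^ N * real Z ^ (J * (\<Sum>i<d. i)) * real T ^ (d * (\<Sum>j<J. j)))"
      by (rule arg_cong)
    also have "\<dots> = real N * ln (real (N + 1)) + real (J * (\<Sum>i<d. i)) * ln (real Z) + real (d * (\<Sum>j<J. j)) * ln (real T)"
    proof -
      have "real (N + 1) ^ N > 0" "real Z ^ (J * (\<Sum>i<d. i)) > 0" "real T ^ (d * (\<Sum>j<J. j)) > 0"
        using pos by auto
      then show ?thesis using pos by (simp only: ln_mult_pos ln_realpow mult_pos_pos)
    qed
    also have "\<dots> = real N / 2 * (2 * ln (real N + 1) + (real d - 1) * ln (real Z) + (real J - 1) * ln (real T))"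
      unfolding of_nat_mult[of J] of_nat_mult[of d "\<Sum>j<J. j"] real_sum_lessThan N_def
      by (simp add: field_simps)
    also have "\<dots> \<le> real N / 2 * ((real N - 1) * ln (real q))"
      by (intro mult_left_mono key) auto
    also have "\<dots> = real (\<Sum>k<N. k) * ln (real q)" by (simp only: real_sum_lessThan) simp
    also have "\<dots> = ln (real (q ^ (\<Sum>k<d * J. k)))" using qp by (simp add: ln_realpow N_def)
    finally have "ln ?lhs \<le> ln (real (q ^ (\<Sum>k<d * J. k)))" .
    moreover have "(0::real) < ?lhs"
    proof -
      have "0 < (d * J + 1) ^ (d * J) * Z ^ (J * (\<Sum>i<d. i)) * T ^ (d * (\<Sum>j<J. j))"
        using Z(1) T(1) by (intro mult_pos_pos zero_less_power) linarith+
      then show ?thesis by (simp only: of_nat_0_less_iff)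
    qed
    moreover have "0 < real (q ^ (\<Sum>k<d * J. k))" using qp by simp
    ultimately have "?lhs \<le> real (q ^ (\<Sum>k<d * J. k))" by (subst (asm) ln_le_cancel_iff)
    then show "large_modulus d J Z T q" unfolding large_modulus_def by (simp only: of_nat_le_iff)
  qed (rule J)
qed

lemma small_prime_not_dvd_eventually:
  fixes \<eta> C :: real and \<kappa> :: nat
  assumes \<eta>: "\<eta> > 0" and C: "C \<ge> 0"
  shows "\<exists>H0\<ge>1. \<forall>H\<ge>H0. \<forall>A::int. A \<noteq> 0 \<longrightarrow> real_of_int \<bar>A\<bar> \<le> C * H ^ \<kappa> \<longrightarrow>
    (\<exists>l::nat. prime l \<and> l \<le> nat \<lfloor>H powr \<eta>\<rfloor> \<and> \<not> int l dvd A)"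
proof -
  \<comment> \<open>With \<open>y\<close> about \<open>H powr \<eta>\<close>, the power
    \<open>y ^ K\<close> is at least of order \<open>H ^ (\<kappa> + 1)\<close>.\<close>
  define K where "K = nat \<lceil>(real \<kappa> + 1) / \<eta>\<rceil>"
  obtain y0 where y0: "\<And>y A::nat. y \<ge> y0 \<Longrightarrow> A > 0 \<Longrightarrow> (\<forall>p. prime p \<longrightarrow> p \<le> y \<longrightarrow> p dvd A) \<Longrightarrow> A > y ^ K"
    using all_small_primes_dvd_imp_large[of K] by blast
  \<comment> \<open>The factor \<open>2 ^ K\<close> allows for
    \<open>y \<ge> H powr \<eta> / 2\<close> after rounding down; the last term ensures
    \<open>y \<ge> y0\<close>.\<close>
  define H0 where "H0 = max 1 (max (C * 2 ^ K) ((real y0 + 1) powr (1 / \<eta>)))"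
  have K: "real \<kappa> + 1 \<le> \<eta> * real K"
  proof -
    have "(real \<kappa> + 1) / \<eta> \<le> real K" unfolding K_def by linarith
    then show ?thesis using \<eta> by (simp add: field_simps)
  qed
  show ?thesis
  proof (intro exI[of _ H0] conjI allI impI)
    show "1 \<le> H0" by (simp add: H0_def)
    fix H :: real and A :: int assume H: "H0 \<le> H" and A: "A \<noteq> 0" "real_of_int \<bar>A\<bar> \<le> C * H ^ \<kappa>"
    have H1: "H \<ge> 1" using H by (simp add: H0_def)
    define y where "y = nat \<lfloor>H powr \<eta>\<rfloor>"
    have "real y0 + 1 = ((real y0 + 1) powr (1 / \<eta>)) powr \<eta>" using \<eta> by (simp add: powr_powr)
    also have "\<dots> \<le> H powr \<eta>" using H \<eta> by (intro powr_mono2) (auto simp: H0_def)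
    finally have Hy0: "real y0 + 1 \<le> H powr \<eta>" .
    then have yy0: "y \<ge> y0" unfolding y_def by linarith
    have Hp1: "H powr \<eta> \<ge> 1" using Hy0 by linarith
    have "\<lfloor>H powr \<eta>\<rfloor> \<ge> 1" using Hp1 by (simp only: one_le_floor)
    then have yf: "real y = of_int \<lfloor>H powr \<eta>\<rfloor>" "(1::real) \<le> of_int \<lfloor>H powr \<eta>\<rfloor>" by (simp_all add: y_def)
    have yH: "H powr \<eta> / 2 \<le> real y"
      using yf real_of_int_floor_add_one_gt[of "H powr \<eta>"] by linarith
    show "\<exists>l::nat. prime l \<and> l \<le> nat \<lfloor>H powr \<eta>\<rfloor> \<and> \<not> int l dvd A"
    proof (rule ccontr)
      assume neg: "\<not> ?thesis"
      have "\<forall>p. prime p \<longrightarrow> p \<le> y \<longrightarrow> p dvd nat \<bar>A\<bar>"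
      proof (intro allI impI)
        fix p :: nat assume "prime p" "p \<le> y"
        then have "int p dvd A" using neg by (auto simp: y_def)
        then show "p dvd nat \<bar>A\<bar>" by (simp add: dvd_nat_abs_iff)
      qed
      moreover have "nat \<bar>A\<bar> > 0" using A by simp
      ultimately have "y ^ K < nat \<bar>A\<bar>" using y0[OF yy0] by blast
      then have "real y ^ K < real_of_int \<bar>A\<bar>"
        by (metis abs_ge_zero of_int_less_iff of_int_of_nat_eq of_nat_power zless_nat_eq_int_zless)
      moreover have "C * H ^ \<kappa> \<le> real y ^ K"
      proof -
        have "C * H ^ \<kappa> * 2 ^ K = (C * 2 ^ K) * H ^ \<kappa>" by simp
        also have "\<dots> \<le> H * H ^ \<kappa>" using H H1 by (intro mult_right_mono) (auto simp: H0_def)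
        also have "\<dots> = H powr (real \<kappa> + 1)" using H1 by (simp add: powr_add powr_realpow)
        also have "\<dots> \<le> H powr (\<eta> * real K)" using K H1 by (intro powr_mono) auto
        also have "\<dots> = (H powr \<eta>) ^ K" using H1 by (simp add: powr_powr[symmetric] powr_realpow)
        finally have "C * H ^ \<kappa> \<le> (H powr \<eta> / 2) ^ K" by (simp add: power_divide field_simps)
        also have "\<dots> \<le> real y ^ K" using yH by (intro power_mono) auto
        finally show ?thesis .
      qed
      ultimately show False using A by linarith
    qed
  qed
qed

text \<open>The least power that reaches \<open>P\<close> overshoots by at most a factor
  \<open>l\<close>, and \<open>l\<close> will be at most \<open>H powr \<eta>\<close>.\<close>

lemma prime_power_between:
  fixes P :: real
  assumes "P \<ge> 1" "prime (l::nat)"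
  obtains e where "e \<ge> 1" "P \<le> real (l ^ e)" "real (l ^ e) \<le> P * real l"
proof -
  have l2: "real l \<ge> 2" using prime_ge_2_nat[OF assms(2)] by linarith
  obtain b where b: "P < real l ^ b" using real_arch_pow[of "real l" P] l2 by auto
  define e where "e = (LEAST e. e \<ge> 1 \<and> P \<le> real l ^ e)"
  have "P \<le> real l ^ Suc b"
    using b l2 power_increasing[of b "Suc b" "real l"] by linarith
  then have "Suc b \<ge> 1 \<and> P \<le> real l ^ Suc b" by simp
  then have e: "e \<ge> 1 \<and> P \<le> real l ^ e" unfolding e_def by (rule LeastI)
  have "real l ^ e \<le> P * real l"
  proof (cases "e = 1")
    case True
    then show ?thesis using assms l2 by simp
  next
    case False
    then have "e - 1 \<ge> 1" "e - 1 < e" using e by auto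
    then have "\<not> P \<le> real l ^ (e - 1)" using not_less_Least[of "e - 1"] unfolding e_def by blast
    then have "real l ^ (e - 1) * real l \<le> P * real l" using l2 by (intro mult_right_mono) auto
    then show ?thesis using e by (metis One_nat_def Suc_pred less_eq_Suc_le power_Suc2)
  qed
  then show ?thesis using e by (intro that[of e]) auto
qed

lemma card_le_fibres:
  assumes "finite S" "f ` S \<subseteq> B" "finite B" "\<And>b. b \<in> B \<Longrightarrow> card {s \<in> S. f s = b} \<le> D"
  shows "card S \<le> card B * D"
proof -
  have "S = (\<Union>b\<in>B. {s \<in> S. f s = b})" using assms(2) by blast
  then have "card S \<le> (\<Sum>b\<in>B. card {s \<in> S. f s = b})"
    using card_UN_le[OF assms(3), of "\<lambda>b. {s \<in> S. f s = b}"] by simp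
  also have "\<dots> \<le> card B * D" using sum_bounded_above[of B "\<lambda>b. card {s \<in> S. f s = b}" D] assms(4) by simp
  finally show ?thesis .
qed

lemma card_ints_le: "H \<ge> 0 \<Longrightarrow> finite {t::int. real_of_int \<bar>t\<bar> \<le> H} \<and> real (card {t::int. real_of_int \<bar>t\<bar> \<le> H}) \<le> 2 * H + 1"
proof -
  assume H: "H \<ge> 0"
  have "{t::int. real_of_int \<bar>t\<bar> \<le> H} = {-\<lfloor>H\<rfloor>..\<lfloor>H\<rfloor>}"
    by (auto simp: abs_le_iff le_floor_iff minus_le_iff)
  moreover have "real (card {-\<lfloor>H\<rfloor>..\<lfloor>H\<rfloor>}) \<le> 2 * H + 1" using H by simp
  ultimately show ?thesis by simp
qed

section \<open>Counting the admissible parameters of one slice\<close>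

context perm_group_Suc
begin

definition slice_points :: "int poly \<Rightarrow> int poly \<Rightarrow> real \<Rightarrow> int set" where
  "slice_points f\<^sub>0 W H = {t. real_of_int \<bar>t\<bar> \<le> H \<and>
     (\<exists>\<alpha>. extended_roots (Suc m) (f\<^sub>0 + Polynomial.smult t W) \<alpha> \<and>
        (\<forall>k. norm (\<alpha> k) \<le> real (Suc m) * H) \<and> (inj_on \<alpha> {1..Suc m} \<longrightarrow> relperms (Suc m) \<alpha> \<subseteq> G))}"

lemma theta_integral:
  assumes "extended_roots (Suc m) f \<alpha>" "inj_on \<alpha> {1..Suc m}" "relperms (Suc m) \<alpha> \<subseteq> G"
  shows "meval \<alpha> (theta c K G) \<in> \<int>"
proof (rule relperms_invariant_int[OF assms(1,2)])
  fix \<tau> assume "\<tau> \<in> relperms (Suc m) \<alpha>"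
  then have "\<tau> \<in> G" using assms(3) by blast
  then show "meval (\<lambda>k. \<alpha> (\<tau> k)) (theta c K G) = meval \<alpha> (theta c K G)"
    by (simp only: meval_theta_translate[OF G_perms] translate_G)
qed

text \<open>Apart from boundedly many \<open>t\<close>, where the roots or the values of
  \<open>theta\<close> collide, each \<open>t\<close> has its own small prime not dividing the
  derivative of the resolvent. Sorting the \<open>t\<close> by this prime, by \<open>z\<close>
  modulo the prime and by \<open>t\<close> modulo its power gives at most
  \<open>8 * H powr (1/d + \<epsilon>)\<close> classes of bounded size.\<close>

lemma slice_count:
  assumes \<epsilon>: "\<epsilon> > 0"
  shows "\<exists>C>0. \<forall>H\<ge>1. \<forall>W f\<^sub>0 x. germ m W f\<^sub>0 x \<longrightarrow> inj_on (\<lambda>A. meval x (theta c K A)) L \<longrightarrow>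
     real (card (slice_points f\<^sub>0 W H)) \<le> C * H powr (1 / real (card L) + \<epsilon>)"
proof -
  \<comment> \<open>The exponent \<eta> is spent four times: on the prime, on the residue of
    \<open>z\<close>, on the surplus in \<open>P\<close>, and on the overshoot of the prime
    power.\<close>
  define \<eta> where "\<eta> = \<epsilon> / 4"
  have \<eta>: "\<eta> > 0" using \<epsilon> by (simp add: \<eta>_def)
  define d where "d = card L"
  have d: "d \<ge> 1" using card_L_pos by (simp add: d_def)
  define DG where "DG = (\<Prod>A\<in>L - {G}. theta c K G - theta c K A)"
  obtain C1 K1 where C1: "C1 \<ge> 0" "\<And>(\<rho> :: nat \<Rightarrow> complex) B. B \<ge> 1 \<Longrightarrow> (\<forall>k. norm (\<rho> k) \<le> B) \<Longrightarrow> norm (meval \<rho> (theta c K G)) \<le> C1 * B ^ K1"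
    using meval_size_bound[of "theta c K G"] by blast
  obtain C2 K2 where C2: "C2 \<ge> 0" "\<And>(\<rho> :: nat \<Rightarrow> complex) B. B \<ge> 1 \<Longrightarrow> (\<forall>k. norm (\<rho> k) \<le> B) \<Longrightarrow> norm (meval \<rho> DG) \<le> C2 * B ^ K2"
    using meval_size_bound[of DG] by blast
  let ?n = "real (Suc m)"
  define C3 where "C3 = C1 * ?n ^ K1 + 2"
  obtain J H1 where J: "J \<ge> 1" and H1: "H1 \<ge> 1" and ineq: "\<And>H Z T q. H \<ge> H1 \<Longrightarrow> Z \<ge> 1 \<Longrightarrow> T \<ge> 1 \<Longrightarrow> real Z \<le> C3 * H ^ K1 \<Longrightarrow> real T \<le> H \<Longrightarrow>
     H powr (1 / real d + \<eta>) \<le> real q \<Longrightarrow>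
     large_modulus d J Z T q"
    using determinant_inequality_eventually[OF d \<eta>, of C3 K1] C1 by (auto simp: C3_def)
  obtain H2 where H2: "H2 \<ge> 1" and pr: "\<And>H A. H \<ge> H2 \<Longrightarrow> A \<noteq> 0 \<Longrightarrow> real_of_int \<bar>A\<bar> \<le> (C2 * ?n ^ K2) * H ^ K2 \<Longrightarrow>
    \<exists>l::nat. prime l \<and> l \<le> nat \<lfloor>H powr \<eta>\<rfloor> \<and> \<not> int l dvd A"
    using small_prime_not_dvd_eventually[OF \<eta>, of "C2 * ?n ^ K2" K2] C2(1) by auto
  let ?p = "\<lambda>_::nat. 0::int" and ?R0 = "resolvent_disc c K" and ?R1 = "discriminant (Suc m)"
  obtain D0 where D0: "\<And>W f\<^sub>0 x p. germ m W f\<^sub>0 x \<Longrightarrow> meval (extend_params (Suc m) x fls_X_inv p) ?R0 \<noteq> 0 \<Longrightarrow>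
     finite (slice_zeros m W f\<^sub>0 p ?R0) \<and> card (slice_zeros m W f\<^sub>0 p ?R0) \<le> D0"
    using slice_zeros_bounded[OF symm_resolvent_disc[of c K]] by blast
  obtain D1 where D1: "\<And>W f\<^sub>0 x p. germ m W f\<^sub>0 x \<Longrightarrow> meval (extend_params (Suc m) x fls_X_inv p) ?R1 \<noteq> 0 \<Longrightarrow>
     finite (slice_zeros m W f\<^sub>0 p ?R1) \<and> card (slice_zeros m W f\<^sub>0 p ?R1) \<le> D1"
    using slice_zeros_bounded[OF symm_discriminant[of "Suc m"]] by blast
  obtain D2 where D2: "\<And>W f\<^sub>0 x S z l e Z T. germ m W f\<^sub>0 x \<Longrightarrow> inj_on (\<lambda>A. meval x (theta c K A)) L \<Longrightarrow>
     prime l \<Longrightarrow> e \<ge> 1 \<Longrightarrow> Z \<ge> 1 \<Longrightarrow> T \<ge> 1 \<Longrightarrow> J \<ge> 1 \<Longrightarrow> large_modulus (card L) J Z T (l ^ e) \<Longrightarrow>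
     (\<forall>t\<in>S. class_point c K W f\<^sub>0 l Z T (z t) t) \<Longrightarrow>
     (\<forall>s\<in>S. \<forall>t\<in>S. int l dvd z s - z t \<and> int (l ^ e) dvd s - t) \<Longrightarrow>
     card S \<le> D2"
    using class_bounded[of c K J] by blast
  define H0 where "H0 = max H1 H2"
  \<comment> \<open>\<open>2 * H0 + 1\<close> covers small \<open>H\<close> trivially,
    \<open>D0\<close> and \<open>D1\<close> the collisions, and \<open>8 * D2\<close> the
    classes.\<close>
  define C where "C = 2 * H0 + 1 + real D0 + real D1 + 8 * real D2"
  have H01: "H0 \<ge> 1" using H1 by (simp add: H0_def)
  show ?thesis
  proof (intro exI[of _ C] conjI allI impI)
    show "C > 0" using H01 by (simp add: C_def add_pos_nonneg)
    fix H :: real and W f\<^sub>0 :: "int poly" and x :: "nat \<Rightarrow> complex fls"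
    assume Hge1: "1 \<le> H" and x: "germ m W f\<^sub>0 x" and sep: "inj_on (\<lambda>A. meval x (theta c K A)) L"
    let ?S = "slice_points f\<^sub>0 W H" and ?E = "H powr (1 / real (card L) + \<epsilon>)"
    have E1: "?E \<ge> 1" using Hge1 \<epsilon> by (intro ge_one_powr_ge_zero) (auto intro: add_nonneg_nonneg)
    have finI: "finite {t::int. real_of_int \<bar>t\<bar> \<le> H}" and cI: "real (card {t::int. real_of_int \<bar>t\<bar> \<le> H}) \<le> 2 * H + 1"
      using card_ints_le[of H] Hge1 by auto
    have SI: "?S \<subseteq> {t. real_of_int \<bar>t\<bar> \<le> H}" by (auto simp: slice_points_def)
    have finS: "finite ?S" by (rule finite_subset[OF SI finI])
    show "real (card ?S) \<le> C * ?E"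
    proof (cases "H < H0")
      case True
      have "real (card ?S) \<le> 2 * H + 1" using card_mono[OF finI SI] cI by linarith
      also have "\<dots> \<le> C" using True by (simp add: C_def)
      also have "\<dots> \<le> C * ?E" using E1 H01 by (simp add: C_def)
      finally show ?thesis .
    next
      case False
      then have HH1: "H \<ge> H1" and HH2: "H \<ge> H2" by (auto simp: H0_def)
      have injx: "inj_on x {1..Suc m}" using x by (simp add: germ_def)
      let ?Z0 = "slice_zeros m W f\<^sub>0 ?p ?R0" and ?Z1 = "slice_zeros m W f\<^sub>0 ?p ?R1"
      have evd: "meval (extend_params (Suc m) y s ?p) (resolvent_disc c K) = (\<Prod>A\<in>L. \<Prod>B\<in>L - {A}. meval y (theta c K A) - meval y (theta c K B))"
        for y :: "nat \<Rightarrow> 'b::comm_ring_1" and s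
        unfolding resolvent_disc_def meval_prod meval_diff
        by (intro prod.cong refl) (simp only: meval_theta_extend_params DiffD1)
      have "meval (extend_params (Suc m) x fls_X_inv ?p) (resolvent_disc c K) \<noteq> 0"
        unfolding evd using sep by (auto simp: prod_zero_iff dest: inj_onD)
      from D0[OF x this] have Z0: "finite ?Z0" "card ?Z0 \<le> D0" by auto
      have ij: "inj_on (extend_params (Suc m) y s ?p) {1..Suc m} \<longleftrightarrow> inj_on y {1..Suc m}" for y :: "nat \<Rightarrow> 'b::comm_ring_1" and s
        by (intro inj_on_cong) (auto simp: extend_params_def)
      have "meval (extend_params (Suc m) x fls_X_inv ?p) (discriminant (Suc m)) \<noteq> 0"
        unfolding meval_discriminant ij using injx by blast
      from D1[OF x this] have Z1: "finite ?Z1" "card ?Z1 \<le> D1" by auto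
      define S' where "S' = ?S - ?Z0 - ?Z1"
      define y where "y = nat \<lfloor>H powr \<eta>\<rfloor>"
      define P where "P = H powr (1 / real d + \<eta>)"
      define Z where "Z = nat \<lceil>C1 * (?n * H) ^ K1\<rceil> + 1"
      define T where "T = nat \<lfloor>H\<rfloor>"
      have P1: "P \<ge> 1" unfolding P_def using Hge1 \<eta> by (intro ge_one_powr_ge_zero) (auto intro: add_nonneg_nonneg)
      have T1: "T \<ge> 1" "real T \<le> H" using Hge1 unfolding T_def by linarith+
      have nH: "?n * H \<ge> 1" using mult_mono[of 1 ?n 1 H] Hge1 by simp
      have Zge: "Z \<ge> 1" by (simp add: Z_def)
      have Zle: "real Z \<le> C3 * H ^ K1"
      proof -
        have "0 \<le> C1 * (?n * H) ^ K1" using C1(1) nH by (intro mult_nonneg_nonneg) auto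
        then have "real Z \<le> C1 * (?n * H) ^ K1 + 2" unfolding Z_def by linarith
        also have "\<dots> = C1 * ?n ^ K1 * H ^ K1 + 2 * 1" by (simp add: power_mult_distrib)
        also have "\<dots> \<le> C1 * ?n ^ K1 * H ^ K1 + 2 * H ^ K1" using Hge1 by (intro add_left_mono mult_left_mono one_le_power) auto
        finally show ?thesis by (simp add: C3_def distrib_right)
      qed
      have "\<exists>z l. prime l \<and> l \<le> y \<and> class_point c K W f\<^sub>0 l Z T z t" if t: "t \<in> S'" for t
      proof -
        obtain \<alpha> where \<alpha>: "extended_roots (Suc m) (f\<^sub>0 + Polynomial.smult t W) \<alpha>" "\<forall>k. norm (\<alpha> k) \<le> ?n * H"
          "inj_on \<alpha> {1..Suc m} \<longrightarrow> relperms (Suc m) \<alpha> \<subseteq> G" and tH: "real_of_int \<bar>t\<bar> \<le> H"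
          using t by (auto simp: S'_def slice_points_def)
        have n0: "meval (extend_params (Suc m) \<alpha> (of_int t) ?p) (resolvent_disc c K) \<noteq> 0"
          using t \<alpha>(1) unfolding S'_def slice_zeros_def by blast
        have n1: "meval (extend_params (Suc m) \<alpha> (of_int t) ?p) (discriminant (Suc m)) \<noteq> 0"
          using t \<alpha>(1) unfolding S'_def slice_zeros_def by blast
        have inj: "inj_on \<alpha> {1..Suc m}" using n1 unfolding meval_discriminant ij by blast
        have "meval \<alpha> (theta c K G) \<in> \<int>" using theta_integral[OF \<alpha>(1) inj] \<alpha>(3) inj by blast
        then obtain z where z: "of_int z = meval \<alpha> (theta c K G)" by (metis Ints_cases)
        \<comment> \<open>This integer is the value of \<open>DG\<close> at the roots: nonzero
          outside the collisions and of polynomial size in \<open>H\<close>, so a small prime misses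
          it.\<close>
        define A where "A = bieval (pderiv (bires c K f\<^sub>0 W)) z t"
        have Aeq: "of_int A = (\<Prod>B\<in>L - {G}. meval \<alpha> (theta c K G) - meval \<alpha> (theta c K B))"
          unfolding A_def by (rule bires_pderiv[OF \<alpha>(1) z])
        also have "\<dots> \<noteq> 0" using n0 G_in_L unfolding evd by (auto simp: prod_zero_iff)
        finally have A0: "A \<noteq> 0" by auto
        have "of_int A = meval \<alpha> DG" unfolding Aeq DG_def by (simp add: meval_hom)
        then have "norm (of_int A :: complex) \<le> C2 * (?n * H) ^ K2" using C2(2)[OF nH \<alpha>(2)] by simp
        then have Ab: "real_of_int \<bar>A\<bar> \<le> (C2 * ?n ^ K2) * H ^ K2" by (simp add: power_mult_distrib mult.assoc)
        obtain l where l: "prime l" "l \<le> y" "\<not> int l dvd A" using pr[OF HH2 A0 Ab] by (auto simp: y_def)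
        have "norm (of_int z :: complex) \<le> C1 * (?n * H) ^ K1" using C1(2)[OF nH \<alpha>(2)] z by simp
        then have "real_of_int \<bar>z\<bar> \<le> C1 * (?n * H) ^ K1" by simp
        then have "\<bar>z\<bar> \<le> int Z" unfolding Z_def by linarith
        moreover have "\<bar>t\<bar> \<le> int T" using tH unfolding T_def by linarith
        ultimately show ?thesis using l \<alpha>(1) z unfolding A_def class_point_def by blast
      qed
      then obtain z l where zl: "\<And>t. t \<in> S' \<Longrightarrow> prime (l t) \<and> l t \<le> y \<and> class_point c K W f\<^sub>0 (l t) Z T (z t) t"
        by metis
      have "\<exists>e. prime l \<longrightarrow> e \<ge> 1 \<and> P \<le> real (l ^ e) \<and> real (l ^ e) \<le> P * real l" for l :: nat
        using prime_power_between[OF P1] by metis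
      then obtain e where e: "\<And>l::nat. prime l \<Longrightarrow> e l \<ge> 1 \<and> P \<le> real (l ^ e l) \<and> real (l ^ e l) \<le> P * real l"
        by metis
      \<comment> \<open>The exponent depends on the prime alone, so equal values of \<open>f\<close>
        mean congruence modulo the same prime and the same prime power.\<close>
      define f where "f t = (l t, z t mod int (l t), t mod int (l t ^ e (l t)))" for t
      define B where "B = {..y} \<times> {0..int y} \<times> {0..\<lfloor>P * real y\<rfloor>}"
      have finB: "finite B" by (simp add: B_def)
      have fB: "f ` S' \<subseteq> B"
      proof
        fix b assume "b \<in> f ` S'"
        then obtain t where t: "t \<in> S'" "b = f t" by blast
        have l: "prime (l t)" "l t \<le> y" using zl[OF t(1)] by auto
        then have l0: "l t > 0" by (simp add: prime_gt_0_nat)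
        have "z t mod int (l t) < int (l t)" "z t mod int (l t) \<ge> 0" using l0 by auto
        then have b2: "z t mod int (l t) \<in> {0..int y}" using l by simp
        have q0: "l t ^ e (l t) > 0" using l0 by simp
        have "t mod int (l t ^ e (l t)) < int (l t ^ e (l t))" "t mod int (l t ^ e (l t)) \<ge> 0"
          using q0 by (intro pos_mod_bound pos_mod_sign; simp only: of_nat_0_less_iff)+
        moreover have "real (l t ^ e (l t)) \<le> P * real y"
        proof -
          have "P * real (l t) \<le> P * real y" using l P1 by (intro mult_left_mono) auto
          then show ?thesis using e[OF l(1)] by linarith
        qed
        then have "int (l t ^ e (l t)) \<le> \<lfloor>P * real y\<rfloor>" by (simp only: le_floor_iff of_int_of_nat_eq)
        ultimately show "b \<in> B" using b2 l by (simp add: B_def f_def t)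
      qed
      have finS': "finite S'" using finS by (simp add: S'_def)
      have fibre: "card {t \<in> S'. f t = b} \<le> D2" for b
      proof (cases "{t \<in> S'. f t = b} = {}")
        case False
        then obtain t0 where t0: "t0 \<in> S'" "f t0 = b" by blast
        have pl: "prime (l t0)" using zl[OF t0(1)] by blast
        have lt: "l t = l t0" if "t \<in> {t \<in> S'. f t = b}" for t using that t0 by (auto simp: f_def)
        have iq: "large_modulus (card L) J Z T (l t0 ^ e (l t0))"
          using ineq[OF HH1 Zge T1(1) Zle T1(2), of "l t0 ^ e (l t0)"] e[OF pl] unfolding P_def d_def by blast
        have e1: "e (l t0) \<ge> 1" using e[OF pl] by blast
        show ?thesis
        proof (rule D2[OF x sep pl e1 Zge T1(1) J iq, where z = z])
          show "\<forall>t\<in>{t \<in> S'. f t = b}. class_point c K W f\<^sub>0 (l t0) Z T (z t) t"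
          proof
            fix t assume t: "t \<in> {t \<in> S'. f t = b}"
            then have "t \<in> S'" by blast
            from zl[OF this] show "class_point c K W f\<^sub>0 (l t0) Z T (z t) t" unfolding lt[OF t] by blast
          qed
          show "\<forall>s\<in>{t \<in> S'. f t = b}. \<forall>t\<in>{t \<in> S'. f t = b}. int (l t0) dvd z s - z t \<and> int (l t0 ^ e (l t0)) dvd s - t"
          proof (intro ballI)
            fix s t assume st: "s \<in> {t \<in> S'. f t = b}" "t \<in> {t \<in> S'. f t = b}"
            then have "f s = f t" by simp
            then have "z s mod int (l t0) = z t mod int (l t0)" "s mod int (l t0 ^ e (l t0)) = t mod int (l t0 ^ e (l t0))"
              unfolding f_def lt[OF st(1)] lt[OF st(2)] by blast+
            then show "int (l t0) dvd z s - z t \<and> int (l t0 ^ e (l t0)) dvd s - t" by (simp only: mod_eq_dvd_iff)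
          qed
        qed
      next
        case True
        then show ?thesis by (simp only: card.empty)
      qed
      have cS': "card S' \<le> card B * D2" by (rule card_le_fibres[OF finS' fB finB fibre])
      have cB: "real (card B) \<le> 8 * ?E"
      proof -
        have Hp1: "H powr \<eta> \<ge> 1" using Hge1 \<eta> by (intro ge_one_powr_ge_zero) auto
        have y1: "real y \<le> H powr \<eta>" unfolding y_def using Hp1 by linarith
        have y2: "real (y + 1) \<le> 2 * H powr \<eta>" using y1 Hp1 by simp
        have Py: "1 \<le> P * H powr \<eta>" using mult_mono[of 1 P 1 "H powr \<eta>"] P1 Hp1 by simp
        have "P * real y \<ge> 0" "P * real y \<le> P * H powr \<eta>" using P1 y1 by (auto intro: mult_left_mono)
        then have fl: "real (nat (\<lfloor>P * real y\<rfloor> + 1)) \<le> 2 * (P * H powr \<eta>)" using Py by linarith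
        have "real (card B) = real (y + 1) * (real (y + 1) * real (nat (\<lfloor>P * real y\<rfloor> + 1)))"
          by (simp add: B_def card_cartesian_product nat_add_distrib algebra_simps)
        also have "\<dots> \<le> (2 * H powr \<eta>) * ((2 * H powr \<eta>) * (2 * (P * H powr \<eta>)))"
          using y2 fl Hp1 by (intro mult_mono) auto
        also have "\<dots> = 8 * (H powr \<eta> * H powr \<eta> * H powr \<eta> * P)" by simp
        also have "H powr \<eta> * H powr \<eta> * H powr \<eta> * P = H powr (\<eta> + \<eta> + \<eta> + (1 / real d + \<eta>))"
          by (simp only: P_def powr_add)
        also have "\<eta> + \<eta> + \<eta> + (1 / real d + \<eta>) = 1 / real (card L) + \<epsilon>" by (simp add: \<eta>_def d_def)
        finally show ?thesis .
      qed
      have "?S \<subseteq> S' \<union> (?Z0 \<union> ?Z1)" unfolding S'_def by blast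
      then have "card ?S \<le> card (S' \<union> (?Z0 \<union> ?Z1))" using finS' Z0 Z1 by (intro card_mono) auto
      also have "\<dots> \<le> card S' + (card ?Z0 + card ?Z1)"
        by (rule order_trans[OF card_Un_le add_left_mono[OF card_Un_le]])
      finally have "card ?S \<le> card B * D2 + (D0 + D1)" using cS' Z0 Z1 by linarith
      then have "real (card ?S) \<le> real (card B) * real D2 + (real D0 + real D1)"
        by (metis (mono_tags) of_nat_add of_nat_le_iff of_nat_mult)
      also have "\<dots> \<le> (8 * ?E) * real D2 + (real D0 + real D1) * ?E"
        using cB E1 by (intro add_mono mult_right_mono) (auto intro: mult_right_mono simp: mult_le_cancel_left1)
      also have "\<dots> \<le> C * ?E"
      proof -
        have "0 \<le> (2 * H0 + 1) * ?E" using H01 by (intro mult_nonneg_nonneg) auto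
        then show ?thesis by (simp add: C_def algebra_simps)
      qed
      finally show ?thesis .
    qed
  qed
qed

end

section \<open>Counting in the box\<close>

lemma coeff_monic_poly:
  "Polynomial.coeff (monic_poly n a) j = (if j = n then 1 else if j < n then a (n - j) else 0)"
proof -
  have "Polynomial.coeff (monic_poly n a) j = (if n = j then 1 else 0) + (\<Sum>i=1..n. if n - i = j then a i else 0)"
    by (simp add: monic_poly_def coeff_sum)
  also have "(\<Sum>i=1..n. if n - i = j then a i else 0) = (if j < n then a (n - j) else 0)"
  proof (cases "j < n")
    case True
    have "(\<Sum>i=1..n. if n - i = j then a i else 0) = (\<Sum>i\<in>{1..n}. if i = n - j then a i else 0)"
      by (intro sum.cong refl) (use True in auto)
    then show ?thesis using True by simp
  next
    case False
    then show ?thesis by (intro sum.neutral[THEN trans]) auto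
  qed
  finally show ?thesis by auto
qed

lemma ipeval_monom: "ipeval (Polynomial.monom a k) y = of_int a * y ^ k"
  by (simp add: ipeval_def map_poly_monom poly_monom)

text \<open>If \<open>norm z > n * H \<ge> 1\<close>, the leading term outweighs the
  \<open>n\<close> others, each at most \<open>H * norm z ^ (n - 1)\<close>.\<close>

lemma monic_poly_root_bound:
  assumes a: "\<forall>i\<in>{1..n}. \<bar>real_of_int (a i)\<bar> \<le> H" and H: "H \<ge> 1" and n: "n \<ge> 1"
    and r: "extended_roots n (monic_poly n a) \<alpha>"
  shows "norm (\<alpha> k) \<le> real n * H"
proof (cases "k \<in> {1..n}")
  case True
  define z where "z = \<alpha> k"
  have nH: "1 \<le> real n * H" using mult_mono[of 1 "real n" 1 H] n H by simp
  have "ipeval (monic_poly n a) z = 0"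
    using True by (auto simp: ipeval_rootpoly[OF r] prod_zero_iff z_def)
  then have "z ^ n = - (\<Sum>i=1..n. of_int (a i) * z ^ (n - i))"
    by (simp add: monic_poly_def ipeval_add ipeval_sum ipeval_monom eq_neg_iff_add_eq_0)
  then have "norm z ^ n = norm (\<Sum>i=1..n. of_int (a i) * z ^ (n - i))"
    by (metis norm_minus_cancel norm_power)
  also have "\<dots> \<le> (\<Sum>i=1..n. \<bar>real_of_int (a i)\<bar> * norm z ^ (n - i))"
    by (rule order_trans[OF norm_sum]) (simp add: norm_mult norm_power)
  finally have le: "norm z ^ n \<le> (\<Sum>i=1..n. \<bar>real_of_int (a i)\<bar> * norm z ^ (n - i))" .
  have "norm z \<le> real n * H"
  proof (rule ccontr)
    assume neg: "\<not> ?thesis"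
    then have z1: "norm z \<ge> 1" using nH by linarith
    have "(\<Sum>i=1..n. \<bar>real_of_int (a i)\<bar> * norm z ^ (n - i)) \<le> (\<Sum>i=1..n. H * norm z ^ (n - 1))"
      using a z1 H by (intro sum_mono mult_mono power_increasing) auto
    also have "\<dots> = (real n * H) * norm z ^ (n - 1)" by simp
    also have "\<dots> < norm z * norm z ^ (n - 1)"
      using neg z1 by (intro mult_strict_right_mono zero_less_power) auto
    also have "\<dots> = norm z ^ n" using n by (metis One_nat_def Suc_pred less_eq_Suc_le power_Suc)
    finally show False using le by linarith
  qed
  then show ?thesis by (simp add: z_def)
next
  case False
  then have "\<alpha> k = 0" using r by (simp add: extended_roots_def)
  then show ?thesis using H by simp
qed

lemma extended_roots_exist:
  assumes "Polynomial.degree f = n" "Polynomial.coeff f n = 1"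
  obtains \<alpha> where "extended_roots n f \<alpha>"
proof -
  let ?F = "map_poly of_int f :: complex poly"
  have F0: "?F \<noteq> 0" using assms by auto
  have lc: "lead_coeff ?F = 1" using assms by (simp add: coeff_map_poly)
  obtain A where A: "size A = Polynomial.degree ?F" "?F = Polynomial.smult (lead_coeff ?F) (\<Prod>x\<in>#A. [:-x, 1:])"
    using alg_closed_imp_factorization[OF F0] by blast
  obtain xs where xs: "mset xs = A" using ex_mset by blast
  have len: "length xs = n" using A(1) xs assms by (metis degree_of_int_poly size_mset)
  define \<alpha> where "\<alpha> k = (if k \<in> {1..n} then xs ! (k - 1) else 0)" for k
  have "(\<Prod>x\<in>#A. [:-x, 1:]) = (\<Prod>x\<leftarrow>xs. [:-x, 1:])" unfolding xs[symmetric] by (simp add: prod_mset_prod_list flip: mset_map)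
  also have "\<dots> = (\<Prod>i<n. [:- (xs ! i), 1:])" by (simp add: prod.list_conv_set_nth len atLeast0LessThan)
  also have "\<dots> = (\<Prod>i=1..n. [:- \<alpha> i, 1:])"
    by (rule prod.reindex_bij_witness[of _ "\<lambda>i. i - 1" Suc]) (auto simp: \<alpha>_def)
  finally have "?F = (\<Prod>i=1..n. [:- \<alpha> i, 1:])" using A(2) lc by simp
  then have "extended_roots n f \<alpha>" by (simp add: extended_roots_def root_labelling_def \<alpha>_def)
  then show ?thesis by (rule that)
qed

definition good_tuples :: "nat \<Rightarrow> real \<Rightarrow> (nat \<Rightarrow> nat) set \<Rightarrow> (nat \<Rightarrow> int) set" where
  "good_tuples n H G = {a \<in> {1..n} \<rightarrow>\<^sub>E UNIV. (\<forall>i\<in>{1..n}. \<bar>real_of_int (a i)\<bar> \<le> H) \<and>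
     (\<exists>\<alpha>. extended_roots n (monic_poly n a) \<alpha> \<and> (inj_on \<alpha> {1..n} \<longrightarrow> relperms n \<alpha> \<subseteq> G))}"

lemma card_box:
  fixes I :: "nat set"
  assumes "finite I" "H \<ge> 0"
  shows "finite {a \<in> I \<rightarrow>\<^sub>E (UNIV :: int set). \<forall>i\<in>I. \<bar>real_of_int (a i)\<bar> \<le> H}"
    "real (card {a \<in> I \<rightarrow>\<^sub>E (UNIV :: int set). \<forall>i\<in>I. \<bar>real_of_int (a i)\<bar> \<le> H}) \<le> (2 * H + 1) ^ card I"
proof -
  have eq: "{a \<in> I \<rightarrow>\<^sub>E (UNIV :: int set). \<forall>i\<in>I. \<bar>real_of_int (a i)\<bar> \<le> H} = (\<Pi>\<^sub>E i\<in>I. {t::int. real_of_int \<bar>t\<bar> \<le> H})"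
    by (auto simp: PiE_def Pi_def)
  show "finite {a \<in> I \<rightarrow>\<^sub>E (UNIV :: int set). \<forall>i\<in>I. \<bar>real_of_int (a i)\<bar> \<le> H}"
    unfolding eq using card_ints_le[OF assms(2)] assms(1) by (intro finite_PiE) auto
  have "real (card {a \<in> I \<rightarrow>\<^sub>E (UNIV :: int set). \<forall>i\<in>I. \<bar>real_of_int (a i)\<bar> \<le> H}) = real (card {t::int. real_of_int \<bar>t\<bar> \<le> H}) ^ card I"
    unfolding eq by (simp add: card_PiE assms)
  also have "\<dots> \<le> (2 * H + 1) ^ card I" using card_ints_le[OF assms(2)] by (intro power_mono) auto
  finally show "real (card {a \<in> I \<rightarrow>\<^sub>E (UNIV :: int set). \<forall>i\<in>I. \<bar>real_of_int (a i)\<bar> \<le> H}) \<le> (2 * H + 1) ^ card I" .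
qed

lemma finite_good_tuples: "H \<ge> 0 \<Longrightarrow> finite (good_tuples n H G)"
  by (rule finite_subset[OF _ card_box(1)[of "{1..n}" H]]) (auto simp: good_tuples_def)

definition full_poly :: "nat \<Rightarrow> int poly \<Rightarrow> (nat \<Rightarrow> complex) \<Rightarrow> bool" where
  "full_poly m W \<beta> \<longleftrightarrow> extended_roots m W \<beta> \<and> inj_on \<beta> {1..m} \<and> relperms m \<beta> = perms m"

lemma meval_ipeval: "meval \<rho> (ipeval f P) = ipeval f (meval \<rho> P)"
  by (induction f) (simp_all add: ipeval_pCons meval_hom)

text \<open>Transpositions carry one common root to all roots of \<open>W\<close>, so
  \<open>W\<close> divides \<open>f\<^sub>0\<close>. The cofactor is monic and linear, and the
  vanishing second coefficient of \<open>f\<^sub>0\<close> determines it.\<close>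

lemma full_poly_common_root:
  assumes W: "full_poly m W \<beta>" and m: "m \<ge> 1"
    and f0: "Polynomial.degree f\<^sub>0 = Suc m" "Polynomial.coeff f\<^sub>0 (Suc m) = 1" "Polynomial.coeff f\<^sub>0 m = 0"
    and j: "j \<in> {1..m}" "ipeval f\<^sub>0 (\<beta> j) = 0"
  shows "f\<^sub>0 = W * [:- Polynomial.coeff W (m - 1), 1:]"
proof -
  have roots: "extended_roots m W \<beta>" and inj: "inj_on \<beta> {1..m}" and full: "relperms m \<beta> = perms m"
    using W by (auto simp: full_poly_def)
  note Wm = extended_roots_monic[OF roots]
  have all: "ipeval f\<^sub>0 (\<beta> i) = 0" if i: "i \<in> {1..m}" for i
  proof -
    let ?t = "Transposition.transpose j i"
    have "?t permutes {1..m}" using i j by (intro permutes_swap_id)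
    then have "?t \<in> relperms m \<beta>" by (simp add: full)
    moreover have "meval \<beta> (ipeval f\<^sub>0 (mvar j)) = 0" by (simp add: meval_ipeval j)
    ultimately have "meval (\<lambda>k. \<beta> (?t k)) (ipeval f\<^sub>0 (mvar j)) = 0" unfolding relperms_def by blast
    then show ?thesis by (simp add: meval_ipeval)
  qed
  define c where "c = - Polynomial.coeff W (m - 1)"
  define D where "D = f\<^sub>0 - W * [:c, 1:]"
  have cW: "Polynomial.coeff (W * [:c, 1:]) k = c * Polynomial.coeff W k + (case k of 0 \<Rightarrow> 0 | Suc i \<Rightarrow> Polynomial.coeff W i)" for k
    by (simp add: coeff_pCons mult.commute[of W] split: nat.split)
  have "Polynomial.coeff D k = 0" if k: "k \<ge> m" for k
  proof -
    have W0: "Polynomial.coeff W i = 0" if "i > m" for i using that Wm by (intro coeff_eq_0) simp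
    consider (a) "k = m" | (b) "k = Suc m" | (c) "k > Suc m" using k by linarith
    then show ?thesis
    proof cases
      case a
      obtain m' where m': "m = Suc m'" using m by (cases m) auto
      then have "Polynomial.coeff W (Suc m') = 1" using Wm by simp
      then show ?thesis unfolding D_def Polynomial.coeff_diff cW a f0(3) using m' by (simp add: c_def)
    next
      case b
      then show ?thesis using f0 Wm W0[of "Suc m"] unfolding D_def Polynomial.coeff_diff cW by simp
    next
      case c
      have "Polynomial.coeff f\<^sub>0 k = 0" using c f0 by (intro coeff_eq_0) simp
      moreover obtain k' where "k = Suc k'" using c by (cases k) auto
      ultimately show ?thesis using c W0 unfolding D_def Polynomial.coeff_diff cW by simp
    qed
  qed
  then have dD: "Polynomial.degree D < m" using m by (cases "D = 0") (auto intro: degree_lessI)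
  have rt: "ipeval D (\<beta> i) = 0" if i: "i \<in> {1..m}" for i
  proof -
    have "ipeval W (\<beta> i) = 0" using i by (auto simp: ipeval_rootpoly[OF roots] prod_zero_iff)
    then show ?thesis using all[OF i] by (simp add: D_def ipeval_diff ipeval_add ipeval_smult ipeval_pCons)
  qed
  have "map_poly of_int D = (0 :: complex poly)"
    using dD rt inj by (intro poly_eq_0_of_roots[of "{1..m}" _ \<beta>]) (auto simp: ipeval_def)
  then have "D = 0" by simp
  then show ?thesis by (simp add: D_def c_def)
qed

text \<open>There are \<open>O(H ^ m)\<close> base points \<open>f\<^sub>0\<close>, each with the
  slice bound. For the single base point divisible by \<open>W\<close> the trivial bound
  \<open>3 * H\<close> suffices, since \<open>m \<ge> 1\<close>.\<close>

lemma good_tuples_count_Suc: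
  assumes m: "m \<ge> 1" and W: "full_poly m W \<beta>" and G: "subgroup G (sym_group (Suc m))" and \<epsilon>: "\<epsilon> > 0"
  shows "\<exists>C>0. \<forall>H\<ge>1. real (card (good_tuples (Suc m) H G)) \<le> C * H powr (real m + 1 / real (sym_index (Suc m) G) + \<epsilon>)"
proof -
  interpret perm_group_Suc m G by (intro perm_group_Suc.intro perm_group.intro G)
  have roots: "extended_roots m W \<beta>" and inj: "inj_on \<beta> {1..m}" and full: "relperms m \<beta> = perms m"
    using W by (auto simp: full_poly_def)
  note Wm = extended_roots_monic[OF roots]
  have "\<exists>C>0. \<forall>H\<ge>1. \<forall>W f\<^sub>0 x. germ m W f\<^sub>0 x \<longrightarrow> inj_on (\<lambda>A. meval x (theta c K A)) L \<longrightarrow>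
     real (card (slice_points f\<^sub>0 W H)) \<le> C * H powr (1 / real (card L) + \<epsilon>)" for c K
    by (rule slice_count[OF \<epsilon>])
  then obtain Cf where Cf0: "\<And>c K. Cf c K > (0::real)" and Cf: "\<And>c K H W f\<^sub>0 x. H \<ge> 1 \<Longrightarrow> germ m W f\<^sub>0 x \<Longrightarrow>
      inj_on (\<lambda>A. meval x (theta c K A)) L \<Longrightarrow> real (card (slice_points f\<^sub>0 W H)) \<le> Cf c K * H powr (1 / real (card L) + \<epsilon>)"
    by metis
  \<comment> \<open>One constant for all admissible parameter pairs, whichever of them a slice
    requires.\<close>
  define C0 where "C0 = (\<Sum>c\<le>param_bound. \<Sum>K\<le>param_bound. Cf c K)"
  have CfC0: "Cf c K \<le> C0" if "c \<le> param_bound" "K \<le> param_bound" for c K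
  proof -
    have nn: "0 \<le> (\<Sum>K\<le>param_bound. Cf c K)" for c by (intro sum_nonneg less_imp_le Cf0)
    have "Cf c K \<le> (\<Sum>K\<le>param_bound. Cf c K)"
      using that less_imp_le[OF Cf0] by (intro member_le_sum) auto
    also have "\<dots> \<le> C0" unfolding C0_def
      by (rule member_le_sum[of c "{..param_bound}" "\<lambda>c. \<Sum>K\<le>param_bound. Cf c K"]) (use that nn in simp_all)
    finally show ?thesis .
  qed
  have C00: "C0 > 0" using CfC0[of 0 0] Cf0[of 0 0] by linarith
  \<comment> \<open>Subtracting \<open>a 1 * W\<close> enlarges the coefficients by a factor of at
    most \<open>w\<close>.\<close>
  define w where "w = 1 + (\<Sum>k\<le>m. \<bar>real_of_int (Polynomial.coeff W k)\<bar>)"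
  have w: "1 + \<bar>real_of_int (Polynomial.coeff W k)\<bar> \<le> w" if "k \<le> m" for k
    unfolding w_def
    by (rule add_left_mono, rule member_le_sum[of k "{..m}" "\<lambda>k. \<bar>real_of_int (Polynomial.coeff W k)\<bar>"]) (use that in simp_all)
  have w1: "w \<ge> 1" by (simp add: w_def sum_nonneg)
  define C where "C = (2 * w + 1) ^ m * C0 + 3"
  show ?thesis
  proof (intro exI[of _ C] conjI allI impI)
    show "C > 0" using C00 w1 by (simp add: C_def add_nonneg_pos)
    fix H :: real assume H: "H \<ge> 1"
    define E where "E = H powr (1 / real (card L) + \<epsilon>)"
    have E1: "E \<ge> 1" unfolding E_def using H \<epsilon> by (intro ge_one_powr_ge_zero) (auto intro: add_nonneg_nonneg)
    define F where "F = {f::int poly. Polynomial.coeff f (Suc m) = 1 \<and> Polynomial.coeff f m = 0 \<and>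
      (\<forall>k>Suc m. Polynomial.coeff f k = 0) \<and> (\<forall>k<m. \<bar>real_of_int (Polynomial.coeff f k)\<bar> \<le> w * H)}"
    define Bx where "Bx = {a \<in> {..<m} \<rightarrow>\<^sub>E (UNIV :: int set). \<forall>i\<in>{..<m}. \<bar>real_of_int (a i)\<bar> \<le> w * H}"
    have wH: "w * H \<ge> 1" using mult_mono[of 1 w 1 H] w1 H by simp
    have Bx: "finite Bx" "real (card Bx) \<le> (2 * (w * H) + 1) ^ m"
      unfolding Bx_def using card_box[of "{..<m}" "w * H"] wH by auto
    let ?r = "\<lambda>f. restrict (Polynomial.coeff f) {..<m}"
    have injr: "inj_on ?r F"
    proof (rule inj_onI)
      fix f f' assume ff: "f \<in> F" "f' \<in> F" "?r f = ?r f'"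
      have "Polynomial.coeff f k = Polynomial.coeff f' k" for k
      proof -
        consider "k < m" | "k = m" | "k = Suc m" | "k > Suc m" by linarith
        then show ?thesis
        proof cases
          case 1
          then show ?thesis using fun_cong[OF ff(3), of k] by simp
        qed (use ff in \<open>auto simp: F_def\<close>)
      qed
      then show "f = f'" by (intro poly_eqI)
    qed
    have rF: "?r ` F \<subseteq> Bx"
    proof (rule image_subsetI)
      fix f assume f: "f \<in> F"
      have "?r f \<in> {..<m} \<rightarrow>\<^sub>E UNIV" unfolding restrict_PiE_iff by simp
      moreover have "\<forall>i\<in>{..<m}. \<bar>real_of_int (?r f i)\<bar> \<le> w * H" using f by (simp add: F_def)
      ultimately show "?r f \<in> Bx" unfolding Bx_def by blast
    qed
    have finF: "finite F" using finite_imageD[OF finite_subset[OF rF Bx(1)] injr] .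
    have cF: "real (card F) \<le> ((2 * w + 1) * H) ^ m"
    proof -
      have "card F \<le> card Bx" using card_inj_on_le[OF injr rF Bx(1)] .
      then have "real (card F) \<le> real (card Bx)" by (rule of_nat_mono)
      also have "\<dots> \<le> (2 * (w * H) + 1) ^ m" by (rule Bx(2))
      also have "\<dots> \<le> ((2 * w + 1) * H) ^ m"
      proof (rule power_mono)
        show "2 * (w * H) + 1 \<le> (2 * w + 1) * H" using H by (simp add: algebra_simps)
        show "0 \<le> 2 * (w * H) + 1" using wH by linarith
      qed
      finally show ?thesis .
    qed
    define bad where "bad = W * [:- Polynomial.coeff W (m - 1), 1:]"
    have finI: "finite {t::int. real_of_int \<bar>t\<bar> \<le> H}" and cI: "real (card {t::int. real_of_int \<bar>t\<bar> \<le> H}) \<le> 2 * H + 1"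
      using card_ints_le[of H] H by auto
    have sub: "slice_points f\<^sub>0 W H \<subseteq> {t. real_of_int \<bar>t\<bar> \<le> H}" for f\<^sub>0 by (auto simp: slice_points_def)
    have finsp: "finite (slice_points f\<^sub>0 W H)" for f\<^sub>0 by (rule finite_subset[OF sub finI])
    have spbad: "real (card (slice_points f\<^sub>0 W H)) \<le> 3 * H" for f\<^sub>0
      using card_mono[OF finI sub[of f\<^sub>0]] cI H by linarith
    have spgood: "real (card (slice_points f\<^sub>0 W H)) \<le> C0 * E" if f: "f\<^sub>0 \<in> F" "f\<^sub>0 \<noteq> bad" for f\<^sub>0
    proof -
      have c: "Polynomial.coeff f\<^sub>0 (Suc m) = 1" "Polynomial.coeff f\<^sub>0 m = 0" "\<And>k. k > Suc m \<Longrightarrow> Polynomial.coeff f\<^sub>0 k = 0"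
        using f(1) by (auto simp: F_def)
      have "Polynomial.degree f\<^sub>0 \<le> Suc m" using c(3) by (intro degree_le) auto
      moreover have "Suc m \<le> Polynomial.degree f\<^sub>0" using c(1) by (intro le_degree) simp
      ultimately have deg: "Polynomial.degree f\<^sub>0 = Suc m" by simp
      have sl: "slice m W f\<^sub>0 \<beta>"
      proof
        show "ipeval f\<^sub>0 (\<beta> j) \<noteq> 0" if "j \<in> {1..m}" for j
          using full_poly_common_root[OF W m deg c(1,2) that] f(2) by (auto simp: bad_def)
      qed (use m roots inj full deg c in auto)
      obtain x where x: "germ m W f\<^sub>0 x" using slice.germ_x[OF sl] by blast
      have "inj_on x {1..Suc m}" using x by (simp add: germ_def)
      then obtain c K where cK: "c \<le> param_bound" "K \<le> param_bound" "inj_on (\<lambda>A. meval x (theta c K A)) L"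
        by (rule good_params) blast
      have "real (card (slice_points f\<^sub>0 W H)) \<le> Cf c K * E" unfolding E_def by (rule Cf[OF H x cK(3)])
      also have "\<dots> \<le> C0 * E" using CfC0[OF cK(1,2)] E1 by (intro mult_right_mono) auto
      finally show ?thesis .
    qed
    \<comment> \<open>\<open>a 1\<close> is the second coefficient of the polynomial and
      \<open>W\<close> is monic of degree \<open>m\<close>, so the base point has second coefficient
      0.\<close>
    define \<Phi> where "\<Phi> a = (monic_poly (Suc m) a - Polynomial.smult (a 1) W, a 1)" for a
    have \<Phi>inj: "inj_on \<Phi> (good_tuples (Suc m) H G)"
    proof (rule inj_onI)
      fix a b assume ab: "a \<in> good_tuples (Suc m) H G" "b \<in> good_tuples (Suc m) H G" "\<Phi> a = \<Phi> b"
      then have eq: "monic_poly (Suc m) a = monic_poly (Suc m) b" by (auto simp: \<Phi>_def)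
      have "a i = b i" if i: "i \<in> {1..Suc m}" for i
      proof -
        have "Polynomial.coeff (monic_poly (Suc m) a) (Suc m - i) = a i" "Polynomial.coeff (monic_poly (Suc m) b) (Suc m - i) = b i"
          using i unfolding coeff_monic_poly by auto
        then show ?thesis using eq by simp
      qed
      moreover have "a \<in> {1..Suc m} \<rightarrow>\<^sub>E UNIV" "b \<in> {1..Suc m} \<rightarrow>\<^sub>E UNIV" using ab by (auto simp: good_tuples_def)
      ultimately show "a = b" by (intro PiE_ext)
    qed
    have \<Phi>sub: "\<Phi> ` good_tuples (Suc m) H G \<subseteq> (SIGMA f\<^sub>0:F. slice_points f\<^sub>0 W H)"
    proof
      fix p assume "p \<in> \<Phi> ` good_tuples (Suc m) H G"
      then obtain a where a: "a \<in> good_tuples (Suc m) H G" "p = \<Phi> a" by blast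
      let ?f = "monic_poly (Suc m) a - Polynomial.smult (a 1) W"
      have aH: "\<forall>i\<in>{1..Suc m}. \<bar>real_of_int (a i)\<bar> \<le> H" using a by (simp add: good_tuples_def)
      obtain \<alpha> where \<alpha>: "extended_roots (Suc m) (monic_poly (Suc m) a) \<alpha>" "inj_on \<alpha> {1..Suc m} \<longrightarrow> relperms (Suc m) \<alpha> \<subseteq> G"
        using a by (auto simp: good_tuples_def)
      have a1: "\<bar>real_of_int (a 1)\<bar> \<le> H" using aH by simp
      have cW: "Polynomial.coeff W k = 0" if "k > m" for k using that Wm by (intro coeff_eq_0) simp
      have cf: "Polynomial.coeff ?f k = Polynomial.coeff (monic_poly (Suc m) a) k - a 1 * Polynomial.coeff W k" for k by simp
      have "?f \<in> F" unfolding F_def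
      proof (intro CollectI conjI allI impI)
        show "Polynomial.coeff ?f (Suc m) = 1" unfolding cf by (simp add: coeff_monic_poly cW)
        show "Polynomial.coeff ?f m = 0" unfolding cf by (simp add: coeff_monic_poly Wm)
        show "Polynomial.coeff ?f k = 0" if "k > Suc m" for k unfolding cf using that by (simp add: coeff_monic_poly cW)
        show "\<bar>real_of_int (Polynomial.coeff ?f k)\<bar> \<le> w * H" if k: "k < m" for k
        proof -
          have "Suc m - k \<in> {1..Suc m}" using k by auto
          then have 1: "\<bar>real_of_int (a (Suc m - k))\<bar> \<le> H" using aH by blast
          have "\<bar>real_of_int (Polynomial.coeff ?f k)\<bar> = \<bar>real_of_int (a (Suc m - k)) - real_of_int (a 1) * real_of_int (Polynomial.coeff W k)\<bar>"
            unfolding cf using k by (simp add: coeff_monic_poly)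
          also have "\<dots> \<le> \<bar>real_of_int (a (Suc m - k))\<bar> + \<bar>real_of_int (a 1)\<bar> * \<bar>real_of_int (Polynomial.coeff W k)\<bar>"
            by (rule order_trans[OF abs_triangle_ineq4]) (simp add: abs_mult)
          also have "\<dots> \<le> H + H * \<bar>real_of_int (Polynomial.coeff W k)\<bar>"
            using 1 a1 by (intro add_mono mult_right_mono) auto
          also have "\<dots> = (1 + \<bar>real_of_int (Polynomial.coeff W k)\<bar>) * H" by (simp add: algebra_simps)
          also have "\<dots> \<le> w * H" using w[of k] k H by (intro mult_right_mono) auto
          finally show ?thesis .
        qed
      qed
      moreover have "a 1 \<in> slice_points ?f W H"
        unfolding slice_points_def
      proof (intro CollectI conjI exI[of _ \<alpha>] allI)
        show "extended_roots (Suc m) (?f + Polynomial.smult (a 1) W) \<alpha>" using \<alpha>(1) by simp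
        show "norm (\<alpha> k) \<le> real (Suc m) * H" for k by (rule monic_poly_root_bound[OF aH H _ \<alpha>(1)]) simp
      qed (use a1 \<alpha>(2) in auto)
      ultimately show "p \<in> (SIGMA f\<^sub>0:F. slice_points f\<^sub>0 W H)" by (simp add: a \<Phi>_def)
    qed
    have "card (good_tuples (Suc m) H G) \<le> card (SIGMA f\<^sub>0:F. slice_points f\<^sub>0 W H)"
      by (rule card_inj_on_le[OF \<Phi>inj \<Phi>sub]) (intro finite_SigmaI finF finsp)
    also have "\<dots> = (\<Sum>f\<^sub>0\<in>F. card (slice_points f\<^sub>0 W H))" using finF finsp by (intro card_SigmaI) auto
    finally have "real (card (good_tuples (Suc m) H G)) \<le> (\<Sum>f\<^sub>0\<in>F. real (card (slice_points f\<^sub>0 W H)))"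
      by (metis of_nat_le_iff of_nat_sum)
    also have "\<dots> \<le> (\<Sum>f\<^sub>0\<in>F. C0 * E + (if f\<^sub>0 = bad then 3 * H else 0))"
    proof (rule sum_mono)
      fix f\<^sub>0 assume f: "f\<^sub>0 \<in> F"
      have "C0 * E \<ge> 0" using C00 E1 by simp
      then show "real (card (slice_points f\<^sub>0 W H)) \<le> C0 * E + (if f\<^sub>0 = bad then 3 * H else 0)"
        using spgood[OF f] spbad[of f\<^sub>0] by auto
    qed
    also have "\<dots> = real (card F) * (C0 * E) + (if bad \<in> F then 3 * H else 0)"
      using finF by (simp add: sum.distrib)
    also have "\<dots> \<le> ((2 * w + 1) * H) ^ m * (C0 * E) + 3 * H"
      using cF C00 E1 H by (intro add_mono mult_right_mono) auto
    also have "\<dots> \<le> ((2 * w + 1) * H) ^ m * (C0 * E) + 3 * (H ^ m * E)"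
    proof -
      have "H \<le> H ^ m" using H m by (metis One_nat_def power_increasing power_one_right)
      also have "\<dots> \<le> H ^ m * E" using E1 H by (simp add: mult_le_cancel_left1)
      finally show ?thesis by simp
    qed
    also have "\<dots> = C * (H ^ m * E)" unfolding C_def power_mult_distrib by (simp add: distrib_left distrib_right ac_simps)
    also have "H ^ m * E = H powr (real m + 1 / real (sym_index (Suc m) G) + \<epsilon>)"
    proof -
      have "H ^ m = H powr real m" using H by (intro powr_realpow[symmetric]) simp
      then show ?thesis unfolding E_def card_L by (simp only: powr_add mult.assoc)
    qed
    finally show "real (card (good_tuples (Suc m) H G)) \<le> C * H powr (real m + 1 / real (sym_index (Suc m) G) + \<epsilon>)" .
  qed
qed

section \<open>Polynomials with full symmetric group\<close>

lemma sym_index_proper: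
  assumes G: "subgroup G (sym_group n)" and "G \<noteq> perms n"
  shows "sym_index n G \<ge> 2"
proof -
  interpret perm_group n G by (rule perm_group.intro[OF G])
  have "card L \<noteq> 1"
  proof
    assume "card L = 1"
    then have L: "L = {G}" using G_in_L by (auto simp: card_1_singleton_iff)
    have "perms n \<subseteq> G"
    proof
      fix \<pi> assume "\<pi> \<in> perms n"
      then have "translate \<pi> G \<in> L" by (auto simp: lcos_def)
      then have "translate \<pi> G = G" using L by blast
      moreover have "\<pi> \<in> translate \<pi> G"
        unfolding translate_def by (rule image_eqI[of _ _ id]) (simp_all add: id_G)
      ultimately show "\<pi> \<in> G" by simp
    qed
    moreover have "G \<subseteq> perms n" using G_perms by blast
    ultimately show False using assms(2) by blast
  qed
  then show ?thesis using card_L_pos card_L by linarith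
qed

lemma finite_subgroups: "finite {G. subgroup G (sym_group n)}"
proof (rule finite_subset)
  show "{G. subgroup G (sym_group n)} \<subseteq> Pow (perms n)"
    using subgroup.subset by (fastforce simp: sym_group_def perms_def)
qed simp

text \<open>A polynomial of degree \<open>m\<close> yields the counting bound in degree
  \<open>m + 1\<close>. Proper subgroups have index at least 2, so together they account for
  \<open>O(H powr (m + 3/4))\<close> tuples, fewer than the box contains.\<close>

lemma full_poly_exists:
  "m \<ge> 1 \<Longrightarrow> \<exists>W \<beta>. full_poly m W \<beta>"
proof (induction m rule: nat_induct_at_least)
  case base
  let ?z = "\<lambda>_::nat. 0::complex"
  have p: "perms 1 = {id}" by (auto simp: perms_def)
  have "relperms 1 ?z = {id}"
    using relperms_id[of 1 ?z] p by (auto simp: relperms_def)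
  moreover have "extended_roots 1 [:0, 1:] ?z"
    by (simp add: extended_roots_def root_labelling_def map_poly_pCons)
  ultimately have "full_poly 1 [:0, 1:] ?z" unfolding full_poly_def using p by simp
  then show ?case by blast
next
  case (Suc m)
  then obtain W \<beta> where W: "full_poly m W \<beta>" by blast
  let ?n = "Suc m"
  define \<G> where "\<G> = {G. subgroup G (sym_group ?n) \<and> G \<noteq> perms ?n}"
  have fin: "finite \<G>" by (rule finite_subset[OF _ finite_subgroups[of ?n]]) (auto simp: \<G>_def)
  have "\<exists>C>0. \<forall>H\<ge>1. real (card (good_tuples ?n H G)) \<le> C * H powr (real m + 1 / real (sym_index ?n G) + 1 / 4)" if "G \<in> \<G>" for G
    using that good_tuples_count_Suc[OF Suc.hyps W, of G "1/4"] by (auto simp: \<G>_def)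
  then obtain C where C0: "\<And>G. G \<in> \<G> \<Longrightarrow> C G > (0::real)" and
    C: "\<And>G H. G \<in> \<G> \<Longrightarrow> H \<ge> 1 \<Longrightarrow> real (card (good_tuples ?n H G)) \<le> C G * H powr (real m + 1 / real (sym_index ?n G) + 1 / 4)"
    by metis
  define S where "S = (\<Sum>G\<in>\<G>. C G)"
  have S0: "S \<ge> 0" unfolding S_def using C0 by (intro sum_nonneg) (auto intro: less_imp_le)
  \<comment> \<open>Large enough for \<open>H powr (1/4) \<ge> S + 1\<close>, which contradicts the
    bound \<open>S\<close> obtained below.\<close>
  define k where "k = nat \<lceil>(S + 1) ^ 4\<rceil> + 1"
  define H where "H = real k"
  have "k \<ge> 1" unfolding k_def by (rule le_add2)
  then have k1: "H \<ge> 1" unfolding H_def by linarith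
  have kS: "(S + 1) ^ 4 \<le> H" unfolding H_def k_def by linarith
  show ?case
  proof (rule ccontr)
    assume neg: "\<nexists>W \<beta>. full_poly ?n W \<beta>"
    define Bx where "Bx = {1..?n} \<rightarrow>\<^sub>E {0..int k}"
    have "Bx \<subseteq> (\<Union>G\<in>\<G>. good_tuples ?n H G)"
    proof
      fix a assume a: "a \<in> Bx"
      then have aH: "a \<in> {1..?n} \<rightarrow>\<^sub>E UNIV" "\<forall>i\<in>{1..?n}. \<bar>real_of_int (a i)\<bar> \<le> H"
        by (auto simp: Bx_def H_def PiE_def Pi_def)
      have cf: "Polynomial.coeff (monic_poly ?n a) j = 0" if "j > ?n" for j using that by (simp add: coeff_monic_poly)
      have c1: "Polynomial.coeff (monic_poly ?n a) ?n = 1" by (simp add: coeff_monic_poly)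
      have "Polynomial.degree (monic_poly ?n a) = ?n"
        using cf c1 by (intro antisym degree_le le_degree) auto
      then obtain \<alpha> where \<alpha>: "extended_roots ?n (monic_poly ?n a) \<alpha>" using c1 by (rule extended_roots_exist)
      show "a \<in> (\<Union>G\<in>\<G>. good_tuples ?n H G)"
      proof (cases "inj_on \<alpha> {1..?n}")
        case True
        then have "relperms ?n \<alpha> \<noteq> perms ?n" using neg \<alpha> by (auto simp: full_poly_def)
        then have "relperms ?n \<alpha> \<in> \<G>" by (simp add: \<G>_def subgroup_relperms)
        moreover have "a \<in> good_tuples ?n H (relperms ?n \<alpha>)" using aH \<alpha> by (auto simp: good_tuples_def)
        ultimately show ?thesis by blast
      next
        \<comment> \<open>A tuple with repeated roots belongs to every set, so the trivial group can
          take it; that group is proper because the degree is at least 2.\<close>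
        case False
        have tr: "Transposition.transpose 1 2 \<in> perms ?n"
          using Suc.hyps by (auto intro: permutes_swap_id)
        have "{id} \<noteq> perms ?n"
        proof
          assume "{id} = perms ?n"
          then have "Transposition.transpose 1 2 = (id :: nat \<Rightarrow> nat)" using tr by blast
          then have "Transposition.transpose 1 2 (1::nat) = id 1" by (rule fun_cong)
          then show False by simp
        qed
        moreover have "subgroup {id} (sym_group ?n)"
          using group.triv_subgroup[OF sym_group_is_group[of ?n]] by (simp add: sym_group_def)
        ultimately have "{id} \<in> \<G>" by (simp add: \<G>_def)
        moreover have "a \<in> good_tuples ?n H {id}" using aH \<alpha> False by (auto simp: good_tuples_def)
        ultimately show ?thesis by blast
      qed
    qed
    moreover have fu: "finite (\<Union>G\<in>\<G>. good_tuples ?n H G)"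
      using fin k1 by (intro finite_UN_I finite_good_tuples) auto
    ultimately have "card Bx \<le> card (\<Union>G\<in>\<G>. good_tuples ?n H G)" by (rule card_mono[rotated])
    also have "\<dots> \<le> (\<Sum>G\<in>\<G>. card (good_tuples ?n H G))" by (rule card_UN_le[OF fin])
    finally have "real (card Bx) \<le> (\<Sum>G\<in>\<G>. real (card (good_tuples ?n H G)))"
      by (metis of_nat_le_iff of_nat_sum)
    also have "\<dots> \<le> (\<Sum>G\<in>\<G>. C G * H powr (real m + 3 / 4))"
    proof (rule sum_mono)
      fix G assume G: "G \<in> \<G>"
      have "2 \<le> sym_index ?n G" using G sym_index_proper by (auto simp: \<G>_def)
      then have "1 / real (sym_index ?n G) \<le> 1 / 2" by (simp add: field_simps)
      then have "H powr (real m + 1 / real (sym_index ?n G) + 1 / 4) \<le> H powr (real m + 3 / 4)"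
        using k1 by (intro powr_mono) auto
      then have "C G * H powr (real m + 1 / real (sym_index ?n G) + 1 / 4) \<le> C G * H powr (real m + 3 / 4)"
        using C0[OF G] by (intro mult_left_mono) auto
      then show "real (card (good_tuples ?n H G)) \<le> C G * H powr (real m + 3 / 4)"
        using C[OF G k1] by linarith
    qed
    also have "\<dots> = S * H powr (real m + 3 / 4)" by (simp add: S_def sum_distrib_right)
    finally have 1: "real (card Bx) \<le> S * H powr (real m + 3 / 4)" .
    have "card Bx = (k + 1) ^ ?n" by (simp add: Bx_def card_PiE nat_add_distrib)
    then have "real (card Bx) = real (k + 1) ^ ?n" by (simp only: of_nat_power)
    also have "real (k + 1) = H + 1" by (simp add: H_def)
    finally have "real (card Bx) = (H + 1) ^ ?n" .
    moreover have "H ^ ?n \<le> (H + 1) ^ ?n" using k1 by (intro power_mono) auto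
    moreover have "H ^ ?n = H powr (real m + 3 / 4) * H powr (1 / 4)"
    proof -
      have "H powr (real m + 3 / 4) * H powr (1 / 4) = H powr (real m + 3 / 4 + 1 / 4)" by (rule powr_add[symmetric])
      also have "real m + 3 / 4 + 1 / 4 = real ?n" by simp
      also have "H powr real ?n = H ^ ?n" using k1 by (intro powr_realpow) simp
      finally show ?thesis by (rule sym)
    qed
    ultimately have 2: "H powr (real m + 3 / 4) * H powr (1 / 4) \<le> S * H powr (real m + 3 / 4)" using 1 by linarith
    have "H powr (real m + 3 / 4) > 0" using k1 by simp
    then have "H powr (1 / 4) \<le> S" using 2 by (simp add: mult.commute[of S])
    moreover have "S + 1 \<le> H powr (1 / 4)"
    proof -
      have "(S + 1) ^ 4 = (S + 1) powr 4" using S0 by (simp add: powr_numeral)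
      then have "((S + 1) ^ 4) powr (1 / 4) = (S + 1) powr (4 * (1 / 4))" by (simp only: powr_powr)
      then have "S + 1 = ((S + 1) ^ 4) powr (1 / 4)" using S0 by simp
      also have "\<dots> \<le> H powr (1 / 4)" using kS S0 by (intro powr_mono2) auto
      finally show ?thesis .
    qed
    ultimately show False by linarith
  qed
qed

lemma galois_count_le_good_tuples:
  assumes G: "subgroup G (sym_group n)" and H: "H \<ge> 1"
  shows "galois_count n H G \<le> card (good_tuples n H G)"
proof -
  interpret perm_group n G by (rule perm_group.intro[OF G])
  have "{a \<in> {1..n} \<rightarrow>\<^sub>E (UNIV :: int set). (\<forall>i\<in>{1..n}. \<bar>real_of_int (a i)\<bar> \<le> H) \<and> has_galois_group n (monic_poly n a) G}
    \<subseteq> good_tuples n H G"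
  proof
    fix a assume a: "a \<in> {a \<in> {1..n} \<rightarrow>\<^sub>E (UNIV :: int set). (\<forall>i\<in>{1..n}. \<bar>real_of_int (a i)\<bar> \<le> H) \<and> has_galois_group n (monic_poly n a) G}"
    then obtain \<alpha> \<phi> where \<alpha>: "root_labelling n (monic_poly n a) \<alpha>"
      and iso: "\<phi> \<in> iso (galois_group (monic_poly n a)) ((sym_group n)\<lparr>carrier := G\<rparr>)"
      and compat: "\<forall>\<sigma>\<in>carrier (galois_group (monic_poly n a)). \<forall>i\<in>{1..n}. \<sigma> (\<alpha> i) = \<alpha> (\<phi> \<sigma> i)"
      by (auto simp: has_galois_group_def)
    \<comment> \<open>A labelling is arbitrary outside \<open>1..n\<close>; resetting it to 0 there
      leaves the compatibility with \<open>\<phi>\<close> intact.\<close>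
    define \<alpha>' where "\<alpha>' k = (if k \<in> {1..n} then \<alpha> k else 0)" for k
    have eq: "\<alpha>' k = \<alpha> k" if "k \<in> {1..n}" for k using that by (simp add: \<alpha>'_def)
    have "(\<Prod>i=1..n. [:- \<alpha>' i, 1:]) = (\<Prod>i=1..n. [:- \<alpha> i, 1:])"
      by (intro prod.cong refl) (simp only: eq)
    then have r: "extended_roots n (monic_poly n a) \<alpha>'"
      using \<alpha> unfolding extended_roots_def root_labelling_def by (auto simp: \<alpha>'_def)
    have "relperms n \<alpha>' \<subseteq> G" if inj: "inj_on \<alpha>' {1..n}"
    proof (rule relperms_subset_galois[OF r inj iso])
      show "G \<subseteq> perms n" using G_perms by blast
      show "\<forall>\<sigma>\<in>carrier (galois_group (monic_poly n a)). \<forall>i\<in>{1..n}. \<sigma> (\<alpha>' i) = \<alpha>' (\<phi> \<sigma> i)"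
      proof (intro ballI)
        fix \<sigma> i assume s: "\<sigma> \<in> carrier (galois_group (monic_poly n a))" and i: "i \<in> {1..n}"
        have "\<phi> \<sigma> \<in> G" using iso s by (auto simp: iso_def hom_def)
        then have "\<phi> \<sigma> i \<in> {1..n}" using perms_in[OF G_perms i] by blast
        then show "\<sigma> (\<alpha>' i) = \<alpha>' (\<phi> \<sigma> i)" using compat s i eq by metis
      qed
    qed
    then show "a \<in> good_tuples n H G" using a r unfolding good_tuples_def by blast
  qed
  then show ?thesis unfolding galois_count_def
    using H by (intro card_mono finite_good_tuples) auto
qed

lemma galois_count_bound:
  assumes n: "n \<ge> 1" and \<epsilon>: "\<epsilon> > 0" and G: "subgroup G (sym_group n)"
  shows "\<exists>C>0. \<forall>H\<ge>1. real (galois_count n H G) \<le> C * H powr (real n - 1 + 1 / real (sym_index n G) + \<epsilon>)"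
proof (cases "n = 1")
  \<comment> \<open>In degree 1 there is no slice, as \<open>W\<close> would have degree 0. The
    index is 1, so the exponent is at least 1 and the size of the box is bound enough.\<close>
  case True
  interpret perm_group n G by (rule perm_group.intro[OF G])
  have "perms n = {id}" using True by (auto simp: perms_def)
  then have "G = {id}" using G_perms id_G by blast
  then have "L = {{id}}" using \<open>perms n = {id}\<close> by (simp add: lcos_def)
  then have idx: "sym_index n G = 1" using card_L by simp
  show ?thesis
  proof (intro exI[of _ 3] conjI allI impI)
    fix H :: real assume H: "H \<ge> 1"
    have "good_tuples n H G \<subseteq> {a \<in> {1..n} \<rightarrow>\<^sub>E (UNIV :: int set). \<forall>i\<in>{1..n}. \<bar>real_of_int (a i)\<bar> \<le> H}"
      by (auto simp: good_tuples_def)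
    then have le: "card (good_tuples n H G) \<le> card {a \<in> {1..n} \<rightarrow>\<^sub>E (UNIV :: int set). \<forall>i\<in>{1..n}. \<bar>real_of_int (a i)\<bar> \<le> H}"
      using card_box(1)[of "{1..n}" H] H by (intro card_mono) auto
    then have "real (galois_count n H G) \<le> (2 * H + 1) ^ card {1..n}"
    proof -
      have "real (card {a \<in> {1..n} \<rightarrow>\<^sub>E (UNIV :: int set). \<forall>i\<in>{1..n}. \<bar>real_of_int (a i)\<bar> \<le> H}) \<le> (2 * H + 1) ^ card {1..n}"
        by (rule card_box(2)) (use H in auto)
      then show ?thesis using galois_count_le_good_tuples[OF G H] le by linarith
    qed
    also have "\<dots> = 2 * H + 1" using True by simp
    also have "\<dots> \<le> 3 * H powr 1" using H by simp
    also have "\<dots> \<le> 3 * H powr (real n - 1 + 1 / real (sym_index n G) + \<epsilon>)"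
      using H \<epsilon> True idx by (intro mult_left_mono powr_mono) auto
    finally show "real (galois_count n H G) \<le> 3 * H powr (real n - 1 + 1 / real (sym_index n G) + \<epsilon>)" .
  qed simp
next
  case False
  then obtain m where m: "n = Suc m" "m \<ge> 1" using n by (cases n) auto
  obtain W \<beta> where W: "full_poly m W \<beta>" using full_poly_exists[OF m(2)] by blast
  obtain C where C: "C > 0" "\<And>H. H \<ge> 1 \<Longrightarrow> real (card (good_tuples (Suc m) H G)) \<le> C * H powr (real m + 1 / real (sym_index (Suc m) G) + \<epsilon>)"
    using good_tuples_count_Suc[OF m(2) W _ \<epsilon>, of G] G m by blast
  show ?thesis
  proof (intro exI[of _ C] conjI allI impI)
    fix H :: real assume H: "H \<ge> 1"
    have "real (galois_count n H G) \<le> real (card (good_tuples (Suc m) H G))"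
      using galois_count_le_good_tuples[OF G H] m by simp
    also have "\<dots> \<le> C * H powr (real n - 1 + 1 / real (sym_index n G) + \<epsilon>)"
      using C(2)[OF H] m by simp
    finally show "real (galois_count n H G) \<le> C * H powr (real n - 1 + 1 / real (sym_index n G) + \<epsilon>)" .
  qed (rule C(1))
qed

theorem theorem1:
  fixes n :: nat and \<epsilon> :: real
  assumes "n \<ge> 1" and "\<epsilon> > 0"
  shows "\<exists>C>0. \<forall>G. subgroup G (sym_group n) \<longrightarrow>
           (\<forall>H::real. H \<ge> 1 \<longrightarrow>
              real (galois_count n H G)
                \<le> C * H powr (real n - 1 + 1 / real (sym_index n G) + \<epsilon>))"
proof -
  let ?\<G> = "{G. subgroup G (sym_group n)}"
  have "\<exists>C>0. \<forall>H\<ge>1. real (galois_count n H G) \<le> C * H powr (real n - 1 + 1 / real (sym_index n G) + \<epsilon>)"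
    if "G \<in> ?\<G>" for G
    using galois_count_bound[OF assms, of G] that by blast
  then obtain C where C0: "\<And>G. G \<in> ?\<G> \<Longrightarrow> C G > (0::real)"
    and C: "\<And>G H. G \<in> ?\<G> \<Longrightarrow> H \<ge> 1 \<Longrightarrow> real (galois_count n H G) \<le> C G * H powr (real n - 1 + 1 / real (sym_index n G) + \<epsilon>)"
    by metis
  have nonneg: "(\<Sum>G\<in>?\<G>. C G) \<ge> 0" using C0 by (intro sum_nonneg) (auto intro: less_imp_le)
  show ?thesis
  \<comment> \<open>There are finitely many subgroups, so the sum of their constants depends on
    \<open>n\<close> and \<open>\<epsilon>\<close> only.\<close>
  proof (intro exI[of _ "(\<Sum>G\<in>?\<G>. C G) + 1"] conjI allI impI)
    show "(\<Sum>G\<in>?\<G>. C G) + 1 > 0" using nonneg by linarith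
    fix G and H :: real assume G: "subgroup G (sym_group n)" and H: "H \<ge> 1"
    have "C G \<le> (\<Sum>G\<in>?\<G>. C G)"
      using G C0 finite_subgroups by (intro member_le_sum) (auto intro: less_imp_le)
    then have le: "C G \<le> (\<Sum>G\<in>?\<G>. C G) + 1" by linarith
    have "real (galois_count n H G) \<le> C G * H powr (real n - 1 + 1 / real (sym_index n G) + \<epsilon>)"
      using C[OF _ H] G by blast
    also have "\<dots> \<le> ((\<Sum>G\<in>?\<G>. C G) + 1) * H powr (real n - 1 + 1 / real (sym_index n G) + \<epsilon>)"
      by (rule mult_right_mono[OF le]) simp
    finally show "real (galois_count n H G) \<le> ((\<Sum>G\<in>?\<G>. C G) + 1) * H powr (real n - 1 + 1 / real (sym_index n G) + \<epsilon>)" .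
  qed
qed

end
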